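(* Assume that the family of conformity scores $\mathfrak{C}$ is stable. Then prediction sets based on $n$-fold cross-conformal prediction are asymptotically equivalent to full conformal prediction sets in the following sense: (i) The statement "for all $\delta,\epsilon>0$: $\lim_{n\to\infty}\mathbb{P}\big(\sup_{\alpha\in[0,1]}[\mathbb{P}(y_{n+1}\notin PS^{\mathrm{fc}}_{n,\alpha}(\delta)\,\|\,\mathcal{T}_n)-\alpha]\ge\epsilon\big)=0$" holds if and only if the same statement holds with $PS^{\mathrm{fc}}$ replaced by $PS^{\mathrm{cc}}$. (ii) If, additionally, the continuous case assumption CC is fulfilled, then $\lim_{n\to\infty}\mathbb{E}\big(\sup_{\alpha\in[0,1]}|\mathbb{P}(y_{n+1}\notin PS^{\mathrm{fc}}_{n,\alpha}(0)\,\|\,\mathcal{T}_n)-\alpha|\big)=0$ if and only if the same holds with $PS^{\mathrm{fc}}$ replaced by $PS^{\mathrm{cc}}$. If, moreover, the conformity score is bounded in probability (i.e. $(\mathcal{C}_n(t_{n+1},\mathcal{T}_n))_{n\in\mathbb{N}}$ is stochastically bounded), then for all $\delta>0$ and $\epsilon>0$ $$\lim_{n\to\infty}\mathbb{P}\Big(\sup_{\alpha\in[0,1]}\big[\mathbb{P}(y_{n+1}\notin PS^{\mathrm{cc}}_{n,\alpha}(\delta)\,\|\,\mathcal{T}_n)-\alpha\big]\ge\epsilon\Big)=0,$$ and, under the additional assumption CC, $$\lim_{n\to\infty}\mathbb{E}\Big(\sup_{\alpha\in[0,1]}\big|\mathbb{P}(y_{n+1}\notin PS^{\mathrm{cc}}_{n,\alpha}(0)\,\|\,\mathcal{T}_n)-\alpha\big|\Big)=0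 .$$
   Context: Setting. For every $n\in\mathbb{N}$, $P_n$ is a regular Borel probability measure on $\mathcal{Z}_n=\mathcal{Y}_n\times\mathcal{X}_n$, where $\mathcal{Y}_n\subseteq\mathbb{R}$ is a (possibly unbounded) interval and $\mathcal{X}_n$ is a Euclidean space of dimension $p_n\in\mathbb{N}$. For each $n$, $t_i=t_i^{(n)}=(y_i,x_i)$, $1\le i\le n+1$, are i.i.d. with distribution $P_n$ (which may depend on $n$). Put $\mathcal{T}_n=(t_1,\dots,t_n)$, and let $\mathcal{T}_n^{\setminus i}$ denote $\mathcal{T}_n$ with $t_i$ removed. $\mathbb{P}(\cdot\,\|\,\mathcal{T}_n)$ denotes conditional probability given $\mathcal{T}_n$. Conformity scores. $\mathfrak{C}=(\mathcal{C}^{(n)}_m)_{n,m\in\mathbb{N}}$ is a family of measurable functions $\mathcal{C}^{(n)}_m:\mathcal{Z}_n\times\mathcal{Z}_n^m\to\mathbb{R}$ that are symmetric in their second argument (invariant under permutations of the $m$ entries); the superscript $(n)$ is dropped. $\mathfrak{C}$ is called stable if $|\mathcal{C}_n(t_{n+1},\mathcal{T}_n)-\mathcal{C}_{n-1}(t_{n+1},\mathcal{T}_n^{\setminus n})|\to 0$ in probability as $n\to\infty$. Continuous case assumption (CC): for every $n\in\mathbb{N}$ and almost every $\mathcal{T}_n$, the distribution of $\mathcal{C}_n(t_{n+1},\mathcal{T}_n)$ conditional on $\mathcal{T}_n$ is absolutely continuous with density $f_{\mathcal{T}_n}$, and $(\|f_{\mathcal{T}_n}\|_\infty)_{n\in\mathbb{N}}$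 is stochastically bounded, where $\|f\|_\infty=\sup_{x}|f(x)|$. Quantiles. For a cdf $F$ and $\alpha\in\mathbb{R}$, $F^{-1}(\alpha)=\inf\{x\in\mathbb{R}:F(x)\ge\alpha\}\in[-\infty,\infty]$ with $\inf\emptyset=+\infty$. For real $c$, $c\le+\infty$ is true and $c\le-\infty$ is false. Full conformal prediction sets. For $y\in\mathcal{Y}_n$ let $\mathcal{D}_{n+1}^y=(t_1,\dots,t_n,(y,x_{n+1}))$ and $$\hat F_y(s)=\frac{1}{n+1}\mathds{1}\{\mathcal{C}_n((y,x_{n+1}),\mathcal{T}_n)\le s\}+\frac1{n+1}\sum_{i=1}^n\mathds{1}\{\mathcal{C}_n(t_i,\mathcal{D}_{n+1}^y\setminus t_i)\le s\},$$ where $\mathcal{D}_{n+1}^y\setminus t_i$ is $\mathcal{D}_{n+1}^y$ with its $i$-th entry removed. For $\alpha,\delta\in\mathbb{R}$, $PS^{\mathrm{fc}}_{n,\alpha}(\delta)=\{y\in\mathcal{Y}_n:\mathcal{C}_n((y,x_{n+1}),\mathcal{T}_n)\le\hat F_y^{-1}(1-\alpha)+\delta\}$. $n$-fold cross-conformal prediction sets. For $\delta\ge0$, $$PS^{\mathrm{cc}}_{n,\alpha}(\delta)=\Big\{y\in\mathcal{Y}_n:1+\sum_{i=1}^n\mathds{1}\{\mathcal{C}_{n-1}((y,x_{n+1}),\mathcal{T}_n^{\setminus i})\le\mathcal{C}_{n-1}(t_i,\mathcal{T}_n^{\setminus i})+\delta\}>\alpha(n+1)\Big\}.$$ *)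

theory Defs
  imports "HOL-Probability.Probability"
begin

text \<open>
  An observation is a pair \<open>(y, x)\<close>. The covariate space is the Euclidean space of dimension \<open>p\<close>,
  represented by the product of \<open>p\<close> copies of the real line over the index set \<open>{1..p}\<close>, so that \<open>p\<close>
  may vary with \<open>n\<close>. The product sigma-algebra is the Borel sigma-algebra, and every probability
  measure on it is regular, since the space is Polish.
\<close>

type_synonym obs = "real \<times> (nat \<Rightarrow> real)"

definition obs_space :: "real set \<Rightarrow> nat \<Rightarrow> obs measure" where
  "obs_space Y p = restrict_space borel Y \<Otimes>\<^sub>M (\<Pi>\<^sub>M j\<in>{1..p}. borel)"

text \<open>The entries of a sample of size \<open>m\<close> are indexed by \<open>{1..m}\<close>.\<close>

definition sample_space :: "real set \<Rightarrow> nat \<Rightarrow> nat \<Rightarrow> (nat \<Rightarrow> obs) measure" where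
  "sample_space Y p m = (\<Pi>\<^sub>M i\<in>{1..m}. obs_space Y p)"

definition training :: "(nat \<Rightarrow> 'a \<Rightarrow> 'z) \<Rightarrow> nat \<Rightarrow> 'a \<Rightarrow> nat \<Rightarrow> 'z" where
  "training t n \<omega> = (\<lambda>i\<in>{1..n}. t i \<omega>)"

text \<open>The sample of size \<open>m - 1\<close> left after removing the \<open>i\<close>-th of \<open>m\<close> entries; later entries move up.\<close>

definition remove_entry :: "nat \<Rightarrow> nat \<Rightarrow> (nat \<Rightarrow> 'z) \<Rightarrow> nat \<Rightarrow> 'z" where
  "remove_entry m i \<tau> = (\<lambda>j\<in>{1..m - 1}. if j < i then \<tau> j else \<tau> (Suc j))"

text \<open>
  \<open>K\<close> is a regular conditional distribution of \<open>Z\<close> given \<open>X\<close>. Suprema of conditional probabilities over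
  an uncountable index set only make sense for such a version. The conditional distribution
  of \<open>g (X, Z)\<close> given \<open>X\<close> is then the image of \<open>K (X \<omega>)\<close> under \<open>\<lambda>z. g (X \<omega>, z)\<close>.
  If \<open>X\<close> and \<open>Z\<close> are independent, the constant kernel with value the law of \<open>Z\<close> is such a version.
\<close>

definition regular_cond_distr ::
  "'a measure \<Rightarrow> 'b measure \<Rightarrow> 'c measure \<Rightarrow> ('a \<Rightarrow> 'b) \<Rightarrow> ('a \<Rightarrow> 'c) \<Rightarrow> ('b \<Rightarrow> 'c measure) \<Rightarrow> bool" where
  "regular_cond_distr M N L X Z K \<longleftrightarrow>
     K \<in> N \<rightarrow>\<^sub>M prob_algebra L \<and>
     (\<forall>B\<in>sets L. AE \<omega> in M.
        real_cond_exp M (vimage_algebra (space M) X N) (indicator (Z -` B \<inter> space M)) \<omega>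
          = measure (K (X \<omega>)) B)"

text \<open>A family of conformity scores: \<open>C n m z \<tau>\<close> is $\mathcal{C}^{(n)}_m(z, \tau)$.\<close>

type_synonym score = "nat \<Rightarrow> nat \<Rightarrow> obs \<Rightarrow> (nat \<Rightarrow> obs) \<Rightarrow> real"

definition conformity_scores :: "(nat \<Rightarrow> real set) \<Rightarrow> (nat \<Rightarrow> nat) \<Rightarrow> score \<Rightarrow> bool" where
  "conformity_scores Y p C \<longleftrightarrow> (\<forall>n\<ge>1. \<forall>m\<ge>1.
     (\<lambda>(z, \<tau>). C n m z \<tau>)
       \<in> borel_measurable (obs_space (Y n) (p n) \<Otimes>\<^sub>M sample_space (Y n) (p n) m) \<and>
     (\<forall>z\<in>space (obs_space (Y n) (p n)). \<forall>\<tau>\<in>space (sample_space (Y n) (p n) m).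
        \<forall>\<pi>. \<pi> permutes {1..m} \<longrightarrow> C n m z (\<tau> \<circ> \<pi>) = C n m z \<tau>))"

definition stable_scores :: "(nat \<Rightarrow> 'a measure) \<Rightarrow> (nat \<Rightarrow> nat \<Rightarrow> 'a \<Rightarrow> obs) \<Rightarrow> score \<Rightarrow> bool" where
  "stable_scores M t C \<longleftrightarrow> (\<forall>\<epsilon>>0.
     (\<lambda>n. measure (M n) {\<omega>\<in>space (M n).
        \<bar>C n n (t n (n + 1) \<omega>) (training (t n) n \<omega>)
          - C n (n - 1) (t n (n + 1) \<omega>) (remove_entry n n (training (t n) n \<omega>))\<bar> > \<epsilon>})
     \<longlonglongrightarrow> 0)"

text \<open>
  Stated with the outer measure because it is applied below to the supremum norm of a random density,
  which need not be measurable.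
\<close>

definition stochastically_bounded :: "(nat \<Rightarrow> 'a measure) \<Rightarrow> (nat \<Rightarrow> 'a \<Rightarrow> ennreal) \<Rightarrow> bool" where
  "stochastically_bounded M X \<longleftrightarrow> (\<forall>\<epsilon>>0. \<exists>B::real. \<forall>n\<ge>1.
     outer_measure_of (M n) {\<omega>\<in>space (M n). X n \<omega> > ennreal B} \<le> ennreal \<epsilon>)"

definition bounded_scores :: "(nat \<Rightarrow> 'a measure) \<Rightarrow> (nat \<Rightarrow> nat \<Rightarrow> 'a \<Rightarrow> obs) \<Rightarrow> score \<Rightarrow> bool" where
  "bounded_scores M t C \<longleftrightarrow>
     stochastically_bounded M (\<lambda>n \<omega>. ennreal \<bar>C n n (t n (n + 1) \<omega>) (training (t n) n \<omega>)\<bar>)"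

definition continuous_case ::
  "(nat \<Rightarrow> 'a measure) \<Rightarrow> (nat \<Rightarrow> nat \<Rightarrow> 'a \<Rightarrow> obs) \<Rightarrow> (nat \<Rightarrow> (nat \<Rightarrow> obs) \<Rightarrow> obs measure) \<Rightarrow> score \<Rightarrow> bool"
  where
  "continuous_case M t K C \<longleftrightarrow> (\<exists>f :: nat \<Rightarrow> (nat \<Rightarrow> obs) \<Rightarrow> real \<Rightarrow> real.
     (\<forall>n\<ge>1. AE \<omega> in M n.
        (\<forall>x. 0 \<le> f n (training (t n) n \<omega>) x) \<and>
        distributed (K n (training (t n) n \<omega>)) lborel
          (\<lambda>z. C n n z (training (t n) n \<omega>)) (\<lambda>x. ennreal (f n (training (t n) n \<omega>) x))) \<and>
     stochastically_bounded M (\<lambda>n \<omega>. SUP x. ennreal \<bar>f n (training (t n) n \<omega>) x\<bar>))"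

definition quantile :: "(real \<Rightarrow> real) \<Rightarrow> real \<Rightarrow> ereal" where
  "quantile F \<beta> = Inf (ereal ` {x. F x \<ge> \<beta>})"

definition full_conformal_cdf :: "score \<Rightarrow> nat \<Rightarrow> (nat \<Rightarrow> obs) \<Rightarrow> (nat \<Rightarrow> real) \<Rightarrow> real \<Rightarrow> real \<Rightarrow> real" where
  "full_conformal_cdf C n \<tau> x y s =
     1 / (real n + 1) * of_bool (C n n (y, x) \<tau> \<le> s)
     + 1 / (real n + 1) * (\<Sum>i=1..n.
         of_bool (C n n (\<tau> i) (remove_entry (n + 1) i (\<tau>(n + 1 := (y, x)))) \<le> s))"

text \<open>
  The prediction sets take \<open>n\<close>, the training sample \<open>\<tau>\<close>, the new covariate \<open>x\<close>, the level \<open>\<alpha>\<close> and the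
  enlargement \<open>\<delta>\<close>.
\<close>

type_synonym prediction_sets = "nat \<Rightarrow> (nat \<Rightarrow> obs) \<Rightarrow> (nat \<Rightarrow> real) \<Rightarrow> real \<Rightarrow> real \<Rightarrow> real set"

definition PS_fc :: "(nat \<Rightarrow> real set) \<Rightarrow> score \<Rightarrow> prediction_sets" where
  "PS_fc Y C n \<tau> x \<alpha> \<delta> =
     {y\<in>Y n. ereal (C n n (y, x) \<tau>) \<le> quantile (full_conformal_cdf C n \<tau> x y) (1 - \<alpha>) + ereal \<delta>}"

definition PS_cc :: "(nat \<Rightarrow> real set) \<Rightarrow> score \<Rightarrow> prediction_sets" where
  "PS_cc Y C n \<tau> x \<alpha> \<delta> =
     {y\<in>Y n. 1 + (\<Sum>i=1..n. of_bool
        (C n (n - 1) (y, x) (remove_entry n i \<tau>) \<le> C n (n - 1) (\<tau> i) (remove_entry n i \<tau>) + \<delta>))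
      > \<alpha> * (real n + 1)}"

text \<open>
  The conditional probability that \<open>y\<close> is not in \<open>PS\<close>, where \<open>(y, x)\<close> is the new observation, whose
  conditional distribution given the training sample \<open>\<tau>\<close> is \<open>K n \<tau>\<close>.
\<close>

definition noncoverage ::
  "(nat \<Rightarrow> (nat \<Rightarrow> obs) \<Rightarrow> obs measure) \<Rightarrow> prediction_sets \<Rightarrow> nat \<Rightarrow> (nat \<Rightarrow> obs) \<Rightarrow> real \<Rightarrow> real \<Rightarrow> real"
  where
  "noncoverage K PS n \<tau> \<alpha> \<delta> =
     measure (K n \<tau>) {(y, x) \<in> space (K n \<tau>). y \<notin> PS n \<tau> x \<alpha> \<delta>}"

definition asymp_conservative ::
  "(nat \<Rightarrow> 'a measure) \<Rightarrow> (nat \<Rightarrow> nat \<Rightarrow> 'a \<Rightarrow> obs) \<Rightarrow> (nat \<Rightarrow> (nat \<Rightarrow> obs) \<Rightarrow> obs measure)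
    \<Rightarrow> prediction_sets \<Rightarrow> bool" where
  "asymp_conservative M t K PS \<longleftrightarrow> (\<forall>\<delta>>0. \<forall>\<epsilon>>0.
     (\<lambda>n. measure (M n) {\<omega>\<in>space (M n).
        (SUP \<alpha>\<in>{0..1}. noncoverage K PS n (training (t n) n \<omega>) \<alpha> \<delta> - \<alpha>) \<ge> \<epsilon>})
     \<longlonglongrightarrow> 0)"

definition asymp_exact ::
  "(nat \<Rightarrow> 'a measure) \<Rightarrow> (nat \<Rightarrow> nat \<Rightarrow> 'a \<Rightarrow> obs) \<Rightarrow> (nat \<Rightarrow> (nat \<Rightarrow> obs) \<Rightarrow> obs measure)
    \<Rightarrow> prediction_sets \<Rightarrow> bool" where
  "asymp_exact M t K PS \<longleftrightarrow>
     (\<lambda>n. \<integral>\<omega>. (SUP \<alpha>\<in>{0..1}. \<bar>noncoverage K PS n (training (t n) n \<omega>) \<alpha> 0 - \<alpha>\<bar>) \<partial>M n)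
     \<longlonglongrightarrow> 0"

end

theory Submission
  imports Defs
begin

text \<open>
  Both kinds of prediction sets are rank sets: for the observation \<open>z\<close> appended to the training sample
  \<open>\<tau>\<close>, the response is not covered iff \<open>N \<le> \<alpha> (n + 1)\<close>, where \<open>N\<close> is one plus the number of \<open>i\<close> such that
  the score of \<open>z\<close> is at most the score of \<open>t_i\<close> plus \<open>\<delta>\<close>. Write \<open>A_i\<close> (\<open>loo\<close>) for the score of \<open>t_i\<close>
  relative to the \<open>n\<close> other observations among \<open>t_1, ..., t_{n+1}\<close>, and \<open>L_{i,j}\<close> (\<open>lto\<close>) for the score
  relative to these without \<open>t_j\<close>. Then full conformal prediction compares \<open>A_{n+1}\<close> with \<open>A_i\<close>, and
  cross-conformal prediction compares \<open>L_{n+1,i}\<close> with \<open>L_{i,n+1}\<close>. Both are related to the hybrid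
  (jackknife) count, which compares \<open>A_{n+1}\<close> with \<open>L_{i,n+1}\<close>.
  
  By exchangeability, \<open>A_i - L_{i,j}\<close> has the same distribution for all \<open>i \<noteq> j\<close>, so that stability makes
  all these differences small. Hence, with \<open>\<delta>\<close> enlarged by \<open>\<eta>\<close>, each count is at most the other one plus
  a remainder with expectation \<open>o(n)\<close>, and a comparison lemma (\<open>integral_excess_le\<close>,
  \<open>integral_deficit_le\<close>) carries the one-sided deviations
  \<open>sup_\<alpha> (noncoverage - \<alpha>)\<close> and \<open>sup_\<alpha> (\<alpha> - noncoverage)\<close> from one count to the other. This is the
  equivalence for \<open>\<delta> > 0\<close>. If the density of \<open>A_{n+1}\<close> given the training sample is stochastically
  bounded, \<open>A_{n+1}\<close> is unlikely to be within \<open>\<eta>\<close> of \<open>L_{i,n+1}\<close>, which is a function of the training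
  sample. Then changing \<open>\<delta> = 0\<close> by \<open>\<eta>\<close> changes few summands, and the equivalence for \<open>\<delta> = 0\<close> follows.
  
  For bounded scores the jackknife count is treated directly. For a Lipschitz function \<open>\<phi>\<close> with values
  in \<open>[0, 1]\<close>, the mean of \<open>\<phi> (L_{i,n+1})\<close> over \<open>i\<close> and the conditional expectation of \<open>\<phi> (A_{n+1})\<close> given
  the training sample are close in mean square (\<open>integral_sq_deviation\<close>): up to the stability error, all
  mixed second moments agree with that of \<open>\<phi> (A_n)\<close> and \<open>\<phi> (A_{n+1})\<close>. Finitely many ramp functions
  \<open>\<phi>\<close>, with a spacing proportional to \<open>\<delta>\<close> on \<open>[- R, R]\<close>, control the noncoverage uniformly in \<open>\<alpha>\<close>
  (\<open>grid_bound\<close>). For \<open>\<delta> = 0\<close> this is combined with the bound on the density as above.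
  
  Finally, by independence the conditional distribution of the new observation may be replaced by its
  law, and the training sample and the new observation by a point of a product space. Monotonicity in
  \<open>\<alpha>\<close> reduces the suprema to rational \<open>\<alpha>\<close>; this gives measurability, and the almost sure
  equality of the suprema for the two versions of the conditional distribution.
\<close>

text \<open>Index sets are written \<open>{1..n}\<close> throughout, so \<open>1\<close> must not be rewritten to \<open>Suc 0\<close>.\<close>

declare One_nat_def [simp del]

section \<open>Suprema over the nominal level\<close>

lemma unit_rat_ne: "{0..1::real} \<inter> \<rat> \<noteq> {}"
proof -
  have "(0::real) \<in> {0..1} \<inter> \<rat>" by auto
  then show ?thesis by blast
qed

lemma SUP_unit_eq_rat:
  fixes g :: "real \<Rightarrow> real"
  assumes bdd: "\<And>a. a \<in> {0..1} \<Longrightarrow> g a \<le> B"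
    and approx: "\<And>a e. a \<in> {0..1} \<Longrightarrow> e > 0 \<Longrightarrow> \<exists>q\<in>{0..1} \<inter> \<rat>. g a \<le> g q + e"
  shows "(SUP a\<in>{0..1}. g a) = (SUP q\<in>{0..1} \<inter> \<rat>. g q)"
proof (rule antisym)
  have bd: "bdd_above (g ` {0..1})" using bdd by (rule bdd_aboveI2)
  then have bd': "bdd_above (g ` ({0..1} \<inter> \<rat>))" by (rule bdd_above_mono) auto
  show "(SUP q\<in>{0..1} \<inter> \<rat>. g q) \<le> (SUP a\<in>{0..1}. g a)"
    using unit_rat_ne bd by (intro cSUP_subset_mono) auto
  show "(SUP a\<in>{0..1}. g a) \<le> (SUP q\<in>{0..1} \<inter> \<rat>. g q)"
  proof (rule cSUP_least, simp)
    fix a :: real assume a: "a \<in> {0..1}"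
    show "g a \<le> (SUP q\<in>{0..1} \<inter> \<rat>. g q)"
    proof (rule field_le_epsilon)
      fix e :: real assume "e > 0"
      with approx[OF a] obtain q where q: "q \<in> {0..1} \<inter> \<rat>" "g a \<le> g q + e" by blast
      with cSUP_upper[OF q(1) bd'] show "g a \<le> (SUP q\<in>{0..1} \<inter> \<rat>. g q) + e" by linarith
    qed
  qed
qed

text \<open>
  The conditional noncoverage probability as a function of the nominal level is of this form.
  Monotonicity suffices to restrict the suprema below to rational levels.
\<close>

locale unit_mono =
  fixes F :: "real \<Rightarrow> real"
  assumes mono: "\<And>a b. 0 \<le> a \<Longrightarrow> a \<le> b \<Longrightarrow> b \<le> 1 \<Longrightarrow> F a \<le> F b"
    and nonneg: "\<And>a. 0 \<le> F a" and le_1: "\<And>a. F a \<le> 1"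
begin

lemma bdd_excess: "bdd_above ((\<lambda>a. F a - a) ` {0..1})"
  and bdd_deficit: "bdd_above ((\<lambda>a. a - F a) ` {0..1})"
  and bdd_abs: "bdd_above ((\<lambda>a. \<bar>F a - a\<bar>) ` {0..1})"
proof -
  show "bdd_above ((\<lambda>a. F a - a) ` {0..1})" "bdd_above ((\<lambda>a. a - F a) ` {0..1})"
    "bdd_above ((\<lambda>a. \<bar>F a - a\<bar>) ` {0..1})"
    using nonneg le_1 by (auto intro!: bdd_aboveI2[where M=1] simp: abs_le_iff diff_le_eq add_increasing add_increasing2)
qed

lemma SUP_excess_rat: "(SUP a\<in>{0..1}. F a - a) = (SUP q\<in>{0..1} \<inter> \<rat>. F q - q)"
proof (rule SUP_unit_eq_rat)
  fix a :: real assume "a \<in> {0..1}"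
  then show "F a - a \<le> 1" using le_1[of a] by auto
next
  fix a e :: real assume a: "a \<in> {0..1}" and e: "e > 0"
  show "\<exists>q\<in>{0..1} \<inter> \<rat>. F a - a \<le> F q - q + e"
  proof (cases "a = 1")
    case True then show ?thesis using e by (intro bexI[of _ 1]) auto
  next
    case False
    with a e obtain q where "q \<in> \<rat>" "a < q" "q < min 1 (a + e)"
      using Rats_dense_in_real[of a "min 1 (a+e)"] by auto
    then show ?thesis using mono[of a q] a by (intro bexI[of _ q]) auto
  qed
qed

lemma SUP_deficit_rat: "(SUP a\<in>{0..1}. a - F a) = (SUP q\<in>{0..1} \<inter> \<rat>. q - F q)"
proof (rule SUP_unit_eq_rat)
  fix a :: real assume "a \<in> {0..1}"
  then show "a - F a \<le> 1" using nonneg[of a] by auto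
next
  fix a e :: real assume a: "a \<in> {0..1}" and e: "e > 0"
  show "\<exists>q\<in>{0..1} \<inter> \<rat>. a - F a \<le> q - F q + e"
  proof (cases "a = 0")
    case True then show ?thesis using e by (intro bexI[of _ 0]) auto
  next
    case False
    with a e obtain q where "q \<in> \<rat>" "max 0 (a - e) < q" "q < a"
      using Rats_dense_in_real[of "max 0 (a-e)" a] by auto
    then show ?thesis using mono[of q a] a by (intro bexI[of _ q]) auto
  qed
qed

lemma SUP_abs_eq_max:
  "(SUP a\<in>{0..1}. \<bar>F a - a\<bar>) = max (SUP a\<in>{0..1}. F a - a) (SUP a\<in>{0..1}. a - F a)"
proof (rule antisym)
  show "(SUP a\<in>{0..1}. \<bar>F a - a\<bar>) \<le> max (SUP a\<in>{0..1}. F a - a) (SUP a\<in>{0..1}. a - F a)"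
  proof (rule cSUP_least, simp)
    fix a :: real assume a: "a \<in> {0..1}"
    show "\<bar>F a - a\<bar> \<le> max (SUP a\<in>{0..1}. F a - a) (SUP a\<in>{0..1}. a - F a)"
      using cSUP_upper[OF a bdd_excess] cSUP_upper[OF a bdd_deficit] by linarith
  qed
  show "max (SUP a\<in>{0..1}. F a - a) (SUP a\<in>{0..1}. a - F a) \<le> (SUP a\<in>{0..1}. \<bar>F a - a\<bar>)"
  proof (intro max.boundedI cSUP_mono bdd_abs)
    fix a :: real assume "a \<in> {0..1}"
    then show "\<exists>m\<in>{0..1}. F a - a \<le> \<bar>F m - m\<bar>" "\<exists>m\<in>{0..1}. a - F a \<le> \<bar>F m - m\<bar>"
      by (auto intro!: bexI[of _ a])
  qed auto
qed

lemma SUP_excess_bounds: "0 \<le> (SUP a\<in>{0..1}. F a - a)" "(SUP a\<in>{0..1}. F a - a) \<le> 1"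
  using cSUP_upper[OF _ bdd_excess, of 0] nonneg[of 0] apply simp
  by (rule cSUP_least) (auto simp: diff_le_eq le_1 add_increasing2)

lemma SUP_deficit_bounds: "0 \<le> (SUP a\<in>{0..1}. a - F a)" "(SUP a\<in>{0..1}. a - F a) \<le> 1"
  using cSUP_upper[OF _ bdd_deficit, of 1] le_1[of 1] apply simp
  by (rule cSUP_least) (auto simp: diff_le_eq nonneg add_increasing2)

end

lemma countable_unit_rat: "countable ({0..1::real} \<inter> \<rat>)"
  using countable_rat by (rule countable_subset[rotated]) auto

lemma measurable_SUP_excess:
  assumes F: "\<And>x. x \<in> space M \<Longrightarrow> unit_mono (F x)"
    and meas: "\<And>a. a \<in> {0..1} \<Longrightarrow> (\<lambda>x. F x a) \<in> borel_measurable M"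
  shows "(\<lambda>x. SUP a\<in>{0..1}. F x a - a) \<in> borel_measurable M"
    and "(\<lambda>x. SUP a\<in>{0..1}. a - F x a) \<in> borel_measurable M"
proof -
  have "(\<lambda>x. SUP a\<in>{0..1} \<inter> \<rat>. F x a - a) \<in> borel_measurable M"
    "(\<lambda>x. SUP a\<in>{0..1} \<inter> \<rat>. a - F x a) \<in> borel_measurable M"
    using meas bdd_above_mono[OF unit_mono.bdd_excess[OF F] image_mono]
      bdd_above_mono[OF unit_mono.bdd_deficit[OF F] image_mono]
    by (auto intro!: borel_measurable_cSUP countable_unit_rat)
  then show "(\<lambda>x. SUP a\<in>{0..1}. F x a - a) \<in> borel_measurable M"
    "(\<lambda>x. SUP a\<in>{0..1}. a - F x a) \<in> borel_measurable M"
    by (auto simp: unit_mono.SUP_excess_rat[OF F] unit_mono.SUP_deficit_rat[OF F] cong: measurable_cong)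
qed

lemma AE_SUP_excess_eq:
  assumes F: "\<And>x. x \<in> space M \<Longrightarrow> unit_mono (F x)" and G: "\<And>x. x \<in> space M \<Longrightarrow> unit_mono (G x)"
    and eq: "\<And>a. a \<in> {0..1} \<Longrightarrow> AE x in M. F x a = G x a"
  shows "AE x in M. (SUP a\<in>{0..1}. F x a - a) = (SUP a\<in>{0..1}. G x a - a) \<and>
     (SUP a\<in>{0..1}. a - F x a) = (SUP a\<in>{0..1}. a - G x a)"
proof -
  have "AE x in M. \<forall>a\<in>{0..1} \<inter> \<rat>. F x a = G x a"
    using eq countable_unit_rat by (subst AE_ball_countable) auto
  then show ?thesis
  proof (rule AE_mp, intro AE_I2 impI)
    fix x assume x: "x \<in> space M" and *: "\<forall>a\<in>{0..1} \<inter> \<rat>. F x a = G x a"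
    have "(SUP q\<in>{0..1} \<inter> \<rat>. F x q - q) = (SUP q\<in>{0..1} \<inter> \<rat>. G x q - q)"
      "(SUP q\<in>{0..1} \<inter> \<rat>. q - F x q) = (SUP q\<in>{0..1} \<inter> \<rat>. q - G x q)"
      using * by (auto intro!: SUP_cong)
    then show "(SUP a\<in>{0..1}. F x a - a) = (SUP a\<in>{0..1}. G x a - a) \<and>
     (SUP a\<in>{0..1}. a - F x a) = (SUP a\<in>{0..1}. a - G x a)"
      by (simp add: unit_mono.SUP_excess_rat[OF F[OF x]] unit_mono.SUP_excess_rat[OF G[OF x]]
         unit_mono.SUP_deficit_rat[OF F[OF x]] unit_mono.SUP_deficit_rat[OF G[OF x]])
  qed
qed

lemma measure_eq_integral_of_bool: "measure M {x\<in>space M. R x} = (\<integral>x. of_bool (R x) \<partial>M)"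
proof -
  have "(\<integral>x. of_bool (R x) \<partial>M) = (\<integral>x. indicat_real {x\<in>space M. R x} x \<partial>M)"
    by (intro Bochner_Integration.integral_cong) (auto simp: indicator_def)
  also have "\<dots> = measure M {x\<in>space M. R x}"
  proof -
    have "{x\<in>space M. R x} \<inter> space M = {x\<in>space M. R x}" by auto
    then show ?thesis by simp
  qed
  finally show ?thesis by simp
qed

section \<open>Exchangeability of leave-one-out scores\<close>

text \<open>
  The score of the \<open>i\<close>-th entry of \<open>w\<close> relative to the entries with index in the finite set \<open>J\<close>, listed
  in an arbitrary order. For symmetric scores the order is irrelevant (\<open>score_at_eq\<close> below).
\<close>

definition score_at :: "(nat \<Rightarrow> 'z \<Rightarrow> (nat \<Rightarrow> 'z) \<Rightarrow> real) \<Rightarrow> nat \<Rightarrow> nat set \<Rightarrow> (nat \<Rightarrow> 'z) \<Rightarrow> real" where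
  "score_at c i J w =
     c (card J) (w i) (\<lambda>k\<in>{1..card J}. w ((SOME e. bij_betw e {1..card J} J) k))"

text \<open>
  Among \<open>n + 1\<close> observations: the leave-one-out score of the \<open>i\<close>-th one relative to all others, and its
  leave-two-out score relative to all others except the \<open>j\<close>-th one.
\<close>

definition loo :: "(nat \<Rightarrow> 'z \<Rightarrow> (nat \<Rightarrow> 'z) \<Rightarrow> real) \<Rightarrow> nat \<Rightarrow> nat \<Rightarrow> (nat \<Rightarrow> 'z) \<Rightarrow> real" where
  "loo c n i w = score_at c i ({1..Suc n} - {i}) w"

definition lto :: "(nat \<Rightarrow> 'z \<Rightarrow> (nat \<Rightarrow> 'z) \<Rightarrow> real) \<Rightarrow> nat \<Rightarrow> nat \<Rightarrow> nat \<Rightarrow> (nat \<Rightarrow> 'z) \<Rightarrow> real" where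
  "lto c n i j w = score_at c i ({1..Suc n} - {i, j}) w"

lemma some_enum: "finite J \<Longrightarrow> bij_betw (SOME e. bij_betw e {1..card J} J) {1..card J} J"
  using ex_bij_betw_nat_finite_1[of J] by (rule someI_ex)

lemma permutes_pair:
  assumes "a \<in> I" "b \<in> I" "a' \<in> I" "b' \<in> I" "a \<noteq> b" "a' \<noteq> b'"
  obtains \<sigma> where "\<sigma> permutes I" "\<sigma> a = a'" "\<sigma> b = b'"
proof
  let ?t = "Transposition.transpose a a'"
  show "Transposition.transpose (?t b) b' \<circ> ?t permutes I"
    using assms by (intro permutes_compose permutes_swap_id) (auto simp: Transposition.transpose_def)
  show "(Transposition.transpose (?t b) b' \<circ> ?t) a = a'" "(Transposition.transpose (?t b) b' \<circ> ?t) b = b'"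
    using assms by (auto simp: Transposition.transpose_def)
qed

text \<open>
  A sample of size \<open>n + 1\<close> from \<open>P\<close> and the scores \<open>c m\<close> for reference samples of size \<open>m\<close>. Below, \<open>Q\<close> is
  the law of the sample and \<open>PT\<close> that of the training sample. Leaving two out requires \<open>n \<ge> 2\<close>.
\<close>

locale iid_scores = prob_space P for P :: "'z measure" +
  fixes n :: nat and c :: "nat \<Rightarrow> 'z \<Rightarrow> (nat \<Rightarrow> 'z) \<Rightarrow> real"
  assumes n_ge_2: "2 \<le> n"
    and measurable_c: "1 \<le> m \<Longrightarrow>
      (\<lambda>(z, \<tau>). c m z \<tau>) \<in> borel_measurable (P \<Otimes>\<^sub>M (\<Pi>\<^sub>M i\<in>{1..m}. P))"
    and sym_c: "1 \<le> m \<Longrightarrow> z \<in> space P \<Longrightarrow> \<tau> \<in> space (\<Pi>\<^sub>M i\<in>{1..m}. P) \<Longrightarrow>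
      \<pi> permutes {1..m} \<Longrightarrow> c m z (\<tau> \<circ> \<pi>) = c m z \<tau>"
begin

abbreviation Q :: "(nat \<Rightarrow> 'z) measure" where "Q \<equiv> \<Pi>\<^sub>M i\<in>{1..Suc n}. P"
abbreviation PT :: "(nat \<Rightarrow> 'z) measure" where "PT \<equiv> \<Pi>\<^sub>M i\<in>{1..n}. P"

sublocale Q: prob_space Q by (intro prob_space_PiM prob_space_axioms)
sublocale PT: prob_space PT by (intro prob_space_PiM prob_space_axioms)
sublocale prod: product_sigma_finite "\<lambda>_::nat. P"
  by (simp add: product_sigma_finite_def prob_space_imp_sigma_finite prob_space_axioms)

lemma score_at_eq:
  assumes w: "w \<in> space (\<Pi>\<^sub>M i\<in>I. P)" and i: "i \<in> I" and J: "J \<subseteq> I" "1 \<le> m" and e: "bij_betw e {1..m} J"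
  shows "c m (w i) (\<lambda>k\<in>{1..m}. w (e k)) = score_at c i J w"
proof -
  have fin: "finite J" and card: "card J = m"
    using e bij_betw_finite[OF e] bij_betw_same_card[OF e] by auto
  define e0 where "e0 = (SOME e. bij_betw e {1..card J} J)"
  have e0: "bij_betw e0 {1..m} J" using some_enum[OF fin] card by (simp add: e0_def)
  define \<pi> where "\<pi> k = (if k \<in> {1..m} then inv_into {1..m} e0 (e k) else k)" for k
  have "bij_betw (inv_into {1..m} e0 \<circ> e) {1..m} {1..m}"
    using e e0 by (intro bij_betw_trans[of e _ J] bij_betw_inv_into)
  then have "bij_betw \<pi> {1..m} {1..m}"
    by (subst bij_betw_cong[of _ _ "inv_into {1..m} e0 \<circ> e"]) (auto simp: \<pi>_def)
  then have \<pi>: "\<pi> permutes {1..m}" by (rule bij_imp_permutes) (auto simp: \<pi>_def)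
  let ?\<tau> = "\<lambda>k\<in>{1..m}. w (e0 k)"
  have e0_I: "e0 k \<in> I" if "k \<in> {1..m}" for k using e0 that bij_betwE J(1) by blast
  have e_J: "e k \<in> J" if "k \<in> {1..m}" for k using e that bij_betwE by blast
  have \<tau>: "?\<tau> \<in> space (\<Pi>\<^sub>M i\<in>{1..m}. P)"
    using w e0_I by (auto simp: space_PiM PiE_iff)
  have "?\<tau> \<circ> \<pi> = (\<lambda>k\<in>{1..m}. w (e k))"
  proof
    fix k
    show "(?\<tau> \<circ> \<pi>) k = (\<lambda>k\<in>{1..m}. w (e k)) k"
    proof (cases "k \<in> {1..m}")
      case True
      then have "\<pi> k \<in> {1..m}" using permutes_in_image[OF \<pi>] by blast
      moreover have "e0 (\<pi> k) = e k"
        using True e_J[OF True] e0 by (auto simp: \<pi>_def bij_betw_inv_into_right)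
      ultimately show ?thesis using True by simp
    next
      case False then show ?thesis by (auto simp: \<pi>_def)
    qed
  qed
  moreover have "w i \<in> space P" using w i by (auto simp: space_PiM)
  ultimately show ?thesis
    using sym_c[OF J(2) _ \<tau> \<pi>, of "w i"] unfolding score_at_def card e0_def[unfolded card, symmetric] by simp
qed

lemma score_at_reindex:
  assumes w: "w \<in> space Q" and \<sigma>: "\<sigma> permutes {1..Suc n}"
    and i: "i \<in> {1..Suc n}" and J: "J \<subseteq> {1..Suc n}" "J \<noteq> {}"
  shows "score_at c i J (\<lambda>k\<in>{1..Suc n}. w (\<sigma> k)) = score_at c (\<sigma> i) (\<sigma> ` J) w"
proof -
  have fin: "finite J" using J finite_subset by auto
  then have card: "1 \<le> card J" using J by (simp add: One_nat_def Suc_le_eq card_gt_0_iff)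
  define e where "e = (SOME e. bij_betw e {1..card J} J)"
  have e: "bij_betw e {1..card J} J" using some_enum[OF fin] by (simp add: e_def)
  have eJ: "e k \<in> {1..Suc n}" if "k \<in> {1..card J}" for k using e that bij_betwE J(1) by blast
  have \<sigma>e: "bij_betw (\<sigma> \<circ> e) {1..card J} (\<sigma> ` J)"
    using e by (rule bij_betw_trans) (auto intro: bij_betw_imageI inj_on_subset[OF permutes_inj[OF \<sigma>]])
  have "score_at c i J (\<lambda>k\<in>{1..Suc n}. w (\<sigma> k)) = c (card J) (w (\<sigma> i)) (\<lambda>k\<in>{1..card J}. w ((\<sigma> \<circ> e) k))"
    using i eJ unfolding score_at_def e_def[symmetric] by (auto intro!: arg_cong[where f="c _ _"] restrict_ext)
  also have "\<dots> = score_at c (\<sigma> i) (\<sigma> ` J) w"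
    using permutes_in_image[OF \<sigma>] i J permutes_image[OF \<sigma>] by (intro score_at_eq[OF w _ _ card \<sigma>e]) auto
  finally show ?thesis .
qed

lemma measurable_score_at:
  assumes i: "i \<in> I" and J: "J \<subseteq> I" "J \<noteq> {}" "finite J"
  shows "score_at c i J \<in> borel_measurable (\<Pi>\<^sub>M i\<in>I. P)"
proof -
  have card: "1 \<le> card J" using J by (simp add: One_nat_def Suc_le_eq card_gt_0_iff)
  define e where "e = (SOME e. bij_betw e {1..card J} J)"
  have e: "bij_betw e {1..card J} J" using some_enum[OF J(3)] by (simp add: e_def)
  have eJ: "e k \<in> I" if "k \<in> {1..card J}" for k using e that bij_betwE J(1) by blast
  have "(\<lambda>w. (w i, \<lambda>k\<in>{1..card J}. w (e k))) \<in> (\<Pi>\<^sub>M i\<in>I. P) \<rightarrow>\<^sub>M P \<Otimes>\<^sub>M (\<Pi>\<^sub>M i\<in>{1..card J}. P)"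
    using i eJ by (intro measurable_Pair measurable_restrict measurable_component_singleton) auto
  from measurable_compose[OF this measurable_c[OF card]] show ?thesis
    by (simp add: score_at_def[abs_def] e_def)
qed

lemma lto_set_ne: "{1..Suc n} - {i, j} \<noteq> {}"
proof
  assume "{1..Suc n} - {i, j} = {}"
  then have "card {1..Suc n} \<le> card {i, j}" by (intro card_mono) auto
  also have "\<dots> \<le> 2" by (simp add: card_insert_if)
  finally show False using n_ge_2 by simp
qed

lemma measurable_loo [measurable]: "i \<in> {1..Suc n} \<Longrightarrow> loo c n i \<in> borel_measurable Q"
  and measurable_lto [measurable]: "i \<in> {1..Suc n} \<Longrightarrow> lto c n i j \<in> borel_measurable Q"
proof -
  show "i \<in> {1..Suc n} \<Longrightarrow> loo c n i \<in> borel_measurable Q"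
    unfolding loo_def[abs_def] using lto_set_ne[of i i] by (intro measurable_score_at) auto
  show "i \<in> {1..Suc n} \<Longrightarrow> lto c n i j \<in> borel_measurable Q"
    unfolding lto_def[abs_def] using lto_set_ne[of i j] by (intro measurable_score_at) auto
qed

lemma loo_reindex:
  assumes "w \<in> space Q" "\<sigma> permutes {1..Suc n}" "i \<in> {1..Suc n}"
  shows "loo c n i (\<lambda>k\<in>{1..Suc n}. w (\<sigma> k)) = loo c n (\<sigma> i) w"
proof -
  have "\<sigma> ` ({1..Suc n} - {i}) = {1..Suc n} - {\<sigma> i}"
    using permutes_image[OF assms(2)] by (subst image_set_diff[OF permutes_inj[OF assms(2)]]) auto
  with score_at_reindex[OF assms, of "{1..Suc n} - {i}"] lto_set_ne[of i i] show ?thesis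
    by (simp add: loo_def)
qed

lemma lto_reindex:
  assumes "w \<in> space Q" "\<sigma> permutes {1..Suc n}" "i \<in> {1..Suc n}"
  shows "lto c n i j (\<lambda>k\<in>{1..Suc n}. w (\<sigma> k)) = lto c n (\<sigma> i) (\<sigma> j) w"
proof -
  have "\<sigma> ` ({1..Suc n} - {i, j}) = {1..Suc n} - {\<sigma> i, \<sigma> j}"
    using permutes_image[OF assms(2)] by (subst image_set_diff[OF permutes_inj[OF assms(2)]]) auto
  with score_at_reindex[OF assms, of "{1..Suc n} - {i, j}"] lto_set_ne[of i j] show ?thesis
    by (simp add: lto_def)
qed

lemma distr_permute:
  assumes \<sigma>: "\<sigma> permutes {1..Suc n}"
  shows "distr Q Q (\<lambda>w. \<lambda>k\<in>{1..Suc n}. w (\<sigma> k)) = Q"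
  using distr_PiM_reindex[of "{1..Suc n}" "\<lambda>_. P" \<sigma> "{1..Suc n}"] permutes_in_image[OF \<sigma>]
    permutes_inj_on[OF \<sigma>] prob_space_axioms by auto

lemma integral_permute:
  fixes f :: "_ \<Rightarrow> real"
  assumes \<sigma>: "\<sigma> permutes {1..Suc n}" and f: "f \<in> borel_measurable Q"
  shows "(\<integral>w. f (\<lambda>k\<in>{1..Suc n}. w (\<sigma> k)) \<partial>Q) = (\<integral>w. f w \<partial>Q)"
proof -
  have "(\<lambda>w. \<lambda>k\<in>{1..Suc n}. w (\<sigma> k)) \<in> Q \<rightarrow>\<^sub>M Q"
    using permutes_in_image[OF \<sigma>] by (intro measurable_restrict measurable_component_singleton) auto
  from integral_distr[OF this f] show ?thesis by (simp only: distr_permute[OF \<sigma>])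
qed

lemma integral_loo_lto:
  fixes f :: "real \<Rightarrow> real \<Rightarrow> real"
  assumes ij: "i \<in> {1..Suc n}" "j \<in> {1..Suc n}" "i \<noteq> j"
    and [measurable]: "(\<lambda>(x, y). f x y) \<in> borel_measurable (borel \<Otimes>\<^sub>M borel)"
  shows "(\<integral>w. f (loo c n i w) (lto c n i j w) \<partial>Q) = (\<integral>w. f (loo c n (Suc n) w) (lto c n (Suc n) n w) \<partial>Q)"
proof -
  obtain \<sigma> where \<sigma>: "\<sigma> permutes {1..Suc n}" "\<sigma> (Suc n) = i" "\<sigma> n = j"
    using permutes_pair[of "Suc n" "{1..Suc n}" n i j] ij n_ge_2 by auto
  have [measurable]: "loo c n (Suc n) \<in> borel_measurable Q" "lto c n (Suc n) n \<in> borel_measurable Q"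
    by (intro measurable_loo measurable_lto; simp)+
  have "(\<integral>w. f (loo c n i w) (lto c n i j w) \<partial>Q)
    = (\<integral>w. (\<lambda>w. f (loo c n (Suc n) w) (lto c n (Suc n) n w)) (\<lambda>k\<in>{1..Suc n}. w (\<sigma> k)) \<partial>Q)"
    using \<sigma> by (intro Bochner_Integration.integral_cong) (simp_all add: loo_reindex lto_reindex)
  also have "\<dots> = (\<integral>w. f (loo c n (Suc n) w) (lto c n (Suc n) n w) \<partial>Q)"
    by (rule integral_permute[OF \<sigma>(1)]) simp
  finally show ?thesis .
qed

lemma integral_loo_loo:
  fixes f :: "real \<Rightarrow> real \<Rightarrow> real"
  assumes ij: "i \<in> {1..Suc n}" "j \<in> {1..Suc n}" "i \<noteq> j"
    and [measurable]: "(\<lambda>(x, y). f x y) \<in> borel_measurable (borel \<Otimes>\<^sub>M borel)"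
  shows "(\<integral>w. f (loo c n i w) (loo c n j w) \<partial>Q) = (\<integral>w. f (loo c n (Suc n) w) (loo c n n w) \<partial>Q)"
proof -
  obtain \<sigma> where \<sigma>: "\<sigma> permutes {1..Suc n}" "\<sigma> (Suc n) = i" "\<sigma> n = j"
    using permutes_pair[of "Suc n" "{1..Suc n}" n i j] ij n_ge_2 by auto
  have [measurable]: "loo c n (Suc n) \<in> borel_measurable Q" "loo c n n \<in> borel_measurable Q"
    using n_ge_2 by (intro measurable_loo; simp)+
  have "(\<integral>w. f (loo c n i w) (loo c n j w) \<partial>Q)
    = (\<integral>w. (\<lambda>w. f (loo c n (Suc n) w) (loo c n n w)) (\<lambda>k\<in>{1..Suc n}. w (\<sigma> k)) \<partial>Q)"
    using \<sigma> n_ge_2 by (intro Bochner_Integration.integral_cong) (simp_all add: loo_reindex)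
  also have "\<dots> = (\<integral>w. f (loo c n (Suc n) w) (loo c n n w) \<partial>Q)"
    by (rule integral_permute[OF \<sigma>(1)]) simp
  finally show ?thesis .
qed

text \<open>
  The amount of instability: how likely it is that a single observation in the reference sample changes
  the score by more than \<open>\<eta>\<close>. The indices are immaterial by exchangeability (\<open>gap_eq\<close>).
\<close>

definition gap :: "real \<Rightarrow> real" where
  "gap \<eta> = measure Q {w\<in>space Q. \<bar>loo c n (Suc n) w - lto c n (Suc n) n w\<bar> > \<eta>}"

lemma gap_eq:
  assumes ij: "i \<in> {1..Suc n}" "j \<in> {1..Suc n}" "i \<noteq> j"
  shows "measure Q {w\<in>space Q. \<bar>loo c n i w - lto c n i j w\<bar> > \<eta>} = gap \<eta>"
proof -
  show ?thesis unfolding gap_def measure_eq_integral_of_bool using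
    integral_loo_lto[OF ij, of "\<lambda>x y. of_bool (\<bar>x - y\<bar> > \<eta>)"] by simp
qed

end

section \<open>Noncoverage of rank-based prediction sets\<close>

text \<open>
  The noncoverage probability at level \<open>a\<close> of the prediction set with count \<open>N\<close>, given the training
  sample \<open>\<tau>\<close>, if \<open>\<kappa>\<close> is the distribution of the new observation. Its one-sided deviations from the
  nominal level are \<open>excess\<close> and \<open>deficit\<close>.
\<close>

definition level :: "'z measure \<Rightarrow> nat \<Rightarrow> ((nat \<Rightarrow> 'z) \<Rightarrow> real) \<Rightarrow> (nat \<Rightarrow> 'z) \<Rightarrow> real \<Rightarrow> real" where
  "level \<kappa> n N \<tau> a = measure \<kappa> {z\<in>space \<kappa>. N (\<tau>(Suc n := z)) \<le> a * (real n + 1)}"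

definition excess :: "'z measure \<Rightarrow> nat \<Rightarrow> ((nat \<Rightarrow> 'z) \<Rightarrow> real) \<Rightarrow> (nat \<Rightarrow> 'z) \<Rightarrow> real" where
  "excess \<kappa> n N \<tau> = (SUP a\<in>{0..1}. level \<kappa> n N \<tau> a - a)"

definition deficit :: "'z measure \<Rightarrow> nat \<Rightarrow> ((nat \<Rightarrow> 'z) \<Rightarrow> real) \<Rightarrow> (nat \<Rightarrow> 'z) \<Rightarrow> real" where
  "deficit \<kappa> n N \<tau> = (SUP a\<in>{0..1}. a - level \<kappa> n N \<tau> a)"

context iid_scores
begin

lemma insert_Suc_n: "insert (Suc n) {1..n} = {1..Suc n}" by auto

lemma measurable_append [measurable]:
  "(\<lambda>(\<tau>, z). \<tau>(Suc n := z)) \<in> PT \<Otimes>\<^sub>M P \<rightarrow>\<^sub>M Q"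
  using measurable_add_dim[of "Suc n" "{1..n}" "\<lambda>_. P"] by (simp add: insert_Suc_n)

lemma measurable_append1:
  "\<tau> \<in> space PT \<Longrightarrow> (\<lambda>z. \<tau>(Suc n := z)) \<in> P \<rightarrow>\<^sub>M Q"
  using measurable_compose[OF measurable_Pair1' measurable_append, of \<tau>] by simp

lemma append_space: "\<tau> \<in> space PT \<Longrightarrow> z \<in> space P \<Longrightarrow> \<tau>(Suc n := z) \<in> space Q"
  using measurable_space[OF measurable_append1] by blast

lemma split_integral:
  fixes f :: "(nat \<Rightarrow> 'z) \<Rightarrow> real"
  assumes "integrable Q f"
  shows "(\<integral>w. f w \<partial>Q) = (\<integral>\<tau>. (\<integral>z. f (\<tau>(Suc n := z)) \<partial>P) \<partial>PT)"
  using prod.product_integral_insert[of "{1..n}" "Suc n" f] assms by (simp add: insert_Suc_n)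

lemma integrable_bdd:
  fixes f :: "(nat \<Rightarrow> 'z) \<Rightarrow> real"
  assumes "f \<in> borel_measurable Q" "\<And>w. w \<in> space Q \<Longrightarrow> \<bar>f w\<bar> \<le> B"
  shows "integrable Q f"
  using assms by (intro Q.integrable_const_bound[where B=B] AE_I2) auto

lemma PT_integrable_bdd:
  fixes f :: "(nat \<Rightarrow> 'z) \<Rightarrow> real"
  assumes "f \<in> borel_measurable PT" "\<And>w. w \<in> space PT \<Longrightarrow> \<bar>f w\<bar> \<le> B"
  shows "integrable PT f"
  using assms by (intro PT.integrable_const_bound[where B=B] AE_I2) auto

lemma measurable_section:
  assumes "f \<in> borel_measurable Q" "\<tau> \<in> space PT"
  shows "(\<lambda>z. f (\<tau>(Suc n := z)) :: real) \<in> borel_measurable P"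
  using measurable_compose[OF measurable_append1 assms(1)] assms(2) by simp

lemma measurable_integral_section [measurable (raw)]:
  fixes f :: "(nat \<Rightarrow> 'z) \<Rightarrow> real"
  assumes [measurable]: "f \<in> borel_measurable Q"
  shows "(\<lambda>\<tau>. \<integral>z. f (\<tau>(Suc n := z)) \<partial>P) \<in> borel_measurable PT"
proof -
  have "(\<lambda>(\<tau>, z). f (\<tau>(Suc n := z))) \<in> borel_measurable (PT \<Otimes>\<^sub>M P)"
    using measurable_compose[OF measurable_append assms] by (simp add: split_beta')
  then show ?thesis by (rule borel_measurable_lebesgue_integral)
qed

lemma measurable_prob_section:
  assumes [measurable]: "Measurable.pred Q R"
  shows "(\<lambda>\<tau>. measure P {z\<in>space P. R (\<tau>(Suc n := z))}) \<in> borel_measurable PT"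
    and "(\<integral>\<tau>. measure P {z\<in>space P. R (\<tau>(Suc n := z))} \<partial>PT) = measure Q {w\<in>space Q. R w}"
proof -
  show "(\<lambda>\<tau>. measure P {z\<in>space P. R (\<tau>(Suc n := z))}) \<in> borel_measurable PT"
    unfolding measure_eq_integral_of_bool by measurable
  have "integrable Q (\<lambda>w. of_bool (R w) :: real)"
    by (intro integrable_bdd[where B=1]) auto
  then show "(\<integral>\<tau>. measure P {z\<in>space P. R (\<tau>(Suc n := z))} \<partial>PT) = measure Q {w\<in>space Q. R w}"
    unfolding measure_eq_integral_of_bool by (rule split_integral[symmetric])
qed

lemma unit_mono_level:
  assumes N: "N \<in> borel_measurable Q" and \<tau>: "\<tau> \<in> space PT"
  shows "unit_mono (level P n N \<tau>)"
proof
  have [measurable]: "(\<lambda>z. N (\<tau>(Suc n := z))) \<in> borel_measurable P"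
    by (rule measurable_section[OF N \<tau>])
  fix a b :: real assume "a \<le> b"
  then have *: "a * (real n + 1) \<le> b * (real n + 1)" by (intro mult_right_mono) auto
  then show "level P n N \<tau> a \<le> level P n N \<tau> b"
    unfolding level_def by (intro finite_measure_mono) (auto intro: order_trans[OF _ *])
qed (auto simp: level_def)

lemma measurable_level:
  assumes [measurable]: "N \<in> borel_measurable Q"
  shows "(\<lambda>\<tau>. level P n N \<tau> a) \<in> borel_measurable PT"
  unfolding level_def by (rule measurable_prob_section) measurable

lemma
  assumes N: "N \<in> borel_measurable Q"
  shows measurable_excess: "excess P n N \<in> borel_measurable PT"
    and measurable_deficit: "deficit P n N \<in> borel_measurable PT"
  unfolding excess_def[abs_def] deficit_def[abs_def]
  using unit_mono_level[OF N] measurable_level[OF N]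
  by (auto intro: measurable_SUP_excess)

lemma
  assumes "N \<in> borel_measurable Q" "\<tau> \<in> space PT"
  shows excess_bounds: "0 \<le> excess P n N \<tau>" "excess P n N \<tau> \<le> 1"
    and deficit_bounds: "0 \<le> deficit P n N \<tau>" "deficit P n N \<tau> \<le> 1"
  unfolding excess_def deficit_def
  using unit_mono.SUP_excess_bounds[OF unit_mono_level] unit_mono.SUP_deficit_bounds[OF unit_mono_level] assms
  by auto

lemma
  assumes "N \<in> borel_measurable Q"
  shows integrable_excess: "integrable PT (excess P n N)"
    and integrable_deficit: "integrable PT (deficit P n N)"
  using excess_bounds[OF assms] deficit_bounds[OF assms] assms
  by (auto intro!: PT_integrable_bdd[where B=1] measurable_excess measurable_deficit)

text \<open>
  If \<open>N2 \<le> a (n + 1)\<close> and \<open>B \<le> e (n + 1)\<close>, then \<open>N1 \<le> N2 + B \<le> (a + e) (n + 1)\<close>. So the noncoverage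
  of \<open>N2\<close> is at most that of \<open>N1\<close> at the level increased by \<open>e\<close>, plus the probability that \<open>B\<close> is large.
\<close>

lemma level_le_level_add:
  assumes N: "N1 \<in> borel_measurable Q" "N2 \<in> borel_measurable Q" "B \<in> borel_measurable Q"
    and le: "\<And>w. w \<in> space Q \<Longrightarrow> N1 w \<le> N2 w + B w" and \<tau>: "\<tau> \<in> space PT"
  shows "level P n N2 \<tau> a \<le> level P n N1 \<tau> (a + e)
    + measure P {z\<in>space P. B (\<tau>(Suc n := z)) > e * (real n + 1)}"
proof -
  note [measurable] = measurable_section[OF N(1) \<tau>] measurable_section[OF N(2) \<tau>] measurable_section[OF N(3) \<tau>]
  let ?A = "{z\<in>space P. N1 (\<tau>(Suc n := z)) \<le> (a + e) * (real n + 1)}"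
  let ?B = "{z\<in>space P. B (\<tau>(Suc n := z)) > e * (real n + 1)}"
  have "level P n N2 \<tau> a \<le> measure P (?A \<union> ?B)"
    unfolding level_def
  proof (intro finite_measure_mono)
    show "{z \<in> space P. N2 (\<tau>(Suc n := z)) \<le> a * (real n + 1)} \<subseteq> ?A \<union> ?B"
    proof clarsimp
      fix z assume z: "z \<in> space P" "N2 (\<tau>(Suc n := z)) \<le> a * (real n + 1)"
        "\<not> e * (real n + 1) < B (\<tau>(Suc n := z))"
      then show "N1 (\<tau>(Suc n := z)) \<le> (a + e) * (real n + 1)"
        using le[OF append_space[OF \<tau> z(1)]] unfolding distrib_right[of a e] by linarith
    qed
    show "?A \<union> ?B \<in> sets P" by measurable
  qed
  also have "\<dots> \<le> measure P ?A + measure P ?B"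
    by (intro measure_Un_le) measurable
  finally show ?thesis unfolding level_def .
qed

lemma
  assumes N: "N1 \<in> borel_measurable Q" "N2 \<in> borel_measurable Q" "B \<in> borel_measurable Q"
    and le: "\<And>w. w \<in> space Q \<Longrightarrow> N1 w \<le> N2 w + B w" and \<tau>: "\<tau> \<in> space PT" and e: "e > 0"
  shows excess_le_add: "excess P n N2 \<tau> \<le> excess P n N1 \<tau> + e
      + measure P {z\<in>space P. B (\<tau>(Suc n := z)) > e * (real n + 1)}" (is "_ \<le> _ + _ + ?m")
    and deficit_le_add: "deficit P n N1 \<tau> \<le> deficit P n N2 \<tau> + e
      + measure P {z\<in>space P. B (\<tau>(Suc n := z)) > e * (real n + 1)}"
proof -
  interpret L1: unit_mono "level P n N1 \<tau>" by (rule unit_mono_level) fact+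
  interpret L2: unit_mono "level P n N2 \<tau>" by (rule unit_mono_level) fact+
  have m: "0 \<le> ?m" by simp
  note le = level_le_level_add[OF N le \<tau>, of _ e]
  show "excess P n N2 \<tau> \<le> excess P n N1 \<tau> + e + ?m"
    unfolding excess_def[of P n N2]
  proof (rule cSUP_least, simp)
    fix a :: real assume a: "a \<in> {0..1}"
    show "level P n N2 \<tau> a - a \<le> excess P n N1 \<tau> + e + ?m"
    proof (cases "a + e \<le> 1")
      case True
      then have "level P n N1 \<tau> (a + e) - (a + e) \<le> excess P n N1 \<tau>"
        unfolding excess_def using a e by (intro cSUP_upper L1.bdd_excess) auto
      with le[of a] show ?thesis by linarith
    next
      case False
      with L2.le_1[of a] m excess_bounds(1)[OF N(1) \<tau>] show ?thesis by linarith
    qed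
  qed
  show "deficit P n N1 \<tau> \<le> deficit P n N2 \<tau> + e + ?m"
    unfolding deficit_def[of P n N1]
  proof (rule cSUP_least, simp)
    fix a :: real assume a: "a \<in> {0..1}"
    show "a - level P n N1 \<tau> a \<le> deficit P n N2 \<tau> + e + ?m"
    proof (cases "0 \<le> a - e")
      case True
      then have "(a - e) - level P n N2 \<tau> (a - e) \<le> deficit P n N2 \<tau>"
        unfolding deficit_def using a e by (intro cSUP_upper L2.bdd_deficit) auto
      with le[of "a - e"] show ?thesis by simp
    next
      case False
      with L1.nonneg[of a] m deficit_bounds(1)[OF N(2) \<tau>] show ?thesis by linarith
    qed
  qed
qed

lemma prob_gt_le:
  assumes B: "integrable Q B" "\<And>w. w \<in> space Q \<Longrightarrow> 0 \<le> B w" and k: "k > 0"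
  shows "measure Q {w\<in>space Q. B w > k} \<le> (\<integral>w. B w \<partial>Q) / k"
proof -
  have [measurable]: "B \<in> borel_measurable Q" using B by auto
  have *: "of_bool (B w > k) \<le> B w / k" if "w \<in> space Q" for w
    using B(2)[OF that] k by (cases "B w > k") auto
  have int: "integrable Q (\<lambda>w. of_bool (B w > k) :: real)"
    by (intro integrable_bdd[where B=1]) auto
  have "measure Q {w\<in>space Q. B w > k} \<le> (\<integral>w. B w / k \<partial>Q)"
    unfolding measure_eq_integral_of_bool
    using B(1) int by (intro integral_mono *) auto
  then show ?thesis by simp
qed

lemma
  assumes N: "N1 \<in> borel_measurable Q" "N2 \<in> borel_measurable Q" "integrable Q B"
    and B: "\<And>w. w \<in> space Q \<Longrightarrow> 0 \<le> B w"
    and le: "\<And>w. w \<in> space Q \<Longrightarrow> N1 w \<le> N2 w + B w" and e: "e > 0"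
  shows integral_excess_le: "(\<integral>\<tau>. excess P n N2 \<tau> \<partial>PT) \<le> (\<integral>\<tau>. excess P n N1 \<tau> \<partial>PT) + e
      + (\<integral>w. B w \<partial>Q) / (e * (real n + 1))"
    and integral_deficit_le: "(\<integral>\<tau>. deficit P n N1 \<tau> \<partial>PT) \<le> (\<integral>\<tau>. deficit P n N2 \<tau> \<partial>PT) + e
      + (\<integral>w. B w \<partial>Q) / (e * (real n + 1))"
proof -
  have mB [measurable]: "B \<in> borel_measurable Q" using N by auto
  define m where "m \<tau> = measure P {z\<in>space P. B (\<tau>(Suc n := z)) > e * (real n + 1)}" for \<tau>
  have [measurable]: "m \<in> borel_measurable PT"
    unfolding m_def[abs_def] by (rule measurable_prob_section) measurable
  have int: "integrable PT m"
    by (rule PT_integrable_bdd[where B=1]) (auto simp: m_def)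
  have "(\<integral>\<tau>. m \<tau> \<partial>PT) = measure Q {w\<in>space Q. B w > e * (real n + 1)}"
    unfolding m_def by (rule measurable_prob_section) measurable
  also have "\<dots> \<le> (\<integral>w. B w \<partial>Q) / (e * (real n + 1))"
    using N B e by (intro prob_gt_le) auto
  finally have m: "(\<integral>\<tau>. m \<tau> \<partial>PT) \<le> (\<integral>w. B w \<partial>Q) / (e * (real n + 1))" .
  have "(\<integral>\<tau>. excess P n N2 \<tau> \<partial>PT) \<le> (\<integral>\<tau>. excess P n N1 \<tau> + e + m \<tau> \<partial>PT)"
    using excess_le_add[OF N(1,2) mB le _ e, folded m_def] int N(1,2)
    by (intro integral_mono Bochner_Integration.integrable_add) (auto intro: integrable_excess)
  also have "\<dots> = (\<integral>\<tau>. excess P n N1 \<tau> \<partial>PT) + e + (\<integral>\<tau>. m \<tau> \<partial>PT)"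
    using integrable_excess[OF N(1)] int PT.prob_space by simp
  finally show "(\<integral>\<tau>. excess P n N2 \<tau> \<partial>PT) \<le> (\<integral>\<tau>. excess P n N1 \<tau> \<partial>PT) + e
      + (\<integral>w. B w \<partial>Q) / (e * (real n + 1))" using m by linarith
  have "(\<integral>\<tau>. deficit P n N1 \<tau> \<partial>PT) \<le> (\<integral>\<tau>. deficit P n N2 \<tau> + e + m \<tau> \<partial>PT)"
    using deficit_le_add[OF N(1,2) mB le _ e, folded m_def] int N(1,2)
    by (intro integral_mono Bochner_Integration.integrable_add) (auto intro: integrable_deficit)
  also have "\<dots> = (\<integral>\<tau>. deficit P n N2 \<tau> \<partial>PT) + e + (\<integral>\<tau>. m \<tau> \<partial>PT)"
    using integrable_deficit[OF N(2)] int PT.prob_space by simp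
  finally show "(\<integral>\<tau>. deficit P n N1 \<tau> \<partial>PT) \<le> (\<integral>\<tau>. deficit P n N2 \<tau> \<partial>PT) + e
      + (\<integral>w. B w \<partial>Q) / (e * (real n + 1))" using m by linarith
qed

end

section \<open>Concentration of the leave-one-out empirical distribution\<close>

context iid_scores
begin

lemma score_at_cong:
  assumes "\<And>k. k \<in> insert i J \<Longrightarrow> w k = w' k" "finite J"
  shows "score_at c i J w = score_at c i J w'"
proof -
  have "(SOME e. bij_betw e {1..card J} J) k \<in> J" if "k \<in> {1..card J}" for k
    using bij_betwE[OF some_enum[OF assms(2)]] that by blast
  then have "(\<lambda>k\<in>{1..card J}. w ((SOME e. bij_betw e {1..card J} J) k))
    = (\<lambda>k\<in>{1..card J}. w' ((SOME e. bij_betw e {1..card J} J) k))"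
    using assms(1) by (intro restrict_ext) auto
  then show ?thesis using assms(1)[of i] by (simp add: score_at_def)
qed

lemma lto_append:
  assumes "i \<in> {1..n}"
  shows "lto c n i (Suc n) (\<tau>(Suc n := z)) = lto c n i (Suc n) \<tau>"
  unfolding lto_def using assms by (intro score_at_cong) auto

lemma measurable_lto_PT [measurable]:
  assumes "i \<in> {1..n}"
  shows "lto c n i (Suc n) \<in> borel_measurable PT"
  unfolding lto_def[abs_def] using assms lto_set_ne[of i "Suc n"]
  by (intro measurable_score_at) auto

lemma split_integral_PT:
  fixes f :: "(nat \<Rightarrow> 'z) \<Rightarrow> real"
  assumes "integrable PT f"
  shows "(\<integral>\<tau>. f \<tau> \<partial>PT) = (\<integral>\<sigma>. (\<integral>y. f (\<sigma>(n := y)) \<partial>P) \<partial>(\<Pi>\<^sub>M i\<in>{1..n-1}. P))"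
proof -
  have "insert n {1..n-1} = {1..n}" "n \<notin> {1..n-1}" using n_ge_2 by auto
  with prod.product_integral_insert[of "{1..n-1}" n f] assms show ?thesis by simp
qed

lemma integral_of_bool_Q: "(\<integral>w. of_bool (R w) \<partial>Q) = measure Q {w\<in>space Q. R w}"
  by (rule measure_eq_integral_of_bool[symmetric])

end

text \<open>
  A Lipschitz test function, for which the empirical mean of the leave-one-out training scores is
  compared with the conditional mean of the new score.
\<close>

locale iid_scores_test = iid_scores +
  fixes \<phi> :: "real \<Rightarrow> real" and L :: real
  assumes \<phi>_0: "\<And>x. 0 \<le> \<phi> x" and \<phi>_1: "\<And>x. \<phi> x \<le> 1"
    and lip: "\<And>x y. \<bar>\<phi> x - \<phi> y\<bar> \<le> L * \<bar>x - y\<bar>" and L_0: "0 \<le> L"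
    and measurable_\<phi> [measurable]: "\<phi> \<in> borel_measurable borel"
begin

abbreviation \<phi>loo where "\<phi>loo i w \<equiv> \<phi> (loo c n i w)"
abbreviation \<phi>lto where "\<phi>lto i j w \<equiv> \<phi> (lto c n i j w)"

lemma measurable_test_scores:
  "i \<in> {1..Suc n} \<Longrightarrow> \<phi>loo i \<in> borel_measurable Q" "i \<in> {1..Suc n} \<Longrightarrow> \<phi>lto i j \<in> borel_measurable Q"
  using measurable_compose[OF measurable_loo measurable_\<phi>] measurable_compose[OF measurable_lto measurable_\<phi>] by auto

lemma integral_diff_le_gap:
  assumes ij: "i \<in> {1..Suc n}" "j \<in> {1..Suc n}" "i \<noteq> j" and \<eta>: "0 \<le> \<eta>"
  shows "(\<integral>w. \<bar>\<phi>loo i w - \<phi>lto i j w\<bar> \<partial>Q) \<le> L * \<eta> + gap \<eta>"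
proof -
  note [measurable] = measurable_test_scores(1)[OF ij(1)] measurable_test_scores(2)[OF ij(1), of j] measurable_loo[OF ij(1)] measurable_lto[OF ij(1), of j]
  have abs1: "\<bar>\<phi> x - \<phi> y\<bar> \<le> 1" for x y using \<phi>_0[of x] \<phi>_0[of y] \<phi>_1[of x] \<phi>_1[of y] by linarith
  have *: "\<bar>\<phi>loo i w - \<phi>lto i j w\<bar> \<le> L * \<eta> + of_bool (\<bar>loo c n i w - lto c n i j w\<bar> > \<eta>)" for w
  proof (cases "\<bar>loo c n i w - lto c n i j w\<bar> > \<eta>")
    case True then show ?thesis using abs1 \<eta> L_0 by (simp add: add_increasing)
  next
    case False
    then have "L * \<bar>loo c n i w - lto c n i j w\<bar> \<le> L * \<eta>" using L_0 by (intro mult_left_mono) auto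
    with lip[of "loo c n i w" "lto c n i j w"] False show ?thesis by simp
  qed
  have int: "integrable Q (\<lambda>w. of_bool (\<bar>loo c n i w - lto c n i j w\<bar> > \<eta>) :: real)"
    by (intro integrable_bdd[where B=1]) auto
  have "(\<integral>w. \<bar>\<phi>loo i w - \<phi>lto i j w\<bar> \<partial>Q)
    \<le> (\<integral>w. L * \<eta> + of_bool (\<bar>loo c n i w - lto c n i j w\<bar> > \<eta>) \<partial>Q)"
  proof (rule integral_mono)
    show "integrable Q (\<lambda>w. \<bar>\<phi>loo i w - \<phi>lto i j w\<bar>)"
      using abs1 by (intro integrable_bdd[where B=1]) auto
  qed (use int * in auto)
  also have "\<dots> = L * \<eta> + gap \<eta>"
    using int Q.prob_space by (simp add: integral_of_bool_Q gap_eq[OF ij])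
  finally show ?thesis .
qed

lemma integral_prod_le:
  fixes X Y X' Y' :: "(nat \<Rightarrow> 'a) \<Rightarrow> real"
  assumes [measurable]: "X \<in> borel_measurable Q" "Y \<in> borel_measurable Q" "X' \<in> borel_measurable Q" "Y' \<in> borel_measurable Q"
    and b: "\<And>w. 0 \<le> X w" "\<And>w. X w \<le> 1" "\<And>w. 0 \<le> Y w" "\<And>w. Y w \<le> 1"
      "\<And>w. 0 \<le> X' w" "\<And>w. X' w \<le> 1" "\<And>w. 0 \<le> Y' w" "\<And>w. Y' w \<le> 1"
  shows "(\<integral>w. X w * Y w \<partial>Q) \<le> (\<integral>w. X' w * Y' w \<partial>Q) + (\<integral>w. \<bar>X w - X' w\<bar> \<partial>Q) + (\<integral>w. \<bar>Y w - Y' w\<bar> \<partial>Q)"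
proof -
  have i1: "integrable Q (\<lambda>w. \<bar>X w - X' w\<bar>)" "integrable Q (\<lambda>w. \<bar>Y w - Y' w\<bar>)"
    using b by (auto intro!: integrable_bdd[where B=1] simp: abs_le_iff diff_le_eq add_increasing add_increasing2)
  have i2: "integrable Q (\<lambda>w. X w * Y w)" "integrable Q (\<lambda>w. X' w * Y' w)"
    using b by (auto intro!: integrable_bdd[where B=1] simp: abs_mult mult_le_one)
  have "X w * Y w \<le> X' w * Y' w + \<bar>X w - X' w\<bar> + \<bar>Y w - Y' w\<bar>" for w
  proof -
    have "X w * Y w - X' w * Y' w = (X w - X' w) * Y w + X' w * (Y w - Y' w)" by (simp add: algebra_simps)
    moreover have "(X w - X' w) * Y w \<le> \<bar>X w - X' w\<bar> * 1" using b by (intro mult_mono) auto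
    moreover have "X' w * (Y w - Y' w) \<le> 1 * \<bar>Y w - Y' w\<bar>"
      using b by (intro order_trans[OF mult_left_mono mult_right_mono]) auto
    ultimately have "X w * Y w - X' w * Y' w \<le> \<bar>X w - X' w\<bar> * 1 + 1 * \<bar>Y w - Y' w\<bar>"
      by (simp only: add_mono)
    then show ?thesis by simp
  qed
  then have "(\<integral>w. X w * Y w \<partial>Q) \<le> (\<integral>w. X' w * Y' w + \<bar>X w - X' w\<bar> + \<bar>Y w - Y' w\<bar> \<partial>Q)"
    using i1 i2 by (intro integral_mono) auto
  also have "\<dots> = (\<integral>w. X' w * Y' w \<partial>Q) + (\<integral>w. \<bar>X w - X' w\<bar> \<partial>Q) + (\<integral>w. \<bar>Y w - Y' w\<bar> \<partial>Q)"
    using i1 i2 by simp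
  finally show ?thesis .
qed

text \<open>
  The empirical mean \<open>emp\<close> only depends on the training sample. The conditional mean \<open>cond_mean\<close> of the
  new score uses all training observations, \<open>cond_mean'\<close> all except the \<open>n\<close>-th one.
\<close>

definition emp :: "(nat \<Rightarrow> 'a) \<Rightarrow> real" where
  "emp w = (\<Sum>i=1..n. \<phi>lto i (Suc n) w) / real n"

definition cond_mean :: "(nat \<Rightarrow> 'a) \<Rightarrow> real" where
  "cond_mean \<tau> = (\<integral>z. \<phi>loo (Suc n) (\<tau>(Suc n := z)) \<partial>P)"

definition cond_mean' :: "(nat \<Rightarrow> 'a) \<Rightarrow> real" where
  "cond_mean' \<tau> = (\<integral>z. \<phi>lto (Suc n) n (\<tau>(Suc n := z)) \<partial>P)"

lemma emp_bounds: "0 \<le> emp w" "emp w \<le> 1"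
proof -
  show "0 \<le> emp w" unfolding emp_def by (intro divide_nonneg_nonneg sum_nonneg \<phi>_0) simp
  have "(\<Sum>i=1..n. \<phi>lto i (Suc n) w) \<le> (\<Sum>i=1..n. 1)" by (intro sum_mono \<phi>_1)
  then show "emp w \<le> 1" using n_ge_2 by (simp add: emp_def)
qed

lemma emp_append: "emp (\<tau>(Suc n := z)) = emp \<tau>"
  unfolding emp_def by (simp add: lto_append)

lemma measurable_emp [measurable]: "emp \<in> borel_measurable Q" "emp \<in> borel_measurable PT"
proof -
  show "emp \<in> borel_measurable Q"
    unfolding emp_def[abs_def] by (intro borel_measurable_divide borel_measurable_sum measurable_test_scores) auto
  have "(\<lambda>w. \<phi>lto i (Suc n) w) \<in> borel_measurable PT" if "i \<in> {1..n}" for i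
    using measurable_compose[OF measurable_lto_PT[OF that] measurable_\<phi>] .
  then show "emp \<in> borel_measurable PT"
    unfolding emp_def[abs_def] by (intro borel_measurable_divide borel_measurable_sum) auto
qed

lemma measurable_cond_mean [measurable]:
  "cond_mean \<in> borel_measurable PT" "cond_mean' \<in> borel_measurable PT"
  unfolding cond_mean_def[abs_def] cond_mean'_def[abs_def]
  by (intro measurable_integral_section measurable_test_scores; simp)+

lemma section_integrable:
  assumes "\<tau> \<in> space PT" "f \<in> borel_measurable Q" "\<And>w. \<bar>f w\<bar> \<le> 1"
  shows "integrable P (\<lambda>z. f (\<tau>(Suc n := z)) :: real)"
  using measurable_section[OF assms(2,1)] assms(3) by (intro integrable_const_bound[where B=1] AE_I2) auto

lemma section_integral_bounds:
  assumes "\<tau> \<in> space PT" "f \<in> borel_measurable Q" "\<And>w. 0 \<le> f w" "\<And>w. f w \<le> (1::real)"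
  shows "0 \<le> (\<integral>z. f (\<tau>(Suc n := z)) \<partial>P)" "(\<integral>z. f (\<tau>(Suc n := z)) \<partial>P) \<le> 1"
proof -
  show "0 \<le> (\<integral>z. f (\<tau>(Suc n := z)) \<partial>P)" using assms by (intro integral_nonneg_AE) auto
  have "(\<integral>z. f (\<tau>(Suc n := z)) \<partial>P) \<le> (\<integral>z. 1 \<partial>P)"
    using assms by (intro integral_mono section_integrable) auto
  then show "(\<integral>z. f (\<tau>(Suc n := z)) \<partial>P) \<le> 1" using prob_space by simp
qed

lemma cond_mean_bounds:
  assumes "\<tau> \<in> space PT"
  shows "0 \<le> cond_mean \<tau>" "cond_mean \<tau> \<le> 1" "0 \<le> cond_mean' \<tau>" "cond_mean' \<tau> \<le> 1"
  unfolding cond_mean_def cond_mean'_def using assms \<phi>_0 \<phi>_1 measurable_test_scores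
  by (auto intro!: section_integral_bounds)

text \<open>
  Given the first \<open>n - 1\<close> observations, the leave-two-out scores of the last two observations are i.i.d.
\<close>

lemma integral_cond_mean'_sq:
  "(\<integral>\<tau>. (cond_mean' \<tau>)\<^sup>2 \<partial>PT) = (\<integral>w. \<phi>lto n (Suc n) w * \<phi>lto (Suc n) n w \<partial>Q)"
proof -
  let ?R = "\<Pi>\<^sub>M i\<in>{1..n-1}. P"
  define J where "J = {1..Suc n} - {n, Suc n}"
  have J: "n \<notin> J" "Suc n \<notin> J" "finite J" by (auto simp: J_def)
  \<comment> \<open>the leave-two-out score as a function of the observation and of the common reference sample\<close>
  define H where "H z w = score_at c (Suc n) J (w(Suc n := z))" for z w
  have H1: "lto c n (Suc n) n (w(Suc n := z)) = H z w" for w z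
    unfolding lto_def H_def J_def by (simp add: insert_commute)
  have H2: "lto c n n (Suc n) (w(n := z)) = H z w" for w z
  proof -
    have "score_at c n J (w(n := z)) = score_at c n J (w(n := z, Suc n := z))"
      using J by (intro score_at_cong) auto
    also have "\<dots> = score_at c (Suc n) J (w(n := z, Suc n := z))"
      by (simp add: score_at_def)
    also have "\<dots> = score_at c (Suc n) J (w(Suc n := z))"
      using J by (intro score_at_cong) auto
    finally show ?thesis unfolding H_def lto_def J_def .
  qed
  have H3: "H z (w(n := y)) = H z w" for w z y
    unfolding H_def using J by (intro score_at_cong) auto
  define h where "h w = (\<integral>z. \<phi> (H z w) \<partial>P)" for w
  have c': "cond_mean' = h" unfolding cond_mean'_def h_def H1 ..
  have h: "h (w(n := y)) = h w" for w y unfolding h_def H3 ..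
  have n: "n \<in> {1..n}" "n \<in> {1..Suc n}" using n_ge_2 by auto
  have "(\<integral>\<tau>. (cond_mean' \<tau>)\<^sup>2 \<partial>PT) = (\<integral>\<sigma>. (\<integral>y. (cond_mean' (\<sigma>(n := y)))\<^sup>2 \<partial>P) \<partial>?R)"
    using cond_mean_bounds
    by (intro split_integral_PT PT_integrable_bdd[where B=1]) (auto simp: abs_square_le_1)
  also have "\<dots> = (\<integral>\<sigma>. (h \<sigma>)\<^sup>2 \<partial>?R)" using prob_space by (simp add: c' h)
  also have "\<dots> = (\<integral>\<sigma>. (\<integral>y. \<phi>lto n (Suc n) (\<sigma>(n := y)) * h (\<sigma>(n := y)) \<partial>P) \<partial>?R)"
    by (simp add: H2 h power2_eq_square) (simp add: h_def)
  also have "\<dots> = (\<integral>\<tau>. \<phi>lto n (Suc n) \<tau> * h \<tau> \<partial>PT)"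
  proof (rule split_integral_PT[symmetric])
    have [measurable]: "\<phi>lto n (Suc n) \<in> borel_measurable PT"
      using measurable_compose[OF measurable_lto_PT[OF n(1)] measurable_\<phi>] .
    show "integrable PT (\<lambda>\<tau>. \<phi>lto n (Suc n) \<tau> * h \<tau>)"
      using cond_mean_bounds \<phi>_0 \<phi>_1
      by (intro PT_integrable_bdd[where B=1]) (auto simp: c'[symmetric] abs_mult intro!: mult_le_one)
  qed
  also have "\<dots> = (\<integral>\<tau>. (\<integral>z. \<phi>lto n (Suc n) (\<tau>(Suc n := z)) * \<phi>lto (Suc n) n (\<tau>(Suc n := z)) \<partial>P) \<partial>PT)"
    by (simp add: lto_append[OF n(1)] H1) (simp add: h_def)
  also have "\<dots> = (\<integral>w. \<phi>lto n (Suc n) w * \<phi>lto (Suc n) n w \<partial>Q)"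
    using n measurable_test_scores \<phi>_0 \<phi>_1
    by (intro split_integral[symmetric] integrable_bdd[where B=1] borel_measurable_times)
       (auto simp: abs_mult intro!: mult_le_one)
  finally show ?thesis .
qed

text \<open>
  Expand the square and let \<open>r\<close> be the mixed moment of \<open>\<phi> (A_n)\<close> and \<open>\<phi> (A_{n+1})\<close>, where \<open>A_i\<close> is the
  leave-one-out score. The expectations of \<open>emp\<^sup>2\<close> and \<open>cond_mean\<^sup>2\<close> are at most \<open>r\<close> and that of
  \<open>emp * cond_mean\<close>, which is subtracted twice, is at least \<open>r\<close>, up to \<open>1 / n\<close> for the diagonal and
  multiples of the stability error \<open>L * \<eta> + gap \<eta>\<close>.
\<close>

lemma integral_sq_deviation:
  assumes \<eta>: "0 \<le> \<eta>"
  shows "(\<integral>\<tau>. (emp \<tau> - cond_mean \<tau>)\<^sup>2 \<partial>PT) \<le> 1 / real n + 8 * (L * \<eta> + gap \<eta>)"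
proof -
  define D where "D = L * \<eta> + gap \<eta>"
  have D0: "0 \<le> D" using L_0 \<eta> by (auto simp: D_def gap_def)
  have d: "(\<integral>w. \<bar>\<phi>lto i j w - \<phi>loo i w\<bar> \<partial>Q) \<le> D"
    if "i \<in> {1..Suc n}" "j \<in> {1..Suc n}" "i \<noteq> j" for i j
    using integral_diff_le_gap[OF that \<eta>] by (simp add: D_def abs_minus_commute)
  have d': "(\<integral>w. \<bar>\<phi>loo i w - \<phi>lto i j w\<bar> \<partial>Q) \<le> D"
    if "i \<in> {1..Suc n}" "j \<in> {1..Suc n}" "i \<noteq> j" for i j
    using integral_diff_le_gap[OF that \<eta>] by (simp add: D_def)
  define r where "r = (\<integral>w. \<phi>loo (Suc n) w * \<phi>loo n w \<partial>Q)"
  have r0: "0 \<le> r" unfolding r_def using \<phi>_0 by (intro integral_nonneg_AE) auto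
  have rr: "(\<integral>w. \<phi>loo i w * \<phi>loo j w \<partial>Q) = r" if "i \<in> {1..Suc n}" "j \<in> {1..Suc n}" "i \<noteq> j" for i j
    unfolding r_def by (rule integral_loo_loo[OF that]) measurable
  have n0: "real n > 0" using n_ge_2 by simp
  note bds = \<phi>_0 \<phi>_1
  have Suc_n: "Suc n \<in> {1..Suc n}" "n \<in> {1..Suc n}" using n_ge_2 by auto
  have ltolto: "(\<integral>w. \<phi>lto i (Suc n) w * \<phi>lto j (Suc n) w \<partial>Q) \<le> of_bool (i = j) + (r + 2 * D)"
    if ij: "i \<in> {1..n}" "j \<in> {1..n}" for i j
  proof (cases "i = j")
    case True
    have "(\<integral>w. \<phi>lto i (Suc n) w * \<phi>lto j (Suc n) w \<partial>Q) \<le> (\<integral>w. 1 \<partial>Q)"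
      using ij bds measurable_test_scores
      by (intro integral_mono integrable_bdd[where B=1] borel_measurable_times) (auto simp: abs_mult intro!: mult_le_one)
    then show ?thesis using True D0 r0 Q.prob_space by simp
  next
    case False
    have "(\<integral>w. \<phi>lto i (Suc n) w * \<phi>lto j (Suc n) w \<partial>Q) \<le> (\<integral>w. \<phi>loo i w * \<phi>loo j w \<partial>Q)
      + (\<integral>w. \<bar>\<phi>lto i (Suc n) w - \<phi>loo i w\<bar> \<partial>Q) + (\<integral>w. \<bar>\<phi>lto j (Suc n) w - \<phi>loo j w\<bar> \<partial>Q)"
      using ij by (intro integral_prod_le measurable_test_scores bds) auto
    with d[of i "Suc n"] d[of j "Suc n"] rr[of i j] ij False show ?thesis by auto
  qed
  have ltoloo: "r - D \<le> (\<integral>w. \<phi>lto i (Suc n) w * \<phi>loo (Suc n) w \<partial>Q)" if i: "i \<in> {1..n}" for i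
  proof -
    have "(\<integral>w. \<phi>loo i w * \<phi>loo (Suc n) w \<partial>Q) \<le> (\<integral>w. \<phi>lto i (Suc n) w * \<phi>loo (Suc n) w \<partial>Q)
      + (\<integral>w. \<bar>\<phi>loo i w - \<phi>lto i (Suc n) w\<bar> \<partial>Q) + (\<integral>w. \<bar>\<phi>loo (Suc n) w - \<phi>loo (Suc n) w\<bar> \<partial>Q)"
      using i by (intro integral_prod_le measurable_test_scores bds) auto
    with d'[of i "Suc n"] rr[of i "Suc n"] i show ?thesis by auto
  qed
  have cross: "(\<integral>w. \<phi>lto n (Suc n) w * \<phi>lto (Suc n) n w \<partial>Q) \<le> r + 2 * D"
  proof -
    have "(\<integral>w. \<phi>lto n (Suc n) w * \<phi>lto (Suc n) n w \<partial>Q) \<le> (\<integral>w. \<phi>loo n w * \<phi>loo (Suc n) w \<partial>Q)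
      + (\<integral>w. \<bar>\<phi>lto n (Suc n) w - \<phi>loo n w\<bar> \<partial>Q) + (\<integral>w. \<bar>\<phi>lto (Suc n) n w - \<phi>loo (Suc n) w\<bar> \<partial>Q)"
      using Suc_n by (intro integral_prod_le measurable_test_scores bds) auto
    with d[of n "Suc n"] d[of "Suc n" n] rr[of n "Suc n"] Suc_n show ?thesis by auto
  qed
  have int_emp2: "integrable PT (\<lambda>\<tau>. (emp \<tau>)\<^sup>2)"
    using emp_bounds by (intro PT_integrable_bdd[where B=1]) (auto simp: abs_square_le_1)
  have int_cm2: "integrable PT (\<lambda>\<tau>. (cond_mean \<tau>)\<^sup>2)" "integrable PT (\<lambda>\<tau>. (cond_mean' \<tau>)\<^sup>2)"
    using cond_mean_bounds by (auto intro!: PT_integrable_bdd[where B=1] simp: abs_square_le_1)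
  have int_prod: "integrable PT (\<lambda>\<tau>. emp \<tau> * cond_mean \<tau>)"
    using cond_mean_bounds emp_bounds
    by (intro PT_integrable_bdd[where B=1]) (auto simp: abs_mult intro!: mult_le_one)
  have int_ll: "integrable Q (\<lambda>w. \<phi>lto i (Suc n) w * \<phi>lto j (Suc n) w)" if "i \<in> {1..n}" "j \<in> {1..n}" for i j
    using that bds measurable_test_scores
    by (intro integrable_bdd[where B=1] borel_measurable_times) (auto simp: abs_mult intro!: mult_le_one)
  have int_lo: "integrable Q (\<lambda>w. \<phi>lto i (Suc n) w * \<phi>loo (Suc n) w)" if "i \<in> {1..n}" for i
    using that bds measurable_test_scores
    by (intro integrable_bdd[where B=1] borel_measurable_times) (auto simp: abs_mult intro!: mult_le_one)
  have e1: "(\<integral>\<tau>. (emp \<tau>)\<^sup>2 \<partial>PT) \<le> 1 / real n + r + 2 * D"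
  proof -
    have "(\<integral>\<tau>. (emp \<tau>)\<^sup>2 \<partial>PT) = (\<integral>w. (emp w)\<^sup>2 \<partial>Q)"
    proof (subst split_integral)
      show "integrable Q (\<lambda>w. (emp w)\<^sup>2)"
        using emp_bounds by (intro integrable_bdd[where B=1]) (auto simp: abs_square_le_1)
    qed (simp add: emp_append prob_space)
    also have "\<dots> = (\<integral>w. (\<Sum>i=1..n. \<Sum>j=1..n. \<phi>lto i (Suc n) w * \<phi>lto j (Suc n) w) / (real n)\<^sup>2 \<partial>Q)"
      by (simp add: emp_def power_divide power2_eq_square sum_product)
    also have "\<dots> = (\<Sum>i=1..n. \<integral>w. (\<Sum>j=1..n. \<phi>lto i (Suc n) w * \<phi>lto j (Suc n) w) \<partial>Q) / (real n)\<^sup>2"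
      by (subst Bochner_Integration.integral_sum[symmetric], rule Bochner_Integration.integrable_sum, rule int_ll)
        auto
    also have "\<dots> = (\<Sum>i=1..n. \<Sum>j=1..n. (\<integral>w. \<phi>lto i (Suc n) w * \<phi>lto j (Suc n) w \<partial>Q)) / (real n)\<^sup>2"
      by (intro arg_cong2[where f="(/)"] refl sum.cong Bochner_Integration.integral_sum int_ll)
    also have "\<dots> \<le> (\<Sum>i=1..n. \<Sum>j=1..n. of_bool (i = j) + (r + 2 * D)) / (real n)\<^sup>2"
      using ltolto by (intro divide_right_mono sum_mono) auto
    also have "\<dots> = (real n + (real n)\<^sup>2 * (r + 2 * D)) / (real n)\<^sup>2"
      by (simp add: sum.distrib power2_eq_square of_bool_def sum.delta' algebra_simps)
    also have "\<dots> = 1 / real n + r + 2 * D"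
      using n0 by (simp add: power2_eq_square field_simps)
    finally show ?thesis .
  qed
  have e2: "r - D \<le> (\<integral>\<tau>. emp \<tau> * cond_mean \<tau> \<partial>PT)"
  proof -
    have "r - D = (\<Sum>i=1..n. r - D) / real n" using n0 by simp
    also have "\<dots> \<le> (\<Sum>i=1..n. (\<integral>w. \<phi>lto i (Suc n) w * \<phi>loo (Suc n) w \<partial>Q)) / real n"
      using ltoloo by (intro divide_right_mono sum_mono) auto
    also have "\<dots> = (\<integral>w. emp w * \<phi>loo (Suc n) w \<partial>Q)"
      unfolding emp_def sum_distrib_right times_divide_eq_left
      by (subst Bochner_Integration.integral_sum[symmetric], rule int_lo) auto
    also have "\<dots> = (\<integral>\<tau>. emp \<tau> * cond_mean \<tau> \<partial>PT)"
    proof (subst split_integral)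
      show "integrable Q (\<lambda>w. emp w * \<phi>loo (Suc n) w)"
        using emp_bounds bds measurable_test_scores(1)[OF Suc_n(1)]
        by (intro integrable_bdd[where B=1] borel_measurable_times) (auto simp: abs_mult intro!: mult_le_one)
    qed (simp add: emp_append cond_mean_def)
    finally show ?thesis .
  qed
  have e3: "(\<integral>\<tau>. (cond_mean \<tau>)\<^sup>2 \<partial>PT) \<le> r + 4 * D"
  proof -
    have sq: "x\<^sup>2 \<le> y\<^sup>2 + 2 * \<bar>x - y\<bar>" if "0 \<le> x" "x \<le> 1" "0 \<le> y" "y \<le> 1" for x y :: real
    proof -
      have "x\<^sup>2 - y\<^sup>2 = (x + y) * (x - y)" by (simp add: power2_eq_square algebra_simps)
      also have "\<dots> \<le> (x + y) * \<bar>x - y\<bar>" using that by (intro mult_left_mono) auto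
      also have "\<dots> \<le> 2 * \<bar>x - y\<bar>" using that by (intro mult_right_mono) auto
      finally show ?thesis by simp
    qed
    have int_abs: "integrable PT (\<lambda>\<tau>. \<bar>cond_mean \<tau> - cond_mean' \<tau>\<bar>)"
      using cond_mean_bounds
      by (intro PT_integrable_bdd[where B=1]) (auto simp: abs_le_iff diff_le_eq add_increasing add_increasing2)
    let ?d = "\<lambda>w. \<bar>\<phi>loo (Suc n) w - \<phi>lto (Suc n) n w\<bar>"
    have int_absQ: "integrable Q (\<lambda>w. ?d w)"
      using bds measurable_test_scores Suc_n
      by (intro integrable_bdd[where B=1] borel_measurable_abs borel_measurable_diff)
         (auto simp: abs_le_iff diff_le_eq add_increasing add_increasing2)
    have "(\<integral>\<tau>. \<bar>cond_mean \<tau> - cond_mean' \<tau>\<bar> \<partial>PT)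
      \<le> (\<integral>\<tau>. (\<integral>z. ?d (\<tau>(Suc n := z)) \<partial>P) \<partial>PT)"
    proof (rule integral_mono[OF int_abs])
      have [measurable]: "(\<lambda>w. ?d w) \<in> borel_measurable Q"
        using int_absQ by auto
      have 1: "\<bar>\<phi> x - \<phi> y\<bar> \<le> 1" for x y using \<phi>_0[of x] \<phi>_0[of y] \<phi>_1[of x] \<phi>_1[of y] by linarith
      show "integrable PT (\<lambda>\<tau>. \<integral>z. ?d (\<tau>(Suc n := z)) \<partial>P)"
      proof (rule PT_integrable_bdd[where B=1])
        show "(\<lambda>\<tau>. \<integral>z. ?d (\<tau>(Suc n := z)) \<partial>P) \<in> borel_measurable PT"
          by (rule measurable_integral_section) measurable
        fix \<tau> assume "\<tau> \<in> space PT"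
        from section_integral_bounds[OF this, of "\<lambda>w. ?d w"] 1
        show "\<bar>\<integral>z. ?d (\<tau>(Suc n := z)) \<partial>P\<bar> \<le> 1" by auto
      qed
      fix \<tau> assume \<tau>: "\<tau> \<in> space PT"
      have "integrable P (\<lambda>z. \<phi>loo (Suc n) (\<tau>(Suc n := z)))" "integrable P (\<lambda>z. \<phi>lto (Suc n) n (\<tau>(Suc n := z)))"
        using bds measurable_test_scores Suc_n by (auto intro!: section_integrable[OF \<tau>])
      then have "cond_mean \<tau> - cond_mean' \<tau> = (\<integral>z. \<phi>loo (Suc n) (\<tau>(Suc n := z)) - \<phi>lto (Suc n) n (\<tau>(Suc n := z)) \<partial>P)"
        unfolding cond_mean_def cond_mean'_def by (rule Bochner_Integration.integral_diff[symmetric])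
      then show "\<bar>cond_mean \<tau> - cond_mean' \<tau>\<bar>
        \<le> (\<integral>z. ?d (\<tau>(Suc n := z)) \<partial>P)"
        by (simp add: integral_abs_bound)
    qed
    also have "\<dots> = (\<integral>w. ?d w \<partial>Q)"
      by (rule split_integral[symmetric, OF int_absQ])
    also have "\<dots> \<le> D" using d'[of "Suc n" n] Suc_n by simp
    finally have D: "(\<integral>\<tau>. \<bar>cond_mean \<tau> - cond_mean' \<tau>\<bar> \<partial>PT) \<le> D" .
    have "(\<integral>\<tau>. (cond_mean \<tau>)\<^sup>2 \<partial>PT) \<le> (\<integral>\<tau>. (cond_mean' \<tau>)\<^sup>2 + 2 * \<bar>cond_mean \<tau> - cond_mean' \<tau>\<bar> \<partial>PT)"
      using int_cm2 int_abs sq cond_mean_bounds by (intro integral_mono) auto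
    also have "\<dots> = (\<integral>\<tau>. (cond_mean' \<tau>)\<^sup>2 \<partial>PT) + 2 * (\<integral>\<tau>. \<bar>cond_mean \<tau> - cond_mean' \<tau>\<bar> \<partial>PT)"
      using int_cm2 int_abs by simp
    finally show ?thesis using D cross integral_cond_mean'_sq by linarith
  qed
  have "(\<integral>\<tau>. (emp \<tau> - cond_mean \<tau>)\<^sup>2 \<partial>PT)
    = (\<integral>\<tau>. (emp \<tau>)\<^sup>2 - 2 * (emp \<tau> * cond_mean \<tau>) + (cond_mean \<tau>)\<^sup>2 \<partial>PT)"
    by (simp add: power2_diff algebra_simps)
  also have "\<dots> = (\<integral>\<tau>. (emp \<tau>)\<^sup>2 \<partial>PT) - 2 * (\<integral>\<tau>. emp \<tau> * cond_mean \<tau> \<partial>PT) + (\<integral>\<tau>. (cond_mean \<tau>)\<^sup>2 \<partial>PT)"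
    using int_emp2 int_cm2 int_prod by simp
  finally have eq: "(\<integral>\<tau>. (emp \<tau> - cond_mean \<tau>)\<^sup>2 \<partial>PT)
    = (\<integral>\<tau>. (emp \<tau>)\<^sup>2 \<partial>PT) - 2 * (\<integral>\<tau>. emp \<tau> * cond_mean \<tau> \<partial>PT) + (\<integral>\<tau>. (cond_mean \<tau>)\<^sup>2 \<partial>PT)" .
  have "A \<le> 1 / real n + 8 * D" if "A = X - 2 * Y + Z" "X \<le> 1 / real n + r + 2 * D" "r - D \<le> Y" "Z \<le> r + 4 * D"
    for A X Y Z :: real using that by linarith
  from this[OF eq e1 e2 e3] show ?thesis unfolding D_def .
qed

lemma integral_abs_deviation:
  assumes \<eta>: "0 \<le> \<eta>" and e: "0 < e"
  shows "(\<integral>\<tau>. \<bar>emp \<tau> - cond_mean \<tau>\<bar> \<partial>PT) \<le> e + (1 / real n + 8 * (L * \<eta> + gap \<eta>)) / e"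
proof -
  have b: "\<bar>emp \<tau> - cond_mean \<tau>\<bar> \<le> 1" if "\<tau> \<in> space PT" for \<tau>
    using cond_mean_bounds[OF that] emp_bounds[of \<tau>] by linarith
  have int: "integrable PT (\<lambda>\<tau>. \<bar>emp \<tau> - cond_mean \<tau>\<bar>)" "integrable PT (\<lambda>\<tau>. (emp \<tau> - cond_mean \<tau>)\<^sup>2)"
    using b by (auto intro!: PT_integrable_bdd[where B=1] simp: abs_square_le_1)
  \<comment> \<open>an elementary substitute for the Cauchy-Schwarz inequality\<close>
  have "\<bar>x\<bar> \<le> e + x\<^sup>2 / e" for x :: real
  proof (cases "\<bar>x\<bar> \<le> e")
    case True then show ?thesis using e by (simp add: add_increasing2)
  next
    case False
    then have "\<bar>x\<bar> * e \<le> \<bar>x\<bar> * \<bar>x\<bar>" by (intro mult_left_mono) auto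
    then have "\<bar>x\<bar> \<le> x\<^sup>2 / e" using e by (simp add: field_simps power2_eq_square)
    then show ?thesis using e by simp
  qed
  then have "(\<integral>\<tau>. \<bar>emp \<tau> - cond_mean \<tau>\<bar> \<partial>PT) \<le> (\<integral>\<tau>. e + (emp \<tau> - cond_mean \<tau>)\<^sup>2 / e \<partial>PT)"
    using int by (intro integral_mono) auto
  also have "\<dots> = e + (\<integral>\<tau>. (emp \<tau> - cond_mean \<tau>)\<^sup>2 \<partial>PT) / e"
    using int PT.prob_space by simp
  also have "\<dots> \<le> e + (1 / real n + 8 * (L * \<eta> + gap \<eta>)) / e"
    using integral_sq_deviation[OF \<eta>] e by (intro add_left_mono divide_right_mono) auto
  finally show ?thesis .
qed

end

section \<open>From smoothed averages to noncoverage\<close>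

text \<open>
  The ramp increases linearly from \<open>0\<close> at \<open>s - d\<close> to \<open>1\<close> at \<open>s\<close>.
\<close>

definition ramp :: "real \<Rightarrow> real \<Rightarrow> real \<Rightarrow> real" where
  "ramp s d x = min 1 (max 0 ((x - s) / d + 1))"

lemma ramp_bounds: "0 \<le> ramp s d x" "ramp s d x \<le> 1"
  by (auto simp: ramp_def)

lemma ramp_eq_1: "d > 0 \<Longrightarrow> s \<le> x \<Longrightarrow> ramp s d x = 1"
  by (auto simp: ramp_def)

lemma ramp_eq_0: "d > 0 \<Longrightarrow> x \<le> s - d \<Longrightarrow> ramp s d x = 0"
  by (auto simp: ramp_def field_simps)

lemma ramp_lipschitz:
  assumes "d > 0" shows "\<bar>ramp s d x - ramp s d y\<bar> \<le> 1 / d * \<bar>x - y\<bar>"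
proof -
  have "\<bar>ramp s d x - ramp s d y\<bar> \<le> \<bar>((x - s) / d + 1) - ((y - s) / d + 1)\<bar>"
    unfolding ramp_def by linarith
  also have "((x - s) / d + 1) - ((y - s) / d + 1) = (x - y) / d" by (simp add: diff_divide_distrib)
  finally show ?thesis using assms by (simp add: abs_divide)
qed

lemma measurable_ramp [measurable]: "ramp s d \<in> borel_measurable borel"
  unfolding ramp_def[abs_def] by measurable

text \<open>
  The event is upward closed in the value of \<open>b\<close>. On \<open>\<bar>b\<bar> \<le> R\<close> it is therefore contained in \<open>s_k \<le> b\<close> for
  the grid point \<open>s_k\<close> just below its smallest value, and the ramp at \<open>s_k\<close> bounds its probability from
  above. Some \<open>z0\<close> in the event satisfies \<open>b z0 < s_k + d\<close>. Since the ramp vanishes below \<open>s_k - d\<close>, it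
  is positive at \<open>a i\<close> only if \<open>b z0 - 2 d \<le> a i\<close>, so that its mean over \<open>i\<close> is at most \<open>\<gamma>\<close>.
\<close>

lemma (in prob_space) grid_bound:
  fixes a :: "nat \<Rightarrow> real" and b :: "'a \<Rightarrow> real"
  assumes [measurable]: "b \<in> borel_measurable M" and d: "d > 0" and n: "n \<ge> 1"
    and m: "R \<le> - R + real m * d" and \<gamma>: "\<gamma> \<ge> 0"
  shows "prob {z\<in>space M. (\<Sum>i=1..n. of_bool (b z - 2 * d \<le> a i)) \<le> \<gamma> * real n}
    \<le> \<gamma> + (\<Sum>k\<le>m. \<bar>(\<Sum>i=1..n. ramp (- R + real k * d) d (a i)) / real n
                     - (\<integral>z. ramp (- R + real k * d) d (b z) \<partial>M)\<bar>)
        + prob {z\<in>space M. \<bar>b z\<bar> > R}"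
proof -
  define A where "A z \<longleftrightarrow> (\<Sum>i=1..n. of_bool (b z - 2 * d \<le> a i)) \<le> \<gamma> * real n" for z
  define s where "s k = - R + real k * d" for k
  define dev where "dev k = \<bar>(\<Sum>i=1..n. ramp (s k) d (a i)) / real n - (\<integral>z. ramp (s k) d (b z) \<partial>M)\<bar>" for k
  have [measurable]: "Measurable.pred M A" unfolding A_def by measurable
  have dev0: "0 \<le> (\<Sum>k\<le>m. dev k)" by (intro sum_nonneg) (auto simp: dev_def)
  have "prob {z\<in>space M. A z} \<le> \<gamma> + (\<Sum>k\<le>m. dev k) + prob {z\<in>space M. \<bar>b z\<bar> > R}"
  proof (cases "\<exists>z\<in>space M. A z \<and> \<bar>b z\<bar> \<le> R")
    case False
    then have "prob {z\<in>space M. A z} \<le> prob {z\<in>space M. \<bar>b z\<bar> > R}"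
      by (intro finite_measure_mono) auto
    then show ?thesis using dev0 \<gamma> by linarith
  next
    case True
    define S where "S k \<longleftrightarrow> (\<exists>z\<in>space M. A z \<and> \<bar>b z\<bar> \<le> R \<and> b z < s (Suc k))" for k
    have "S m" using True m d unfolding S_def s_def by (force simp: algebra_simps)
    define k where "k = (LEAST k. S k)"
    have "S k" unfolding k_def by (rule LeastI) fact
    have "k \<le> m" unfolding k_def by (rule Least_le) fact
    obtain z0 where z0: "z0 \<in> space M" "A z0" "b z0 < s (Suc k)" using \<open>S k\<close> by (auto simp: S_def)
    have low: "s k \<le> b z" if z: "z \<in> space M" "A z" "\<bar>b z\<bar> \<le> R" for z
    proof (cases k)
      case 0 then show ?thesis using z by (simp add: s_def)
    next
      case (Suc k')
      then have "\<not> S k'" using not_less_Least[of k' S] by (simp add: k_def)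
      then show ?thesis using z Suc by (auto simp: S_def not_less)
    qed
    have "(\<Sum>i=1..n. ramp (s k) d (a i)) \<le> (\<Sum>i=1..n. of_bool (b z0 - 2 * d \<le> a i))"
    proof (rule sum_mono)
      fix i
      show "ramp (s k) d (a i) \<le> of_bool (b z0 - 2 * d \<le> a i)"
      proof (cases "b z0 - 2 * d \<le> a i")
        case False
        then have "a i \<le> s k - d" using z0(3) by (simp add: s_def algebra_simps)
        then show ?thesis using d by (simp add: ramp_eq_0)
      qed (simp add: ramp_bounds)
    qed
    also have "\<dots> \<le> \<gamma> * real n" using z0 by (simp add: A_def)
    finally have mean: "(\<Sum>i=1..n. ramp (s k) d (a i)) / real n \<le> \<gamma>" using n by (simp add: field_simps)
    have "prob {z\<in>space M. A z} \<le> prob ({z\<in>space M. s k \<le> b z} \<union> {z\<in>space M. \<bar>b z\<bar> > R})"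
      using low by (intro finite_measure_mono) (auto simp: not_less)
    also have "\<dots> \<le> prob {z\<in>space M. s k \<le> b z} + prob {z\<in>space M. \<bar>b z\<bar> > R}"
      by (intro measure_Un_le) measurable
    also have "prob {z\<in>space M. s k \<le> b z} \<le> (\<integral>z. ramp (s k) d (b z) \<partial>M)"
      unfolding measure_eq_integral_of_bool
      using d by (intro integral_mono integrable_const_bound[where B=1] AE_I2)
        (auto simp: ramp_bounds ramp_eq_1 of_bool_def)
    also have "\<dots> \<le> (\<Sum>i=1..n. ramp (s k) d (a i)) / real n + dev k" unfolding dev_def by linarith
    also have "\<dots> \<le> \<gamma> + (\<Sum>k\<le>m. dev k)"
      using mean \<open>k \<le> m\<close> by (intro add_mono member_le_sum) (auto simp: dev_def)
    finally show ?thesis by simp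
  qed
  then show ?thesis unfolding A_def dev_def s_def .
qed

section \<open>Counting statistics of the prediction sets\<close>

text \<open>
  The response of the last of the \<open>n + 1\<close> observations is outside the prediction set at level \<open>\<alpha>\<close> iff the
  count is at most \<open>\<alpha> (n + 1)\<close>. The jackknife count \<open>count_jk\<close> is a hybrid of the full conformal
  count \<open>count_fc\<close> and the cross-conformal count \<open>count_cc\<close>.
\<close>

definition count_fc :: "(nat \<Rightarrow> 'z \<Rightarrow> (nat \<Rightarrow> 'z) \<Rightarrow> real) \<Rightarrow> nat \<Rightarrow> real \<Rightarrow> (nat \<Rightarrow> 'z) \<Rightarrow> real" where
  "count_fc c n \<delta> w = 1 + (\<Sum>i=1..n. of_bool (loo c n (Suc n) w \<le> loo c n i w + \<delta>))"

definition count_cc :: "(nat \<Rightarrow> 'z \<Rightarrow> (nat \<Rightarrow> 'z) \<Rightarrow> real) \<Rightarrow> nat \<Rightarrow> real \<Rightarrow> (nat \<Rightarrow> 'z) \<Rightarrow> real" where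
  "count_cc c n \<delta> w = 1 + (\<Sum>i=1..n. of_bool (lto c n (Suc n) i w \<le> lto c n i (Suc n) w + \<delta>))"

definition count_jk :: "(nat \<Rightarrow> 'z \<Rightarrow> (nat \<Rightarrow> 'z) \<Rightarrow> real) \<Rightarrow> nat \<Rightarrow> real \<Rightarrow> (nat \<Rightarrow> 'z) \<Rightarrow> real" where
  "count_jk c n \<delta> w = 1 + (\<Sum>i=1..n. of_bool (loo c n (Suc n) w \<le> lto c n i (Suc n) w + \<delta>))"

context iid_scores
begin

lemma measurable_counts [measurable]:
  "count_fc c n \<delta> \<in> borel_measurable Q" "count_cc c n \<delta> \<in> borel_measurable Q" "count_jk c n \<delta> \<in> borel_measurable Q"
proof -
  have *: "(\<lambda>w. of_bool (f w \<le> g w + \<delta>) :: real) \<in> borel_measurable Q"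
    if "f \<in> borel_measurable Q" "g \<in> borel_measurable Q" for f g :: "_ \<Rightarrow> real"
  proof -
    have "{w\<in>space Q. f w \<le> g w + \<delta>} \<in> sets Q"
      using that by (intro borel_measurable_le borel_measurable_add borel_measurable_const)
    then show ?thesis by measurable
  qed
  show "count_fc c n \<delta> \<in> borel_measurable Q" "count_cc c n \<delta> \<in> borel_measurable Q" "count_jk c n \<delta> \<in> borel_measurable Q"
    unfolding count_fc_def[abs_def] count_cc_def[abs_def] count_jk_def[abs_def]
    by (intro borel_measurable_add borel_measurable_const borel_measurable_sum * measurable_loo measurable_lto; simp)+
qed

lemma
  assumes N: "N1 \<in> borel_measurable Q" "N2 \<in> borel_measurable Q"
    and R: "\<And>i. i \<in> {1..n} \<Longrightarrow> Measurable.pred Q (R i)"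
    and q: "\<And>i. i \<in> {1..n} \<Longrightarrow> measure Q {w\<in>space Q. R i w} \<le> q"
    and le: "\<And>w. w \<in> space Q \<Longrightarrow> N1 w \<le> N2 w + (\<Sum>i=1..n. of_bool (R i w))" and e: "e > 0"
  shows integral_excess_le_sum: "(\<integral>\<tau>. excess P n N2 \<tau> \<partial>PT) \<le> (\<integral>\<tau>. excess P n N1 \<tau> \<partial>PT) + e + q / e"
    and integral_deficit_le_sum: "(\<integral>\<tau>. deficit P n N1 \<tau> \<partial>PT) \<le> (\<integral>\<tau>. deficit P n N2 \<tau> \<partial>PT) + e + q / e"
proof -
  have int: "integrable Q (\<lambda>w. of_bool (R i w) :: real)" if "i \<in> {1..n}" for i
  proof (rule integrable_bdd[where B=1])
    have [measurable]: "Measurable.pred Q (R i)" by (rule R[OF that])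
    show "(\<lambda>w. of_bool (R i w)) \<in> borel_measurable Q" by measurable
  qed auto
  then have intB: "integrable Q (\<lambda>w. \<Sum>i=1..n. of_bool (R i w) :: real)" by (intro Bochner_Integration.integrable_sum)
  have "(\<integral>w. (\<Sum>i=1..n. of_bool (R i w)) \<partial>Q) = (\<Sum>i=1..n. measure Q {w\<in>space Q. R i w})"
    by (subst Bochner_Integration.integral_sum, rule int) (auto simp: integral_of_bool_Q)
  also have "\<dots> \<le> (\<Sum>i=1..n. q)" using q by (intro sum_mono)
  finally have B: "(\<integral>w. (\<Sum>i=1..n. of_bool (R i w)) \<partial>Q) \<le> real n * q" by simp
  have "0 \<le> q" using order_trans[OF measure_nonneg q, of 1] n_ge_2 by simp
  then have "real n * q \<le> (real n + 1) * q" by (intro mult_right_mono) auto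
  with B have "(\<integral>w. (\<Sum>i=1..n. of_bool (R i w)) \<partial>Q) \<le> (real n + 1) * q" by linarith
  then have "(\<integral>w. (\<Sum>i=1..n. of_bool (R i w)) \<partial>Q) / (e * (real n + 1)) \<le> ((real n + 1) * q) / (e * (real n + 1))"
    using e by (intro divide_right_mono) auto
  also have "\<dots> = q / e" by simp
  finally have *: "(\<integral>w. (\<Sum>i=1..n. of_bool (R i w)) \<partial>Q) / (e * (real n + 1)) \<le> q / e" .
  have nonneg: "0 \<le> (\<Sum>i=1..n. of_bool (R i w) :: real)" for w by (intro sum_nonneg) simp
  show "(\<integral>\<tau>. excess P n N2 \<tau> \<partial>PT) \<le> (\<integral>\<tau>. excess P n N1 \<tau> \<partial>PT) + e + q / e"
    by (rule order_trans[OF integral_excess_le[OF N intB nonneg le e] add_left_mono[OF *]])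
  show "(\<integral>\<tau>. deficit P n N1 \<tau> \<partial>PT) \<le> (\<integral>\<tau>. deficit P n N2 \<tau> \<partial>PT) + e + q / e"
    by (rule order_trans[OF integral_deficit_le[OF N intB nonneg le e] add_left_mono[OF *]])
qed

lemma count_le_sum:
  assumes "\<And>i. i \<in> {1..n} \<Longrightarrow> A i \<Longrightarrow> B i \<or> D i"
  shows "1 + (\<Sum>i=1..n. of_bool (A i)) \<le> 1 + (\<Sum>i=1..n. of_bool (B i)) + (\<Sum>i=1..n. of_bool (D i) :: real)"
proof -
  have "(\<Sum>i=1..n. of_bool (A i) :: real) \<le> (\<Sum>i=1..n. of_bool (B i) + of_bool (D i))"
    using assms by (intro sum_mono) fastforce
  then show ?thesis by (simp add: sum.distrib)
qed

text \<open>The full conformal and the cross-conformal counts are both compared with the jackknife count.\<close>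

lemma fc_le_jk: "count_fc c n \<delta> w \<le> count_jk c n (\<delta> + \<eta>) w
    + (\<Sum>i=1..n. of_bool (\<bar>loo c n i w - lto c n i (Suc n) w\<bar> > \<eta>))"
  and jk_le_fc: "count_jk c n \<delta> w \<le> count_fc c n (\<delta> + \<eta>) w
    + (\<Sum>i=1..n. of_bool (\<bar>loo c n i w - lto c n i (Suc n) w\<bar> > \<eta>))"
  and cc_le_jk: "count_cc c n \<delta> w \<le> count_jk c n (\<delta> + \<eta>) w
    + (\<Sum>i=1..n. of_bool (\<bar>loo c n (Suc n) w - lto c n (Suc n) i w\<bar> > \<eta>))"
  and jk_le_cc: "count_jk c n \<delta> w \<le> count_cc c n (\<delta> + \<eta>) w
    + (\<Sum>i=1..n. of_bool (\<bar>loo c n (Suc n) w - lto c n (Suc n) i w\<bar> > \<eta>))"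
  and jk_le_jk: "0 \<le> \<eta> \<Longrightarrow> count_jk c n (\<delta> + \<eta>) w \<le> count_jk c n \<delta> w
    + (\<Sum>i=1..n. of_bool (\<bar>loo c n (Suc n) w - lto c n i (Suc n) w - \<delta>\<bar> \<le> \<eta>))"
  unfolding count_fc_def count_cc_def count_jk_def by (rule count_le_sum; linarith)+

lemma measurable_gap_pred:
  "i \<in> {1..n} \<Longrightarrow> Measurable.pred Q (\<lambda>w. \<bar>loo c n i w - lto c n i (Suc n) w\<bar> > \<eta>)"
  "i \<in> {1..n} \<Longrightarrow> Measurable.pred Q (\<lambda>w. \<bar>loo c n (Suc n) w - lto c n (Suc n) i w\<bar> > \<eta>)"
  "i \<in> {1..n} \<Longrightarrow> Measurable.pred Q (\<lambda>w. \<bar>loo c n (Suc n) w - lto c n i (Suc n) w - \<delta>\<bar> \<le> \<eta>)"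
proof -
  assume "i \<in> {1..n}"
  then have [measurable]: "loo c n i \<in> borel_measurable Q" "lto c n i j \<in> borel_measurable Q"
     "loo c n (Suc n) \<in> borel_measurable Q" "lto c n (Suc n) i \<in> borel_measurable Q" for j
    by (intro measurable_loo measurable_lto; simp)+
  show "Measurable.pred Q (\<lambda>w. \<bar>loo c n i w - lto c n i (Suc n) w\<bar> > \<eta>)"
    "Measurable.pred Q (\<lambda>w. \<bar>loo c n (Suc n) w - lto c n (Suc n) i w\<bar> > \<eta>)"
    "Measurable.pred Q (\<lambda>w. \<bar>loo c n (Suc n) w - lto c n i (Suc n) w - \<delta>\<bar> \<le> \<eta>)"
    by measurable
qed

lemma gap_prob:
  "i \<in> {1..n} \<Longrightarrow> measure Q {w\<in>space Q. \<bar>loo c n i w - lto c n i (Suc n) w\<bar> > \<eta>} \<le> gap \<eta>"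
  "i \<in> {1..n} \<Longrightarrow> measure Q {w\<in>space Q. \<bar>loo c n (Suc n) w - lto c n (Suc n) i w\<bar> > \<eta>} \<le> gap \<eta>"
  by (simp_all add: gap_eq)

text \<open>
  The two error terms of \<open>grid_bound\<close>: \<open>tail\<close> is the tail probability of the new score, averaged over
  the training sample, and \<open>grid_err\<close> is the total deviation of the means of the ramps. The sign \<open>u\<close>, which is \<open>1\<close> or \<open>- 1\<close>, allows the scores to be reflected at \<open>0\<close>.
\<close>

definition tail :: "real \<Rightarrow> real" where
  "tail R = measure Q {w\<in>space Q. \<bar>loo c n (Suc n) w\<bar> > R}"

definition grid_err :: "real \<Rightarrow> real \<Rightarrow> nat \<Rightarrow> real \<Rightarrow> (nat \<Rightarrow> 'z) \<Rightarrow> real" where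
  "grid_err u R m d \<tau> = (\<Sum>k\<le>m. \<bar>(\<Sum>i=1..n. ramp (- R + real k * d) d (u * lto c n i (Suc n) \<tau>)) / real n
      - (\<integral>z. ramp (- R + real k * d) d (u * loo c n (Suc n) (\<tau>(Suc n := z))) \<partial>P)\<bar>)"

lemma
  assumes u: "\<bar>u\<bar> = 1" and d: "d > 0" and \<eta>: "0 \<le> \<eta>" and e: "0 < e"
  shows integrable_grid_err: "integrable PT (grid_err u R m d)"
    and integral_grid_err: "(\<integral>\<tau>. grid_err u R m d \<tau> \<partial>PT)
      \<le> (real m + 1) * (e + (1 / real n + 8 * (\<eta> / d + gap \<eta>)) / e)"
proof -
  have test: "iid_scores_test P n c (\<lambda>x. ramp (- R + real k * d) d (u * x)) (1 / d)" for k
  proof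
    fix x y :: real
    have "\<bar>u * x - u * y\<bar> = \<bar>x - y\<bar>" using u by (simp add: right_diff_distrib[symmetric] abs_mult)
    then show "\<bar>ramp (- R + real k * d) d (u * x) - ramp (- R + real k * d) d (u * y)\<bar> \<le> 1 / d * \<bar>x - y\<bar>"
      using ramp_lipschitz[OF d, of "- R + real k * d" "u * x" "u * y"] by simp
  qed (use d ramp_bounds in auto)
  let ?dev = "\<lambda>k \<tau>. \<bar>(\<Sum>i=1..n. ramp (- R + real k * d) d (u * lto c n i (Suc n) \<tau>)) / real n
      - (\<integral>z. ramp (- R + real k * d) d (u * loo c n (Suc n) (\<tau>(Suc n := z))) \<partial>P)\<bar>"
  let ?bd = "e + (1 / real n + 8 * (\<eta> / d + gap \<eta>)) / e"
  have int: "integrable PT (?dev k)" and le: "(\<integral>\<tau>. ?dev k \<tau> \<partial>PT) \<le> ?bd" for k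
  proof -
    interpret T: iid_scores_test P n c "\<lambda>x. ramp (- R + real k * d) d (u * x)" "1 / d" by (rule test)
    have "\<bar>T.emp \<tau> - T.cond_mean \<tau>\<bar> \<le> 1" if "\<tau> \<in> space PT" for \<tau>
      using T.cond_mean_bounds[OF that] T.emp_bounds[of \<tau>] by linarith
    then have "integrable PT (\<lambda>\<tau>. \<bar>T.emp \<tau> - T.cond_mean \<tau>\<bar>)"
      by (intro PT_integrable_bdd[where B=1] borel_measurable_abs borel_measurable_diff
          T.measurable_emp(2) T.measurable_cond_mean(1)) simp
    then show "integrable PT (?dev k)"
      unfolding T.emp_def T.cond_mean_def .
    from T.integral_abs_deviation[OF \<eta> e]
    show "(\<integral>\<tau>. ?dev k \<tau> \<partial>PT) \<le> ?bd"
      unfolding T.emp_def T.cond_mean_def by simp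
  qed
  show "integrable PT (grid_err u R m d)"
    unfolding grid_err_def[abs_def] by (intro Bochner_Integration.integrable_sum int)
  have "(\<integral>\<tau>. grid_err u R m d \<tau> \<partial>PT) \<le> (\<Sum>k\<le>m. ?bd)"
    unfolding grid_err_def by (subst Bochner_Integration.integral_sum, rule int) (rule sum_mono, rule le)
  then show "(\<integral>\<tau>. grid_err u R m d \<tau> \<partial>PT) \<le> (real m + 1) * ?bd"
    by (simp add: algebra_simps)
qed

lemma section_tail:
  shows "integrable PT (\<lambda>\<tau>. measure P {z\<in>space P. \<bar>loo c n (Suc n) (\<tau>(Suc n := z))\<bar> > R})"
    and "(\<integral>\<tau>. measure P {z\<in>space P. \<bar>loo c n (Suc n) (\<tau>(Suc n := z))\<bar> > R} \<partial>PT) = tail R"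
proof -
  have [measurable]: "loo c n (Suc n) \<in> borel_measurable Q" by (rule measurable_loo) simp
  have "Measurable.pred Q (\<lambda>w. \<bar>loo c n (Suc n) w\<bar> > R)" by measurable
  from measurable_prob_section[OF this]
  show "integrable PT (\<lambda>\<tau>. measure P {z\<in>space P. \<bar>loo c n (Suc n) (\<tau>(Suc n := z))\<bar> > R})"
    "(\<integral>\<tau>. measure P {z\<in>space P. \<bar>loo c n (Suc n) (\<tau>(Suc n := z))\<bar> > R} \<partial>PT) = tail R"
    by (auto simp: tail_def intro: PT_integrable_bdd[where B=1])
qed

lemma jk_grid:
  assumes u: "\<bar>u\<bar> = 1" and d: "d > 0" and m: "R \<le> - R + real m * d" and \<gamma>: "\<gamma> \<ge> 0" and \<tau>: "\<tau> \<in> space PT"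
  shows "measure P {z\<in>space P. (\<Sum>i=1..n. of_bool (u * loo c n (Suc n) (\<tau>(Suc n := z)) - 2 * d
      \<le> u * lto c n i (Suc n) \<tau>)) \<le> \<gamma> * real n}
    \<le> \<gamma> + grid_err u R m d \<tau> + measure P {z\<in>space P. \<bar>loo c n (Suc n) (\<tau>(Suc n := z))\<bar> > R}"
proof -
  have "(\<lambda>z. loo c n (Suc n) (\<tau>(Suc n := z))) \<in> borel_measurable P"
    by (intro measurable_section \<tau> measurable_loo) simp
  then have "(\<lambda>z. u * loo c n (Suc n) (\<tau>(Suc n := z))) \<in> borel_measurable P" by measurable
  moreover have "n \<ge> 1" using n_ge_2 by simp
  ultimately show ?thesis
    using grid_bound[of "\<lambda>z. u * loo c n (Suc n) (\<tau>(Suc n := z))" d n R m \<gamma> "\<lambda>i. u * lto c n i (Suc n) \<tau>"] d m \<gamma> u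
    unfolding grid_err_def by (simp add: abs_mult)
qed

lemma integral_excess_jk:
  assumes d: "d > 0" and m: "R \<le> - R + real m * d"
  shows "(\<integral>\<tau>. excess P n (count_jk c n (2 * d)) \<tau> \<partial>PT) \<le> (\<integral>\<tau>. grid_err 1 R m d \<tau> \<partial>PT) + tail R"
proof -
  define T where "T \<tau> = measure P {z\<in>space P. \<bar>loo c n (Suc n) (\<tau>(Suc n := z))\<bar> > R}" for \<tau>
  have le: "excess P n (count_jk c n (2 * d)) \<tau> \<le> grid_err 1 R m d \<tau> + T \<tau>" if \<tau>: "\<tau> \<in> space PT" for \<tau>
    unfolding excess_def
  proof (rule cSUP_least, simp)
    fix a :: real assume a: "a \<in> {0..1}"
    have 1: "(\<lambda>z. loo c n (Suc n) (\<tau>(Suc n := z))) \<in> borel_measurable P"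
      by (intro measurable_section \<tau> measurable_loo) simp
    let ?s = "\<lambda>z. \<Sum>i=1..n. of_bool (1 * loo c n (Suc n) (\<tau>(Suc n := z)) - 2 * d \<le> 1 * lto c n i (Suc n) \<tau>)"
    have "level P n (count_jk c n (2 * d)) \<tau> a \<le> measure P {z\<in>space P.
      ?s z \<le> a * real n}"
      unfolding level_def
    proof (intro finite_measure_mono)
      show "{z \<in> space P. count_jk c n (2 * d) (\<tau>(Suc n := z)) \<le> a * (real n + 1)} \<subseteq>
        {z\<in>space P. ?s z \<le> a * real n}"
      proof clarify
        fix z assume z: "count_jk c n (2 * d) (\<tau>(Suc n := z)) \<le> a * (real n + 1)"
        have "count_jk c n (2 * d) (\<tau>(Suc n := z)) = 1 + ?s z"
          unfolding count_jk_def by (simp add: lto_append diff_le_eq)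
        with z a show "?s z \<le> a * real n"
          unfolding distrib_left by simp
      qed
      note [measurable] = 1
      show "{z\<in>space P. ?s z \<le> a * real n} \<in> sets P"
        by measurable
    qed
    also have "\<dots> \<le> a + grid_err 1 R m d \<tau> + T \<tau>"
      unfolding T_def using a by (intro jk_grid d m \<tau>) auto
    finally show "level P n (count_jk c n (2 * d)) \<tau> a - a \<le> grid_err 1 R m d \<tau> + T \<tau>" by simp
  qed
  have int: "integrable PT (grid_err 1 R m d)" "integrable PT T"
    using section_tail(1)[of R] integrable_grid_err[of 1 d 1 1] d by (auto simp: T_def[abs_def])
  have "(\<integral>\<tau>. excess P n (count_jk c n (2 * d)) \<tau> \<partial>PT) \<le> (\<integral>\<tau>. grid_err 1 R m d \<tau> + T \<tau> \<partial>PT)"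
    using int le by (intro integral_mono integrable_excess) auto
  then show ?thesis using int section_tail(2)[of R] by (simp add: T_def[abs_def])
qed

text \<open>
  The complement of the noncoverage event, which is downward closed in the new score, becomes upward
  closed for the reflected scores. Exact ties would be counted on both sides; this is why the shift is
  larger than the width \<open>2 d\<close> of \<open>grid_bound\<close>.
\<close>

lemma integral_deficit_jk:
  assumes d: "d > 0" and m: "R \<le> - R + real m * d"
  shows "(\<integral>\<tau>. deficit P n (count_jk c n (- 3 * d)) \<tau> \<partial>PT)
    \<le> 1 / real n + (\<integral>\<tau>. grid_err (- 1) R m d \<tau> \<partial>PT) + tail R"
proof -
  define T where "T \<tau> = measure P {z\<in>space P. \<bar>loo c n (Suc n) (\<tau>(Suc n := z))\<bar> > R}" for \<tau>
  have n0: "real n > 0" using n_ge_2 by simp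
  have le: "deficit P n (count_jk c n (- 3 * d)) \<tau> \<le> 1 / real n + grid_err (- 1) R m d \<tau> + T \<tau>"
    if \<tau>: "\<tau> \<in> space PT" for \<tau>
    unfolding deficit_def
  proof (rule cSUP_least, simp)
    fix a :: real assume a: "a \<in> {0..1}"
    note [measurable] = measurable_section[OF measurable_counts(3) \<tau>]
    have [measurable]: "(\<lambda>z. loo c n (Suc n) (\<tau>(Suc n := z))) \<in> borel_measurable P"
      by (intro measurable_section \<tau> measurable_loo) simp
    define \<gamma> where "\<gamma> = (1 - a) * (real n + 1) / real n"
    have "\<gamma> = (1 - a) + (1 - a) / real n"
      using n0 by (simp add: \<gamma>_def field_simps)
    moreover have "(1 - a) / real n \<le> 1 / real n" using a n0 by (intro divide_right_mono) auto
    ultimately have \<gamma>: "\<gamma> \<le> 1 - a + 1 / real n" by linarith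
    have \<gamma>0: "0 \<le> \<gamma>" using a by (simp add: \<gamma>_def)
    have \<gamma>n: "\<gamma> * real n = (1 - a) * (real n + 1)" using n0 by (simp add: \<gamma>_def)
    let ?s = "\<lambda>z. \<Sum>i=1..n. of_bool ((- 1) * loo c n (Suc n) (\<tau>(Suc n := z)) - 2 * d \<le> (- 1) * lto c n i (Suc n) \<tau>)"
    have "1 - level P n (count_jk c n (- 3 * d)) \<tau> a
      = measure P {z\<in>space P. \<not> count_jk c n (- 3 * d) (\<tau>(Suc n := z)) \<le> a * (real n + 1)}"
      unfolding level_def by (subst prob_neg) auto
    also have "\<dots> \<le> measure P {z\<in>space P.
      ?s z \<le> \<gamma> * real n}"
    proof (intro finite_measure_mono)
      show "{z\<in>space P. \<not> count_jk c n (- 3 * d) (\<tau>(Suc n := z)) \<le> a * (real n + 1)} \<subseteq>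
        {z\<in>space P. ?s z \<le> \<gamma> * real n}"
      proof clarify
        fix z assume z: "\<not> count_jk c n (- 3 * d) (\<tau>(Suc n := z)) \<le> a * (real n + 1)"
        let ?b = "loo c n (Suc n) (\<tau>(Suc n := z))" and ?a = "\<lambda>i. lto c n i (Suc n) \<tau>"
        have "(\<Sum>i=1..n. of_bool (?b \<le> ?a i + - 3 * d)) + (\<Sum>i=1..n. of_bool ((- 1) * ?b - 2 * d \<le> (- 1) * ?a i)) \<le> (\<Sum>i=1..n. 1::real)"
          unfolding sum.distrib[symmetric] using d by (intro sum_mono) (auto simp: of_bool_def)
        moreover have "count_jk c n (- 3 * d) (\<tau>(Suc n := z)) = 1 + (\<Sum>i=1..n. of_bool (?b \<le> ?a i + - 3 * d))"
          unfolding count_jk_def by (simp add: lto_append)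
        moreover have "(1 - a) * (real n + 1) = real n + 1 - a * (real n + 1)" by (simp add: algebra_simps)
        ultimately show "(\<Sum>i=1..n. of_bool ((- 1) * ?b - 2 * d \<le> (- 1) * ?a i)) \<le> \<gamma> * real n"
          using z unfolding \<gamma>n by simp
      qed
      show "{z\<in>space P. ?s z \<le> \<gamma> * real n} \<in> sets P"
        by measurable
    qed
    also have "\<dots> \<le> \<gamma> + grid_err (- 1) R m d \<tau> + T \<tau>"
      unfolding T_def by (intro jk_grid d m \<tau> \<gamma>0) auto
    finally show "a - level P n (count_jk c n (- 3 * d)) \<tau> a \<le> 1 / real n + grid_err (- 1) R m d \<tau> + T \<tau>"
      using \<gamma> by linarith
  qed
  have int: "integrable PT (grid_err (- 1) R m d)" "integrable PT T"
    using section_tail(1)[of R] integrable_grid_err[of "- 1" d 1 1] d by (auto simp: T_def[abs_def])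
  have "(\<integral>\<tau>. deficit P n (count_jk c n (- 3 * d)) \<tau> \<partial>PT) \<le> (\<integral>\<tau>. 1 / real n + grid_err (- 1) R m d \<tau> + T \<tau> \<partial>PT)"
    using int le by (intro integral_mono integrable_deficit) auto
  then show ?thesis using int section_tail(2)[of R] PT.prob_space by (simp add: T_def[abs_def])
qed

end

section \<open>Limits along a sequence of sample sizes\<close>

lemma tendsto_zero_squeeze:
  fixes a :: "nat \<Rightarrow> real"
  assumes nonneg: "\<And>n. n \<ge> k \<Longrightarrow> 0 \<le> a n"
    and bound: "\<And>e. e > 0 \<Longrightarrow> \<exists>b. b \<longlonglongrightarrow> 0 \<and> (\<forall>n\<ge>k. a n \<le> b n + e)"
  shows "a \<longlonglongrightarrow> 0"
proof (rule LIMSEQ_I)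
  fix r :: real assume r: "0 < r"
  obtain b where b: "b \<longlonglongrightarrow> 0" "\<And>n. n \<ge> k \<Longrightarrow> a n \<le> b n + r / 2"
    using bound[of "r / 2"] r by auto
  obtain n0 where "\<And>n. n \<ge> n0 \<Longrightarrow> \<bar>b n\<bar> < r / 2"
    using LIMSEQ_D[OF b(1), of "r / 2"] r by auto
  then show "\<exists>n0. \<forall>n\<ge>n0. norm (a n - 0) < r"
    using b(2) nonneg by (intro exI[of _ "max n0 k"]) (fastforce simp: abs_less_iff)
qed

lemma squeeze_step:
  fixes x y z g :: "nat \<Rightarrow> real"
  assumes "\<And>n. n \<ge> 2 \<Longrightarrow> x n \<le> y n + r n" "\<And>n. n \<ge> 2 \<Longrightarrow> y n \<le> z n + s n"
    "\<And>n. r n + s n = e + g n" "z \<longlonglongrightarrow> 0" "g \<longlonglongrightarrow> 0"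
  shows "\<exists>b. b \<longlonglongrightarrow> 0 \<and> (\<forall>n\<ge>2. x n \<le> b n + e)"
proof (intro exI conjI allI impI)
  show "(\<lambda>n. z n + g n) \<longlonglongrightarrow> 0" using tendsto_add[OF assms(4,5)] by simp
  fix n :: nat assume "n \<ge> 2"
  with assms(1,2)[of n] assms(3)[of n] show "x n \<le> z n + g n + e" by linarith
qed

text \<open>
  Stable scores along a sequence of sample sizes. The observation spaces may vary with \<open>n\<close>, as they are
  part of the measures \<open>P n\<close>. Samples of size \<open>n < 2\<close> do not matter for the limits.
\<close>

locale score_seq =
  fixes P :: "nat \<Rightarrow> 'z measure" and c :: "nat \<Rightarrow> nat \<Rightarrow> 'z \<Rightarrow> (nat \<Rightarrow> 'z) \<Rightarrow> real"
  assumes iid: "\<And>n. n \<ge> 2 \<Longrightarrow> iid_scores (P n) n (c n)"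
    and gap_tendsto: "\<And>\<eta>. \<eta> > 0 \<Longrightarrow> (\<lambda>n. iid_scores.gap (P n) n (c n) \<eta>) \<longlonglongrightarrow> 0"
begin

definition mean_excess :: "((nat \<Rightarrow> 'z \<Rightarrow> (nat \<Rightarrow> 'z) \<Rightarrow> real) \<Rightarrow> nat \<Rightarrow> real \<Rightarrow> (nat \<Rightarrow> 'z) \<Rightarrow> real) \<Rightarrow> real \<Rightarrow> nat \<Rightarrow> real" where
  "mean_excess N \<delta> n = (\<integral>\<tau>. excess (P n) n (N (c n) n \<delta>) \<tau> \<partial>(\<Pi>\<^sub>M i\<in>{1..n}. P n))"

definition mean_deficit :: "((nat \<Rightarrow> 'z \<Rightarrow> (nat \<Rightarrow> 'z) \<Rightarrow> real) \<Rightarrow> nat \<Rightarrow> real \<Rightarrow> (nat \<Rightarrow> 'z) \<Rightarrow> real) \<Rightarrow> real \<Rightarrow> nat \<Rightarrow> real" where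
  "mean_deficit N \<delta> n = (\<integral>\<tau>. deficit (P n) n (N (c n) n \<delta>) \<tau> \<partial>(\<Pi>\<^sub>M i\<in>{1..n}. P n))"

abbreviation Qn :: "nat \<Rightarrow> (nat \<Rightarrow> 'z) measure" where "Qn n \<equiv> \<Pi>\<^sub>M i\<in>{1..Suc n}. P n"

abbreviation gap' :: "real \<Rightarrow> nat \<Rightarrow> real" where
  "gap' \<eta> n \<equiv> iid_scores.gap (P n) n (c n) \<eta>"

text \<open>
  Counts that agree with the jackknife count up to the stability error and a shift of \<open>\<delta>\<close>, as far as
  mean excess and mean deficit are concerned.
\<close>

definition near_jk :: "((nat \<Rightarrow> 'z \<Rightarrow> (nat \<Rightarrow> 'z) \<Rightarrow> real) \<Rightarrow> nat \<Rightarrow> real \<Rightarrow> (nat \<Rightarrow> 'z) \<Rightarrow> real) \<Rightarrow> bool" where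
  "near_jk N \<longleftrightarrow>
    (\<forall>n\<ge>2. \<forall>\<delta>. N (c n) n \<delta> \<in> borel_measurable (Qn n)) \<and>
    (\<forall>n\<ge>2. \<forall>\<delta> \<eta> e. 0 < e \<longrightarrow>
      mean_excess N (\<delta> + \<eta>) n \<le> mean_excess count_jk \<delta> n + e + gap' \<eta> n / e \<and>
      mean_excess count_jk (\<delta> + \<eta>) n \<le> mean_excess N \<delta> n + e + gap' \<eta> n / e \<and>
      mean_deficit N \<delta> n \<le> mean_deficit count_jk (\<delta> + \<eta>) n + e + gap' \<eta> n / e \<and>
      mean_deficit count_jk \<delta> n \<le> mean_deficit N (\<delta> + \<eta>) n + e + gap' \<eta> n / e)"

lemma near_jk_fc: "near_jk count_fc"
  unfolding near_jk_def
proof (intro conjI allI impI)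
  show "count_fc (c n) n \<delta> \<in> borel_measurable (Qn n)" if "2 \<le> n" for n \<delta>
    by (rule iid_scores.measurable_counts(1)[OF iid[OF that]])
next
  fix n :: nat and \<delta> \<eta> e :: real assume n: "2 \<le> n" and e: "0 < e"
  interpret iid_scores "P n" n "c n" by (rule iid[OF n])
  show "mean_excess count_fc (\<delta> + \<eta>) n \<le> mean_excess count_jk \<delta> n + e + gap' \<eta> n / e"
    "mean_deficit count_jk \<delta> n \<le> mean_deficit count_fc (\<delta> + \<eta>) n + e + gap' \<eta> n / e"
    unfolding mean_excess_def mean_deficit_def
    by ((rule integral_excess_le_sum[OF measurable_counts(3,1) measurable_gap_pred(1) gap_prob(1) jk_le_fc e]; assumption),
        (rule integral_deficit_le_sum[OF measurable_counts(3,1) measurable_gap_pred(1) gap_prob(1) jk_le_fc e]; assumption))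
  show "mean_excess count_jk (\<delta> + \<eta>) n \<le> mean_excess count_fc \<delta> n + e + gap' \<eta> n / e"
    "mean_deficit count_fc \<delta> n \<le> mean_deficit count_jk (\<delta> + \<eta>) n + e + gap' \<eta> n / e"
    unfolding mean_excess_def mean_deficit_def
    by ((rule integral_excess_le_sum[OF measurable_counts(1,3) measurable_gap_pred(1) gap_prob(1) fc_le_jk e]; assumption),
        (rule integral_deficit_le_sum[OF measurable_counts(1,3) measurable_gap_pred(1) gap_prob(1) fc_le_jk e]; assumption))
qed

lemma near_jk_cc: "near_jk count_cc"
  unfolding near_jk_def
proof (intro conjI allI impI)
  show "count_cc (c n) n \<delta> \<in> borel_measurable (Qn n)" if "2 \<le> n" for n \<delta>
    by (rule iid_scores.measurable_counts(2)[OF iid[OF that]])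
next
  fix n :: nat and \<delta> \<eta> e :: real assume n: "2 \<le> n" and e: "0 < e"
  interpret iid_scores "P n" n "c n" by (rule iid[OF n])
  show "mean_excess count_cc (\<delta> + \<eta>) n \<le> mean_excess count_jk \<delta> n + e + gap' \<eta> n / e"
    "mean_deficit count_jk \<delta> n \<le> mean_deficit count_cc (\<delta> + \<eta>) n + e + gap' \<eta> n / e"
    unfolding mean_excess_def mean_deficit_def
    by ((rule integral_excess_le_sum[OF measurable_counts(3,2) measurable_gap_pred(2) gap_prob(2) jk_le_cc e]; assumption),
        (rule integral_deficit_le_sum[OF measurable_counts(3,2) measurable_gap_pred(2) gap_prob(2) jk_le_cc e]; assumption))
  show "mean_excess count_jk (\<delta> + \<eta>) n \<le> mean_excess count_cc \<delta> n + e + gap' \<eta> n / e"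
    "mean_deficit count_cc \<delta> n \<le> mean_deficit count_jk (\<delta> + \<eta>) n + e + gap' \<eta> n / e"
    unfolding mean_excess_def mean_deficit_def
    by ((rule integral_excess_le_sum[OF measurable_counts(2,3) measurable_gap_pred(2) gap_prob(2) cc_le_jk e]; assumption),
        (rule integral_deficit_le_sum[OF measurable_counts(2,3) measurable_gap_pred(2) gap_prob(2) cc_le_jk e]; assumption))
qed

lemma mean_nonneg:
  assumes "n \<ge> 2" "N (c n) n \<delta> \<in> borel_measurable (Qn n)"
  shows "0 \<le> mean_excess N \<delta> n" "0 \<le> mean_deficit N \<delta> n"
  unfolding mean_excess_def mean_deficit_def
  using iid_scores.excess_bounds(1)[OF iid[OF assms(1)] assms(2)] iid_scores.deficit_bounds(1)[OF iid[OF assms(1)] assms(2)]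
  by (auto intro!: integral_nonneg_AE)

lemma mean_jk_nonneg: "n \<ge> 2 \<Longrightarrow> 0 \<le> mean_excess count_jk \<delta> n" "n \<ge> 2 \<Longrightarrow> 0 \<le> mean_deficit count_jk \<delta> n"
  using mean_nonneg iid_scores.measurable_counts(3)[OF iid] by auto

lemma near_jk_nonneg:
  assumes "near_jk N" "n \<ge> 2"
  shows "0 \<le> mean_excess N \<delta> n" "0 \<le> mean_deficit N \<delta> n"
  using mean_nonneg assms by (auto simp: near_jk_def)

lemma gap_div_tendsto: "\<eta> > 0 \<Longrightarrow> (\<lambda>n. gap' \<eta> n / e) \<longlonglongrightarrow> 0"
  using tendsto_mult_left_zero[OF gap_tendsto, of \<eta> "1 / e"] by simp

lemma conservative_transfer:
  assumes nonneg: "\<And>n \<delta>. n \<ge> 2 \<Longrightarrow> 0 \<le> a \<delta> n"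
    and le: "\<And>n \<delta> \<eta> e. n \<ge> 2 \<Longrightarrow> 0 < e \<Longrightarrow> a (\<delta> + \<eta>) n \<le> b \<delta> n + e + gap' \<eta> n / e"
    and lim: "\<And>\<delta>. 0 < \<delta> \<Longrightarrow> b \<delta> \<longlonglongrightarrow> 0" and \<delta>: "0 < \<delta>"
  shows "a \<delta> \<longlonglongrightarrow> 0"
proof (rule tendsto_zero_squeeze[where k=2])
  fix e :: real assume "0 < e"
  then have "\<forall>n\<ge>2. a \<delta> n \<le> b (\<delta>/2) n + gap' (\<delta>/2) n / e + e"
    using le[of _ e "\<delta>/2" "\<delta>/2"] by (simp add: ac_simps)
  moreover have "(\<lambda>n. b (\<delta>/2) n + gap' (\<delta>/2) n / e) \<longlonglongrightarrow> 0"
    using tendsto_add[of "b (\<delta>/2)" 0 _ _ 0] lim \<delta> gap_div_tendsto[of "\<delta>/2" e] by auto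
  ultimately show "\<exists>b. b \<longlonglongrightarrow> 0 \<and> (\<forall>n\<ge>2. a \<delta> n \<le> b n + e)" by blast
qed (rule nonneg)

lemma conservative_near_jk_iff:
  assumes N: "near_jk N"
  shows "(\<forall>\<delta>>0. mean_excess N \<delta> \<longlonglongrightarrow> 0) \<longleftrightarrow> (\<forall>\<delta>>0. mean_excess count_jk \<delta> \<longlonglongrightarrow> 0)"
  using conservative_transfer[of "mean_excess N" "mean_excess count_jk", OF near_jk_nonneg(1)[OF N]]
    conservative_transfer[of "mean_excess count_jk" "mean_excess N", OF mean_jk_nonneg(1)] N
  unfolding near_jk_def by blast

text \<open>
  The probability that the new score is within \<open>\<eta>\<close> of the score of the \<open>i\<close>-th training observation
  relative to the other ones, and the condition that it is small for small \<open>\<eta>\<close>, uniformly in \<open>n\<close>.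
\<close>

abbreviation tie_prob :: "real \<Rightarrow> nat \<Rightarrow> nat \<Rightarrow> real" where
  "tie_prob \<eta> n i \<equiv> measure (Qn n) {w\<in>space (Qn n).
       \<bar>loo (c n) n (Suc n) w - lto (c n) n i (Suc n) w\<bar> \<le> \<eta>}"

definition no_ties :: bool where
  "no_ties \<longleftrightarrow> (\<forall>e>0. \<exists>\<eta>>0. \<forall>n\<ge>2. \<forall>i\<in>{1..n}. tie_prob \<eta> n i \<le> e)"

lemma jk_shift:
  assumes n: "n \<ge> 2" and e: "e > 0" and \<eta>: "\<eta> \<ge> 0"
    and q: "\<And>i. i \<in> {1..n} \<Longrightarrow> tie_prob \<eta> n i \<le> q"
  shows "mean_excess count_jk 0 n \<le> mean_excess count_jk \<eta> n + e + q / e" (is ?A)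
    and "mean_deficit count_jk \<eta> n \<le> mean_deficit count_jk 0 n + e + q / e" (is ?B)
    and "mean_excess count_jk (- \<eta>) n \<le> mean_excess count_jk 0 n + e + q / e" (is ?C)
    and "mean_deficit count_jk 0 n \<le> mean_deficit count_jk (- \<eta>) n + e + q / e" (is ?D)
proof -
  interpret iid_scores "P n" n "c n" by (rule iid[OF n])
  let ?R = "\<lambda>i w. \<bar>loo (c n) n (Suc n) w - lto (c n) n i (Suc n) w\<bar> \<le> \<eta>"
  have pred: "Measurable.pred Q (?R i)" if "i \<in> {1..n}" for i
    using measurable_gap_pred(3)[OF that, where \<delta>=0] by simp
  have up: "count_jk (c n) n \<eta> w \<le> count_jk (c n) n 0 w + (\<Sum>i=1..n. of_bool (?R i w))" for w
    using jk_le_jk[OF \<eta>, of 0 w] by simp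
  have down: "count_jk (c n) n 0 w \<le> count_jk (c n) n (- \<eta>) w + (\<Sum>i=1..n. of_bool (?R i w))" for w
    unfolding count_jk_def by (rule count_le_sum) linarith
  show ?A ?B ?C ?D
    unfolding mean_excess_def mean_deficit_def
    using integral_excess_le_sum[OF measurable_counts(3,3) pred q up e]
      integral_excess_le_sum[OF measurable_counts(3,3) pred q down e]
      integral_deficit_le_sum[OF measurable_counts(3,3) pred q up e]
      integral_deficit_le_sum[OF measurable_counts(3,3) pred q down e]
    by auto
qed

lemma no_ties_shift:
  assumes no_ties and e: "e > 0"
  shows "\<exists>\<eta>>0. \<forall>n\<ge>2. mean_excess count_jk 0 n \<le> mean_excess count_jk \<eta> n + e \<and>
    mean_deficit count_jk \<eta> n \<le> mean_deficit count_jk 0 n + e \<and>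
    mean_excess count_jk (- \<eta>) n \<le> mean_excess count_jk 0 n + e \<and>
    mean_deficit count_jk 0 n \<le> mean_deficit count_jk (- \<eta>) n + e"
proof -
  have e2: "e / 2 > 0" and q: "e / 2 * (e / 2) > 0" using e by auto
  obtain \<eta> where \<eta>: "\<eta> > 0" and *: "\<forall>n\<ge>2. \<forall>i\<in>{1..n}.
     tie_prob \<eta> n i \<le> e / 2 * (e / 2)"
    using assms(1) q unfolding no_ties_def by blast
  have e': "e / 2 + e / 2 * (e / 2) / (e / 2) = e" using e by simp
  have "mean_excess count_jk 0 n \<le> mean_excess count_jk \<eta> n + e"
    "mean_deficit count_jk \<eta> n \<le> mean_deficit count_jk 0 n + e"
    "mean_excess count_jk (- \<eta>) n \<le> mean_excess count_jk 0 n + e"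
    "mean_deficit count_jk 0 n \<le> mean_deficit count_jk (- \<eta>) n + e" if n: "n \<ge> 2" for n
    using jk_shift[OF n e2 less_imp_le[OF \<eta>], of "e / 2 * (e / 2)"] * n unfolding add.assoc e' by blast+
  then show ?thesis using \<eta> by blast
qed

lemma exact_near_jk_iff:
  assumes N: "near_jk N" and no_ties
  shows "mean_excess N 0 \<longlonglongrightarrow> 0 \<and> mean_deficit N 0 \<longlonglongrightarrow> 0
    \<longleftrightarrow> mean_excess count_jk 0 \<longlonglongrightarrow> 0 \<and> mean_deficit count_jk 0 \<longlonglongrightarrow> 0"
proof (intro iffI conjI; elim conjE)
  have near: "mean_excess N (\<delta> + \<eta>) n \<le> mean_excess count_jk \<delta> n + e + gap' \<eta> n / e"
      "mean_excess count_jk (\<delta> + \<eta>) n \<le> mean_excess N \<delta> n + e + gap' \<eta> n / e"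
      "mean_deficit N \<delta> n \<le> mean_deficit count_jk (\<delta> + \<eta>) n + e + gap' \<eta> n / e"
      "mean_deficit count_jk \<delta> n \<le> mean_deficit N (\<delta> + \<eta>) n + e + gap' \<eta> n / e"
    if "n \<ge> 2" "0 < e" for n \<delta> \<eta> e using N that unfolding near_jk_def by blast+
  {
    assume *: "mean_excess N 0 \<longlonglongrightarrow> 0"
    show "mean_excess count_jk 0 \<longlonglongrightarrow> 0"
    proof (rule tendsto_zero_squeeze[where k=2])
      fix e :: real assume e: "0 < e"
      obtain \<eta> where \<eta>: "\<eta> > 0" "\<And>n. n \<ge> 2 \<Longrightarrow> mean_excess count_jk 0 n \<le> mean_excess count_jk \<eta> n + e / 2"
        using no_ties_shift[OF \<open>no_ties\<close> half_gt_zero[OF e]] by blast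
      show "\<exists>b. b \<longlonglongrightarrow> 0 \<and> (\<forall>n\<ge>2. mean_excess count_jk 0 n \<le> b n + e)"
        by (rule squeeze_step[OF \<eta>(2) near(2)[OF _ half_gt_zero[OF e], of _ 0 \<eta>, simplified add.assoc add_0_left add.left_inverse] _ * gap_div_tendsto[OF \<eta>(1), of "e / 2"]]) simp_all
    qed (rule mean_jk_nonneg)
  next
    assume *: "mean_deficit N 0 \<longlonglongrightarrow> 0"
    show "mean_deficit count_jk 0 \<longlonglongrightarrow> 0"
    proof (rule tendsto_zero_squeeze[where k=2])
      fix e :: real assume e: "0 < e"
      obtain \<eta> where \<eta>: "\<eta> > 0" "\<And>n. n \<ge> 2 \<Longrightarrow> mean_deficit count_jk 0 n \<le> mean_deficit count_jk (- \<eta>) n + e / 2"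
        using no_ties_shift[OF \<open>no_ties\<close> half_gt_zero[OF e]] by blast
      show "\<exists>b. b \<longlonglongrightarrow> 0 \<and> (\<forall>n\<ge>2. mean_deficit count_jk 0 n \<le> b n + e)"
        by (rule squeeze_step[OF \<eta>(2) near(4)[OF _ half_gt_zero[OF e], of _ "- \<eta>" \<eta>, simplified add.assoc add_0_left add.left_inverse] _ * gap_div_tendsto[OF \<eta>(1), of "e / 2"]]) simp_all
    qed (rule mean_jk_nonneg)
  next
    assume *: "mean_excess count_jk 0 \<longlonglongrightarrow> 0"
    show "mean_excess N 0 \<longlonglongrightarrow> 0"
    proof (rule tendsto_zero_squeeze[where k=2])
      fix e :: real assume e: "0 < e"
      obtain \<eta> where \<eta>: "\<eta> > 0" "\<And>n. n \<ge> 2 \<Longrightarrow> mean_excess count_jk (- \<eta>) n \<le> mean_excess count_jk 0 n + e / 2"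
        using no_ties_shift[OF \<open>no_ties\<close> half_gt_zero[OF e]] by blast
      show "\<exists>b. b \<longlonglongrightarrow> 0 \<and> (\<forall>n\<ge>2. mean_excess N 0 n \<le> b n + e)"
        by (rule squeeze_step[OF near(1)[OF _ half_gt_zero[OF e], of _ "- \<eta>" \<eta>, simplified add.assoc add_0_left add.left_inverse] \<eta>(2) _ * gap_div_tendsto[OF \<eta>(1), of "e / 2"]]) simp_all
    qed (rule near_jk_nonneg[OF N])
  next
    assume *: "mean_deficit count_jk 0 \<longlonglongrightarrow> 0"
    show "mean_deficit N 0 \<longlonglongrightarrow> 0"
    proof (rule tendsto_zero_squeeze[where k=2])
      fix e :: real assume e: "0 < e"
      obtain \<eta> where \<eta>: "\<eta> > 0" "\<And>n. n \<ge> 2 \<Longrightarrow> mean_deficit count_jk \<eta> n \<le> mean_deficit count_jk 0 n + e / 2"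
        using no_ties_shift[OF \<open>no_ties\<close> half_gt_zero[OF e]] by blast
      show "\<exists>b. b \<longlonglongrightarrow> 0 \<and> (\<forall>n\<ge>2. mean_deficit N 0 n \<le> b n + e)"
        by (rule squeeze_step[OF near(3)[OF _ half_gt_zero[OF e], of _ 0 \<eta>, simplified add.assoc add_0_left add.left_inverse] \<eta>(2) _ * gap_div_tendsto[OF \<eta>(1), of "e / 2"]]) simp_all
    qed (rule near_jk_nonneg[OF N])
  }
qed

text \<open>
  The new score is bounded in probability.
\<close>

definition tight :: bool where
  "tight \<longleftrightarrow> (\<forall>e>0. \<exists>R. \<forall>n\<ge>2. iid_scores.tail (P n) n (c n) R \<le> e)"

lemma grid_err_tendsto:
  assumes u: "\<bar>u\<bar> = 1" and d: "d > 0"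
  shows "(\<lambda>n. \<integral>\<tau>. iid_scores.grid_err (P n) n (c n) u R m d \<tau> \<partial>(\<Pi>\<^sub>M i\<in>{1..n}. P n)) \<longlonglongrightarrow> 0"
    (is "?G \<longlonglongrightarrow> 0")
proof (rule tendsto_zero_squeeze[where k=2])
  fix n :: nat assume n: "n \<ge> 2"
  show "0 \<le> ?G n" unfolding iid_scores.grid_err_def[OF iid[OF n]]
    by (intro integral_nonneg_AE AE_I2 sum_nonneg) simp
next
  fix e :: real assume e: "0 < e"
  define M where "M = real m + 1"
  have M: "M > 0" by (simp add: M_def)
  \<comment> \<open>chosen such that the two terms that do not tend to \<open>0\<close> with \<open>n\<close> add up to \<open>e\<close>\<close>
  define s where "s = e / (2 * M)"
  have s: "s > 0" using e M by (simp add: s_def)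
  define \<eta> where "\<eta> = d * s * e / (16 * M)"
  have \<eta>: "\<eta> > 0" using d s e M by (simp add: \<eta>_def)
  have eq: "M * (s + (x + 8 * (\<eta> / d + y)) / s) = M / s * (x + 8 * y) + e" for x y
  proof -
    have "M * s = e / 2" using M by (simp add: s_def)
    moreover have "M * (8 * (\<eta> / d)) / s = e / 2" using M s d by (simp add: \<eta>_def field_simps)
    moreover have "M * (s + (x + 8 * (\<eta> / d + y)) / s) = M * s + M * (8 * (\<eta> / d)) / s + M / s * (x + 8 * y)"
      using s by (simp add: field_simps)
    ultimately show ?thesis by simp
  qed
  define b where "b n = M / s * (1 / real n + 8 * gap' \<eta> n)" for n
  have "?G n \<le> b n + e" if n: "n \<ge> 2" for n
  proof -
    have "?G n \<le> M * (s + (1 / real n + 8 * (\<eta> / d + gap' \<eta> n)) / s)"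
      unfolding M_def using \<eta> s by (intro iid_scores.integral_grid_err[OF iid[OF n] u d]) auto
    then show ?thesis unfolding eq b_def .
  qed
  moreover have "b \<longlonglongrightarrow> M / s * (0 + 8 * 0)"
    unfolding b_def by (intro tendsto_intros lim_1_over_n gap_tendsto \<eta>)
  ultimately show "\<exists>b. b \<longlonglongrightarrow> 0 \<and> (\<forall>n\<ge>2. ?G n \<le> b n + e)" by auto
qed

lemma jk_bounds:
  assumes tight and d: "d > 0" and e: "e > 0"
  shows "\<exists>b. b \<longlonglongrightarrow> 0 \<and> (\<forall>n\<ge>2. mean_excess count_jk (2 * d) n \<le> b n + e)"
    and "\<exists>b. b \<longlonglongrightarrow> 0 \<and> (\<forall>n\<ge>2. mean_deficit count_jk (- 3 * d) n \<le> b n + e)"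
proof -
  obtain R where R: "\<And>n. n \<ge> 2 \<Longrightarrow> iid_scores.tail (P n) n (c n) R \<le> e"
    using \<open>tight\<close> e by (auto simp: tight_def)
  obtain m :: nat where "2 * R / d \<le> real m" using real_arch_simple by blast
  then have m: "R \<le> - R + real m * d" using d by (simp add: field_simps)
  let ?G = "\<lambda>u n. \<integral>\<tau>. iid_scores.grid_err (P n) n (c n) u R m d \<tau> \<partial>(\<Pi>\<^sub>M i\<in>{1..n}. P n)"
  have G: "?G 1 \<longlonglongrightarrow> 0" "?G (- 1) \<longlonglongrightarrow> 0" using grid_err_tendsto d by auto
  have "mean_excess count_jk (2 * d) n \<le> ?G 1 n + e" if n: "n \<ge> 2" for n
    using iid_scores.integral_excess_jk[OF iid[OF n] d m] R[OF n] unfolding mean_excess_def by linarith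
  with G show "\<exists>b. b \<longlonglongrightarrow> 0 \<and> (\<forall>n\<ge>2. mean_excess count_jk (2 * d) n \<le> b n + e)" by blast
  have "mean_deficit count_jk (- 3 * d) n \<le> (1 / real n + ?G (- 1) n) + e" if n: "n \<ge> 2" for n
    using iid_scores.integral_deficit_jk[OF iid[OF n] d m] R[OF n] unfolding mean_deficit_def by linarith
  moreover have "(\<lambda>n. 1 / real n + ?G (- 1) n) \<longlonglongrightarrow> 0"
    using tendsto_add[OF lim_1_over_n G(2)] by simp
  ultimately show "\<exists>b. b \<longlonglongrightarrow> 0 \<and> (\<forall>n\<ge>2. mean_deficit count_jk (- 3 * d) n \<le> b n + e)"
    by (intro exI[of _ "\<lambda>n. 1 / real n + ?G (- 1) n"]) blast
qed

lemma conservative_jk: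
  assumes tight "\<delta> > 0" shows "mean_excess count_jk \<delta> \<longlonglongrightarrow> 0"
proof (rule tendsto_zero_squeeze[where k=2])
  fix e :: real assume "0 < e"
  with jk_bounds(1)[OF \<open>tight\<close>, of "\<delta> / 2" e] \<open>\<delta> > 0\<close>
  show "\<exists>b. b \<longlonglongrightarrow> 0 \<and> (\<forall>n\<ge>2. mean_excess count_jk \<delta> n \<le> b n + e)" by simp
qed (rule mean_jk_nonneg)

lemma exact_jk:
  assumes tight no_ties
  shows "mean_excess count_jk 0 \<longlonglongrightarrow> 0" "mean_deficit count_jk 0 \<longlonglongrightarrow> 0"
proof -
  show "mean_excess count_jk 0 \<longlonglongrightarrow> 0"
  proof (rule tendsto_zero_squeeze[where k=2])
    fix e :: real assume e: "0 < e"
    obtain \<eta> where \<eta>: "\<eta> > 0" "\<And>n. n \<ge> 2 \<Longrightarrow> mean_excess count_jk 0 n \<le> mean_excess count_jk \<eta> n + e / 2"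
      using no_ties_shift[OF \<open>no_ties\<close> half_gt_zero[OF e]] by blast
    obtain b where b: "b \<longlonglongrightarrow> 0" "\<And>n. n \<ge> 2 \<Longrightarrow> mean_excess count_jk \<eta> n \<le> b n + e / 2"
      using jk_bounds(1)[OF \<open>tight\<close>, of "\<eta> / 2" "e / 2"] e \<eta>(1) by auto
    show "\<exists>b. b \<longlonglongrightarrow> 0 \<and> (\<forall>n\<ge>2. mean_excess count_jk 0 n \<le> b n + e)"
      by (rule squeeze_step[where g="\<lambda>_. 0", OF \<eta>(2) b(2) _ b(1)]) auto
  qed (rule mean_jk_nonneg)
  show "mean_deficit count_jk 0 \<longlonglongrightarrow> 0"
  proof (rule tendsto_zero_squeeze[where k=2])
    fix e :: real assume e: "0 < e"
    obtain \<eta> where \<eta>: "\<eta> > 0" "\<And>n. n \<ge> 2 \<Longrightarrow> mean_deficit count_jk 0 n \<le> mean_deficit count_jk (- \<eta>) n + e / 2"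
      using no_ties_shift[OF \<open>no_ties\<close> half_gt_zero[OF e]] by blast
    obtain b where b: "b \<longlonglongrightarrow> 0" "\<And>n. n \<ge> 2 \<Longrightarrow> mean_deficit count_jk (- \<eta>) n \<le> b n + e / 2"
      using jk_bounds(2)[OF \<open>tight\<close>, of "\<eta> / 3" "e / 2"] e \<eta>(1) by auto
    show "\<exists>b. b \<longlonglongrightarrow> 0 \<and> (\<forall>n\<ge>2. mean_deficit count_jk 0 n \<le> b n + e)"
      by (rule squeeze_step[where g="\<lambda>_. 0", OF \<eta>(2) b(2) _ b(1)]) auto
  qed (rule mean_jk_nonneg)
qed

end

section \<open>Replacing the conditional distribution of the new observation by its law\<close>

text \<open>
  The sample \<open>t 1, ..., t (n + 1)\<close> on a probability space \<open>M\<close>, with a regular conditional distribution \<open>K\<close>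
  of the last observation given the others. The law \<open>P\<close> has the \<open>\<sigma>\<close>-algebra of the observation space \<open>Z\<close>.
\<close>

locale trained = iid_scores P n c for P :: "'z measure" and n c +
  fixes M :: "'a measure" and Z :: "'z measure" and t :: "nat \<Rightarrow> 'a \<Rightarrow> 'z"
    and K :: "(nat \<Rightarrow> 'z) \<Rightarrow> 'z measure"
  assumes prob_M: "prob_space M" and sets_P: "sets P = sets Z"
    and indep_t: "prob_space.indep_vars M (\<lambda>_. Z) t {1..Suc n}"
    and distr_t: "\<And>i. i \<in> {1..Suc n} \<Longrightarrow> distr M Z (t i) = P"
    and cond_K: "regular_cond_distr M (\<Pi>\<^sub>M i\<in>{1..n}. Z) Z (training t n) (t (Suc n)) K"
begin

sublocale M: prob_space M by (rule prob_M)

lemma sets_PiM_P: "sets (\<Pi>\<^sub>M i\<in>I. Z) = sets (\<Pi>\<^sub>M i\<in>I. P)"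
  by (intro sets_PiM_cong) (simp_all add: sets_P)

lemma measurable_t: "i \<in> {1..Suc n} \<Longrightarrow> t i \<in> M \<rightarrow>\<^sub>M P"
  using indep_t M.indep_vars_def2[of "\<lambda>_. Z" t "{1..Suc n}"] by (simp add: measurable_cong_sets[OF refl sets_P])

lemma law_of_subsample:
  assumes "I \<subseteq> {1..Suc n}" "I \<noteq> {}"
  shows "distr M (\<Pi>\<^sub>M i\<in>I. P) (\<lambda>\<omega>. \<lambda>i\<in>I. t i \<omega>) = (\<Pi>\<^sub>M i\<in>I. P)"
proof -
  have "M.indep_vars (\<lambda>_. Z) t I" using indep_t assms(1) by (rule M.indep_vars_subset)
  moreover have "t i \<in> M \<rightarrow>\<^sub>M Z" if "i \<in> I" for i
    using measurable_t[of i] that assms by (auto simp: measurable_cong_sets[OF refl sets_P])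
  ultimately have "distr M (\<Pi>\<^sub>M i\<in>I. Z) (\<lambda>\<omega>. \<lambda>i\<in>I. t i \<omega>) = (\<Pi>\<^sub>M i\<in>I. distr M Z (t i))"
    using M.indep_vars_iff_distr_eq_PiM'[OF assms(2), of t "\<lambda>_. Z"] by simp
  also have "\<dots> = (\<Pi>\<^sub>M i\<in>I. P)" using distr_t assms(1) by (intro PiM_cong) auto
  finally have "distr M (\<Pi>\<^sub>M i\<in>I. Z) (\<lambda>\<omega>. \<lambda>i\<in>I. t i \<omega>) = (\<Pi>\<^sub>M i\<in>I. P)" .
  moreover have "distr M (\<Pi>\<^sub>M i\<in>I. P) (\<lambda>\<omega>. \<lambda>i\<in>I. t i \<omega>) = distr M (\<Pi>\<^sub>M i\<in>I. Z) (\<lambda>\<omega>. \<lambda>i\<in>I. t i \<omega>)"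
    by (rule distr_cong) (simp_all add: sets_PiM_P)
  ultimately show ?thesis by simp
qed

abbreviation X where "X \<equiv> training t n"

lemma measurable_X [measurable]: "X \<in> M \<rightarrow>\<^sub>M PT"
  unfolding training_def[abs_def] by (intro measurable_restrict measurable_t) auto

lemma space_X: "\<omega> \<in> space M \<Longrightarrow> X \<omega> \<in> space PT"
  using measurable_space[OF measurable_X] .

lemma law_X: "distr M PT X = PT"
  unfolding training_def[abs_def] using n_ge_2 by (intro law_of_subsample) auto

lemma joint_eq: "(X \<omega>)(Suc n := t (Suc n) \<omega>) = (\<lambda>i\<in>{1..Suc n}. t i \<omega>)"
  by (auto simp: training_def fun_eq_iff restrict_def)

lemma measurable_joint [measurable]: "(\<lambda>\<omega>. (X \<omega>)(Suc n := t (Suc n) \<omega>)) \<in> M \<rightarrow>\<^sub>M Q"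
  unfolding joint_eq by (intro measurable_restrict measurable_t)

lemma law_joint: "distr M Q (\<lambda>\<omega>. (X \<omega>)(Suc n := t (Suc n) \<omega>)) = Q"
  unfolding joint_eq by (rule law_of_subsample) auto

lemma prob_joint:
  assumes [measurable]: "Measurable.pred Q R"
  shows "measure M {\<omega>\<in>space M. R ((X \<omega>)(Suc n := t (Suc n) \<omega>))} = measure Q {w\<in>space Q. R w}"
proof -
  have S: "{w\<in>space Q. R w} \<in> sets Q" by measurable
  have "measure Q {w\<in>space Q. R w} = measure (distr M Q (\<lambda>\<omega>. (X \<omega>)(Suc n := t (Suc n) \<omega>))) {w\<in>space Q. R w}"
    by (simp only: law_joint)
  also have "\<dots> = measure M ((\<lambda>\<omega>. (X \<omega>)(Suc n := t (Suc n) \<omega>)) -` {w\<in>space Q. R w} \<inter> space M)"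
    by (rule measure_distr[OF measurable_joint S])
  also have "(\<lambda>\<omega>. (X \<omega>)(Suc n := t (Suc n) \<omega>)) -` {w\<in>space Q. R w} \<inter> space M = {\<omega>\<in>space M. R ((X \<omega>)(Suc n := t (Suc n) \<omega>))}"
    using measurable_space[OF measurable_joint] by auto
  finally show ?thesis by simp
qed

lemma integral_X:
  fixes f :: "(nat \<Rightarrow> 'z) \<Rightarrow> real"
  assumes "f \<in> borel_measurable PT"
  shows "(\<integral>\<omega>. f (X \<omega>) \<partial>M) = (\<integral>\<tau>. f \<tau> \<partial>PT)"
proof -
  have "(\<integral>\<tau>. f \<tau> \<partial>(distr M PT X)) = (\<integral>\<omega>. f (X \<omega>) \<partial>M)" by (rule integral_distr[OF measurable_X assms])
  then show ?thesis by (simp only: law_X)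
qed

lemma prob_rectangle:
  assumes A: "A \<in> sets PT" and B: "B \<in> sets P"
  shows "measure M {\<omega>\<in>space M. X \<omega> \<in> A \<and> t (Suc n) \<omega> \<in> B} = measure M {\<omega>\<in>space M. X \<omega> \<in> A} * measure P B"
proof -
  note [measurable] = A B
  have r: "(\<lambda>w. restrict w {1..n}) \<in> Q \<rightarrow>\<^sub>M PT"
    by (rule measurable_restrict_subset) auto
  have pr: "Measurable.pred Q (\<lambda>w. restrict w {1..n} \<in> A \<and> w (Suc n) \<in> B)"
    "Measurable.pred Q (\<lambda>w. restrict w {1..n} \<in> A)"
    using measurable_compose[OF r, of "\<lambda>x. x \<in> A"] by measurable
  have res: "restrict (\<tau>(Suc n := z)) {1..n} = \<tau>" if "\<tau> \<in> space PT" for \<tau> z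
    using that by (fastforce simp: space_PiM PiE_def extensional_def restrict_def fun_eq_iff)
  have "measure M {\<omega>\<in>space M. X \<omega> \<in> A \<and> t (Suc n) \<omega> \<in> B}
    = measure M {\<omega>\<in>space M. (\<lambda>w. restrict w {1..n} \<in> A \<and> w (Suc n) \<in> B) ((X \<omega>)(Suc n := t (Suc n) \<omega>))}"
    using res space_X by (intro arg_cong[where f="measure M"]) auto
  also have "\<dots> = measure Q {w\<in>space Q. restrict w {1..n} \<in> A \<and> w (Suc n) \<in> B}"
    by (rule prob_joint[OF pr(1)])
  also have "\<dots> = (\<integral>\<tau>. measure P {z\<in>space P. restrict (\<tau>(Suc n := z)) {1..n} \<in> A \<and> (\<tau>(Suc n := z)) (Suc n) \<in> B} \<partial>PT)"
    by (rule measurable_prob_section(2)[OF pr(1), symmetric])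
  also have "\<dots> = (\<integral>\<tau>. of_bool (\<tau> \<in> A) * measure P B \<partial>PT)"
  proof (rule Bochner_Integration.integral_cong[OF refl])
    fix \<tau> assume \<tau>: "\<tau> \<in> space PT"
    have "{z\<in>space P. z \<in> B} = B" using sets.sets_into_space[OF B] by auto
    then show "measure P {z\<in>space P. restrict (\<tau>(Suc n := z)) {1..n} \<in> A \<and> (\<tau>(Suc n := z)) (Suc n) \<in> B} = of_bool (\<tau> \<in> A) * measure P B"
      using \<tau> res[OF \<tau>, of "\<tau> (Suc n)"] by simp
  qed
  also have "\<dots> = (\<integral>\<omega>. of_bool (X \<omega> \<in> A) * measure P B \<partial>M)"
    by (rule integral_X[symmetric]) measurable
  also have "\<dots> = measure M {\<omega>\<in>space M. X \<omega> \<in> A} * measure P B"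
    by (simp add: measure_eq_integral_of_bool)
  finally show ?thesis .
qed

lemma K_prob: "\<tau> \<in> space PT \<Longrightarrow> prob_space (K \<tau>)" "\<tau> \<in> space PT \<Longrightarrow> sets (K \<tau>) = sets P"
proof -
  have "K \<in> (\<Pi>\<^sub>M i\<in>{1..n}. Z) \<rightarrow>\<^sub>M prob_algebra Z" using cond_K by (simp add: regular_cond_distr_def)
  moreover have "space (\<Pi>\<^sub>M i\<in>{1..n}. Z) = space PT" by (rule sets_eq_imp_space_eq[OF sets_PiM_P])
  moreover assume "\<tau> \<in> space PT"
  ultimately have "K \<tau> \<in> space (prob_algebra Z)" using measurable_space by metis
  then show "prob_space (K \<tau>)" "sets (K \<tau>) = sets P" by (auto simp: space_prob_algebra sets_P)
qed

lemma measurable_K: "K \<in> PT \<rightarrow>\<^sub>M prob_algebra P"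
proof -
  have "K \<in> (\<Pi>\<^sub>M i\<in>{1..n}. Z) \<rightarrow>\<^sub>M prob_algebra Z" using cond_K by (simp add: regular_cond_distr_def)
  moreover have "prob_algebra Z = prob_algebra P" 
    by (simp add: prob_algebra_def subprob_algebra_cong[OF sets_P])
  ultimately show ?thesis by (simp add: measurable_cong_sets[OF sets_PiM_P refl])
qed

lemma AE_K_eq:
  assumes B: "B \<in> sets P"
  shows "AE \<omega> in M. measure (K (X \<omega>)) B = measure P B"
proof -
  let ?N = "\<Pi>\<^sub>M i\<in>{1..n}. Z"
  let ?F = "vimage_algebra (space M) X ?N"
  have spN: "space ?N = space PT" by (rule sets_eq_imp_space_eq[OF sets_PiM_P])
  have XN: "X \<in> space M \<rightarrow> space ?N" using space_X spN by auto
  have setsF: "sets ?F = {X -` A \<inter> space M | A. A \<in> sets PT}"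
    unfolding sets_vimage_algebra2[OF XN] by (simp only: sets_PiM_P)
  have sub: "subalgebra M ?F"
    unfolding subalgebra_def setsF using measurable_sets[OF measurable_X] by auto
  interpret F: finite_measure_subalgebra M ?F
    by unfold_locales (rule sub)
  have tB: "t (Suc n) -` B \<inter> space M \<in> sets M" using measurable_t[of "Suc n"] B by (auto intro: measurable_sets)
  have "AE \<omega> in M. real_cond_exp M ?F (indicator (t (Suc n) -` B \<inter> space M)) \<omega> = measure P B"
  proof (rule F.real_cond_exp_charact)
    fix A assume "A \<in> sets ?F"
    then obtain A' where A': "A' \<in> sets PT" "A = X -` A' \<inter> space M" by (auto simp: setsF)
    have A: "A \<in> sets M" using measurable_sets[OF measurable_X A'(1)] A'(2) by simp
    have "(\<integral>\<omega>\<in>A. indicator (t (Suc n) -` B \<inter> space M) \<omega> \<partial>M) = (\<integral>\<omega>. indicator (A \<inter> (t (Suc n) -` B \<inter> space M)) \<omega> \<partial>M)"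
      unfolding set_lebesgue_integral_def
      by (intro Bochner_Integration.integral_cong) (auto simp: indicator_def)
    also have "\<dots> = measure M {\<omega>\<in>space M. X \<omega> \<in> A' \<and> t (Suc n) \<omega> \<in> B}"
      by (simp add: A'(2)) (auto intro!: arg_cong[where f="measure M"])
    also have "\<dots> = measure M A * measure P B"
      unfolding prob_rectangle[OF A'(1) B] A'(2) by (auto intro!: arg_cong[where f="measure M"])
    also have "\<dots> = (\<integral>\<omega>\<in>A. measure P B \<partial>M)"
      using sets.sets_into_space[OF A] by (simp add: set_lebesgue_integral_def Int_absorb2)
    finally show "(\<integral>\<omega>\<in>A. indicator (t (Suc n) -` B \<inter> space M) \<omega> \<partial>M) = (\<integral>\<omega>\<in>A. measure P B \<partial>M)" .
  qed (use tB in \<open>auto simp: less_top[symmetric]\<close>)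
  moreover have "AE \<omega> in M. real_cond_exp M ?F (indicator (t (Suc n) -` B \<inter> space M)) \<omega> = measure (K (X \<omega>)) B"
    using cond_K B by (simp add: regular_cond_distr_def sets_P)
  ultimately show ?thesis by eventually_elim simp
qed

text \<open>
  The exceptional null set depends on the event, and the events of interest depend on the training
  sample. Therefore the equality is shown for the sections of every measurable subset \<open>D\<close> of the product
  space; the sets \<open>D\<close> for which it holds almost surely form a Dynkin system that contains the rectangles.
\<close>

lemma AE_emeasure_K_section:
  assumes "D \<in> sets (PT \<Otimes>\<^sub>M P)"
  shows "AE \<omega> in M. emeasure (K (X \<omega>)) (Pair (X \<omega>) -` D) = emeasure P (Pair (X \<omega>) -` D)"
  using Int_stable_pair_measure_generator pair_measure_closed assms
  unfolding sets_pair_measure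
proof (induct rule: sigma_sets_induct_disjoint)
  case (basic D)
  then obtain A B where D: "D = A \<times> B" and B: "B \<in> sets P" by auto
  show ?case using AE_K_eq[OF B]
  proof (rule AE_mp, intro AE_I2 impI)
    fix \<omega> assume \<omega>: "\<omega> \<in> space M" and eq: "measure (K (X \<omega>)) B = measure P B"
    interpret K: prob_space "K (X \<omega>)" by (rule K_prob(1)[OF space_X[OF \<omega>]])
    show "emeasure (K (X \<omega>)) (Pair (X \<omega>) -` D) = emeasure P (Pair (X \<omega>) -` D)"
      using eq by (cases "X \<omega> \<in> A") (simp_all add: D K.emeasure_eq_measure emeasure_eq_measure)
  qed
next
  case empty
  then show ?case by simp
next
  case (compl D)
  then have D: "D \<in> sets (PT \<Otimes>\<^sub>M P)" by (simp add: sets_pair_measure)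
  from compl(2) show ?case
  proof (rule AE_mp, intro AE_I2 impI)
    fix \<omega> assume \<omega>: "\<omega> \<in> space M" and eq: "emeasure (K (X \<omega>)) (Pair (X \<omega>) -` D) = emeasure P (Pair (X \<omega>) -` D)"
    interpret K: prob_space "K (X \<omega>)" by (rule K_prob(1)[OF space_X[OF \<omega>]])
    have sp: "space (K (X \<omega>)) = space P" by (rule sets_eq_imp_space_eq[OF K_prob(2)[OF space_X[OF \<omega>]]])
    have S: "Pair (X \<omega>) -` D \<in> sets P" using D by (rule sets_Pair1)
    have c: "Pair (X \<omega>) -` (space PT \<times> space P - D) = space P - Pair (X \<omega>) -` D"
      using space_X[OF \<omega>] by auto
    have "emeasure (K (X \<omega>)) (space P - Pair (X \<omega>) -` D) = emeasure (K (X \<omega>)) (space P) - emeasure (K (X \<omega>)) (Pair (X \<omega>) -` D)"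
      using S K_prob(2)[OF space_X[OF \<omega>]] sp by (subst sp[symmetric], subst emeasure_compl) auto
    moreover have "emeasure P (space P - Pair (X \<omega>) -` D) = emeasure P (space P) - emeasure P (Pair (X \<omega>) -` D)"
      using S by (subst emeasure_compl) auto
    ultimately show "emeasure (K (X \<omega>)) (Pair (X \<omega>) -` (space PT \<times> space P - D)) = emeasure P (Pair (X \<omega>) -` (space PT \<times> space P - D))"
      unfolding c using eq K.emeasure_space_1 emeasure_space_1 sp by simp
  qed
next
  case (union D)
  then have D: "D i \<in> sets (PT \<Otimes>\<^sub>M P)" for i by (auto simp: sets_pair_measure)
  have "AE \<omega> in M. \<forall>i. emeasure (K (X \<omega>)) (Pair (X \<omega>) -` D i) = emeasure P (Pair (X \<omega>) -` D i)"
    using union(3) by (simp add: AE_all_countable)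
  then show ?case
  proof (rule AE_mp, intro AE_I2 impI)
    fix \<omega> assume \<omega>: "\<omega> \<in> space M" and eq: "\<forall>i. emeasure (K (X \<omega>)) (Pair (X \<omega>) -` D i) = emeasure P (Pair (X \<omega>) -` D i)"
    have S: "range (\<lambda>i. Pair (X \<omega>) -` D i) \<subseteq> sets P" using sets_Pair1[OF D] by auto
    have dj: "disjoint_family (\<lambda>i. Pair (X \<omega>) -` D i)" using union(1) by (rule disjoint_family_on_vimageI)
    show "emeasure (K (X \<omega>)) (Pair (X \<omega>) -` (\<Union>i. D i)) = emeasure P (Pair (X \<omega>) -` (\<Union>i. D i))"
      unfolding vimage_UN using suminf_emeasure[OF S dj] suminf_emeasure[of "\<lambda>i. Pair (X \<omega>) -` D i" "K (X \<omega>)"] S dj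
        K_prob(2)[OF space_X[OF \<omega>]] eq by auto
  qed
qed

lemma space_K: "\<omega> \<in> space M \<Longrightarrow> space (K (X \<omega>)) = space P"
  by (rule sets_eq_imp_space_eq[OF K_prob(2)[OF space_X]])

lemma pred_append_set:
  assumes "Measurable.pred Q R"
  shows "{(\<tau>, z)\<in>space (PT \<Otimes>\<^sub>M P). R (\<tau>(Suc n := z))} \<in> sets (PT \<Otimes>\<^sub>M P)"
  using measurable_compose[OF measurable_append assms] by (simp add: pred_def split_beta')

abbreviation prob_K :: "((nat \<Rightarrow> 'z) \<Rightarrow> bool) \<Rightarrow> 'a \<Rightarrow> real" where
  "prob_K R \<omega> \<equiv> measure (K (X \<omega>)) {z\<in>space (K (X \<omega>)). R ((X \<omega>)(Suc n := z))}"

lemma AE_measure_K: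
  assumes R: "Measurable.pred Q R"
  shows "AE \<omega> in M. prob_K R \<omega>
    = measure P {z\<in>space P. R ((X \<omega>)(Suc n := z))}"
  using AE_emeasure_K_section[OF pred_append_set[OF R]]
proof (rule AE_mp, intro AE_I2 impI)
  let ?D = "{(\<tau>, z)\<in>space (PT \<Otimes>\<^sub>M P). R (\<tau>(Suc n := z))}"
  fix \<omega> assume \<omega>: "\<omega> \<in> space M" and eq: "emeasure (K (X \<omega>)) (Pair (X \<omega>) -` ?D) = emeasure P (Pair (X \<omega>) -` ?D)"
  have "Pair (X \<omega>) -` ?D = {z\<in>space P. R ((X \<omega>)(Suc n := z))}"
    using space_X[OF \<omega>] by (auto simp: space_pair_measure)
  with eq show "prob_K R \<omega>
    = measure P {z\<in>space P. R ((X \<omega>)(Suc n := z))}"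
    by (simp add: measure_def space_K[OF \<omega>])
qed

lemma measurable_measure_K:
  assumes R: "Measurable.pred Q R"
  shows "(\<lambda>\<omega>. prob_K R \<omega>) \<in> borel_measurable M"
proof -
  have "Sigma (space PT) (\<lambda>\<tau>. {z\<in>space P. R (\<tau>(Suc n := z))}) = {(\<tau>, z)\<in>space (PT \<Otimes>\<^sub>M P). R (\<tau>(Suc n := z))}"
    by (auto simp: space_pair_measure)
  then have "(\<lambda>\<tau>. measure (K \<tau>) {z\<in>space P. R (\<tau>(Suc n := z))}) \<in> borel_measurable PT"
    using pred_append_set[OF R] by (intro measure_measurable_prob_algebra2[OF _ measurable_K]) simp
  from measurable_compose[OF measurable_X this] show ?thesis
    by (subst measurable_cong) (auto simp: space_K)
qed

lemma integral_measure_K: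
  assumes R: "Measurable.pred Q R"
  shows "(\<integral>\<omega>. prob_K R \<omega> \<partial>M) = measure Q {w\<in>space Q. R w}"
proof -
  have "(\<integral>\<omega>. prob_K R \<omega> \<partial>M)
    = (\<integral>\<omega>. measure P {z\<in>space P. R ((X \<omega>)(Suc n := z))} \<partial>M)"
    using measurable_measure_K[OF R] measurable_compose[OF measurable_X measurable_prob_section(1)[OF R]] AE_measure_K[OF R]
    by (intro integral_cong_AE)
  also have "\<dots> = (\<integral>\<tau>. measure P {z\<in>space P. R (\<tau>(Suc n := z))} \<partial>PT)"
    by (rule integral_X[OF measurable_prob_section(1)[OF R]])
  finally show ?thesis using measurable_prob_section(2)[OF R] by simp
qed

lemma unit_mono_level_K:
  assumes N: "N \<in> borel_measurable Q" and \<omega>: "\<omega> \<in> space M"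
  shows "unit_mono (level (K (X \<omega>)) n N (X \<omega>))"
proof -
  interpret K: prob_space "K (X \<omega>)" by (rule K_prob(1)[OF space_X[OF \<omega>]])
  have "(\<lambda>z. N ((X \<omega>)(Suc n := z))) \<in> borel_measurable P" by (rule measurable_section[OF N space_X[OF \<omega>]])
  then have [measurable]: "(\<lambda>z. N ((X \<omega>)(Suc n := z))) \<in> borel_measurable (K (X \<omega>))"
    by (simp add: measurable_cong_sets[OF K_prob(2)[OF space_X[OF \<omega>]] refl])
  show ?thesis
  proof
    fix a b :: real assume "a \<le> b"
    then have *: "a * (real n + 1) \<le> b * (real n + 1)" by (intro mult_right_mono) auto
    then show "level (K (X \<omega>)) n N (X \<omega>) a \<le> level (K (X \<omega>)) n N (X \<omega>) b"
      unfolding level_def by (intro K.finite_measure_mono) (auto intro: order_trans[OF _ *])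
  qed (auto simp: level_def)
qed

lemma
  assumes N: "N \<in> borel_measurable Q"
  shows measurable_excess_K: "(\<lambda>\<omega>. excess (K (X \<omega>)) n N (X \<omega>)) \<in> borel_measurable M"
    and measurable_deficit_K: "(\<lambda>\<omega>. deficit (K (X \<omega>)) n N (X \<omega>)) \<in> borel_measurable M"
    and integral_excess_K: "(\<integral>\<omega>. excess (K (X \<omega>)) n N (X \<omega>) \<partial>M) = (\<integral>\<tau>. excess P n N \<tau> \<partial>PT)"
    and integral_deficit_K: "(\<integral>\<omega>. deficit (K (X \<omega>)) n N (X \<omega>) \<partial>M) = (\<integral>\<tau>. deficit P n N \<tau> \<partial>PT)"
proof -
  have pr: "Measurable.pred Q (\<lambda>w. N w \<le> a * (real n + 1))" for a using N by measurable
  have m: "(\<lambda>\<omega>. level (K (X \<omega>)) n N (X \<omega>) a) \<in> borel_measurable M" for a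
    unfolding level_def by (rule measurable_measure_K[OF pr])
  show mK: "(\<lambda>\<omega>. excess (K (X \<omega>)) n N (X \<omega>)) \<in> borel_measurable M" "(\<lambda>\<omega>. deficit (K (X \<omega>)) n N (X \<omega>)) \<in> borel_measurable M"
    unfolding excess_def deficit_def by (rule measurable_SUP_excess[OF unit_mono_level_K[OF N] m]; assumption)+
  have mP: "(\<lambda>\<omega>. excess P n N (X \<omega>)) \<in> borel_measurable M" "(\<lambda>\<omega>. deficit P n N (X \<omega>)) \<in> borel_measurable M"
    using measurable_compose[OF measurable_X measurable_excess[OF N]] measurable_compose[OF measurable_X measurable_deficit[OF N]] by auto
  have "AE \<omega> in M. level (K (X \<omega>)) n N (X \<omega>) a = level P n N (X \<omega>) a" for a
    unfolding level_def by (rule AE_measure_K[OF pr])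
  from AE_SUP_excess_eq[OF unit_mono_level_K[OF N] unit_mono_level[OF N space_X] this]
  have ae: "AE \<omega> in M. excess (K (X \<omega>)) n N (X \<omega>) = excess P n N (X \<omega>) \<and> deficit (K (X \<omega>)) n N (X \<omega>) = deficit P n N (X \<omega>)"
    unfolding excess_def deficit_def .
  show "(\<integral>\<omega>. excess (K (X \<omega>)) n N (X \<omega>) \<partial>M) = (\<integral>\<tau>. excess P n N \<tau> \<partial>PT)"
    unfolding integral_X[OF measurable_excess[OF N], symmetric]
    using ae by (intro integral_cong_AE mK mP) auto
  show "(\<integral>\<omega>. deficit (K (X \<omega>)) n N (X \<omega>) \<partial>M) = (\<integral>\<tau>. deficit P n N \<tau> \<partial>PT)"
    unfolding integral_X[OF measurable_deficit[OF N], symmetric]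
    using ae by (intro integral_cong_AE mK mP) auto
qed

lemma excess_K_bounds:
  assumes "N \<in> borel_measurable Q" "\<omega> \<in> space M"
  shows "0 \<le> excess (K (X \<omega>)) n N (X \<omega>)" "excess (K (X \<omega>)) n N (X \<omega>) \<le> 1"
    "0 \<le> deficit (K (X \<omega>)) n N (X \<omega>)" "deficit (K (X \<omega>)) n N (X \<omega>) \<le> 1"
  unfolding excess_def deficit_def
  using unit_mono.SUP_excess_bounds[OF unit_mono_level_K] unit_mono.SUP_deficit_bounds[OF unit_mono_level_K] assms
  by auto

text \<open>A bound on the conditional density turns into a bound on the probability of near ties.\<close>

lemma near_ties_le:
  fixes f :: "(nat \<Rightarrow> 'z) \<Rightarrow> real \<Rightarrow> real"
  assumes dens: "AE \<omega> in M. distributed (K (X \<omega>)) lborel (\<lambda>z. loo c n (Suc n) ((X \<omega>)(Suc n := z))) (\<lambda>x. ennreal (f (X \<omega>) x))"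
    and B: "0 \<le> B" and \<eta>: "0 \<le> \<eta>" and i: "i \<in> {1..n}" and r: "0 \<le> r"
    and outer: "outer_measure_of M {\<omega>\<in>space M. (SUP x. ennreal \<bar>f (X \<omega>) x\<bar>) > ennreal B} \<le> ennreal r"
  shows "measure Q {w\<in>space Q. \<bar>loo c n (Suc n) w - lto c n i (Suc n) w\<bar> \<le> \<eta>} \<le> r + 2 * \<eta> * B"
proof -
  let ?R = "\<lambda>w. \<bar>loo c n (Suc n) w - lto c n i (Suc n) w\<bar> \<le> \<eta>"
  let ?m = "\<lambda>\<omega>. prob_K ?R \<omega>"
  have R: "Measurable.pred Q ?R" using measurable_gap_pred(3)[OF i, where \<delta>=0] by simp
  obtain E where E: "E \<in> sets M" "{\<omega>\<in>space M. (SUP x. ennreal \<bar>f (X \<omega>) x\<bar>) > ennreal B} \<subseteq> E"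
    "emeasure M E \<le> ennreal r"
    using outer_measure_of_attain[of "{\<omega>\<in>space M. (SUP x. ennreal \<bar>f (X \<omega>) x\<bar>) > ennreal B}" M] outer by auto
  have Er: "measure M E \<le> r" using E(3) r by (simp add: M.emeasure_eq_measure)
  have le: "AE \<omega> in M. ?m \<omega> \<le> indicator E \<omega> + 2 * \<eta> * B"
    using dens
  proof (rule AE_mp, intro AE_I2 impI)
    fix \<omega> assume \<omega>: "\<omega> \<in> space M"
      and d: "distributed (K (X \<omega>)) lborel (\<lambda>z. loo c n (Suc n) ((X \<omega>)(Suc n := z))) (\<lambda>x. ennreal (f (X \<omega>) x))"
    interpret K: prob_space "K (X \<omega>)" by (rule K_prob(1)[OF space_X[OF \<omega>]])
    show "?m \<omega> \<le> indicator E \<omega> + 2 * \<eta> * B"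
    proof (cases "\<omega> \<in> E")
      case True
      then show ?thesis using B \<eta> by (simp add: add_increasing2)
    next
      case False
      then have sup: "(SUP x. ennreal \<bar>f (X \<omega>) x\<bar>) \<le> ennreal B" using E(2) \<omega> by (auto simp: not_less)
      have fB: "ennreal (f (X \<omega>) x) \<le> ennreal B" for x
      proof -
        have "ennreal (f (X \<omega>) x) \<le> ennreal \<bar>f (X \<omega>) x\<bar>" by (intro ennreal_leI) auto
        also have "\<dots> \<le> (SUP x. ennreal \<bar>f (X \<omega>) x\<bar>)" by (rule SUP_upper) simp
        finally show ?thesis using sup by simp
      qed
      define a where "a = lto c n i (Suc n) (X \<omega>)"
      have set: "{z\<in>space (K (X \<omega>)). ?R ((X \<omega>)(Suc n := z))}
        = (\<lambda>z. loo c n (Suc n) ((X \<omega>)(Suc n := z))) -` {a - \<eta>..a + \<eta>} \<inter> space (K (X \<omega>))"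
        unfolding a_def lto_append[OF i] by auto
      have "emeasure (K (X \<omega>)) {z\<in>space (K (X \<omega>)). ?R ((X \<omega>)(Suc n := z))}
        = (\<integral>\<^sup>+x\<in>{a - \<eta>..a + \<eta>}. ennreal (f (X \<omega>) x) \<partial>lborel)"
        unfolding set by (rule distributed_emeasure[OF d]) simp
      also have "\<dots> \<le> (\<integral>\<^sup>+x\<in>{a - \<eta>..a + \<eta>}. ennreal B \<partial>lborel)"
        using fB by (intro nn_integral_mono mult_right_mono) auto
      also have "\<dots> = ennreal B * emeasure lborel {a - \<eta>..a + \<eta>}"
        by (rule nn_integral_cmult_indicator) simp
      also have "\<dots> = ennreal (2 * \<eta> * B)"
        using \<eta> B by (simp add: ennreal_mult[symmetric] mult.commute)
      finally have "ennreal (?m \<omega>) \<le> ennreal (2 * \<eta> * B)" by (simp add: K.emeasure_eq_measure)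
      then have "?m \<omega> \<le> 2 * \<eta> * B" using \<eta> B by (simp add: ennreal_le_iff)
      then show ?thesis using False by simp
    qed
  qed
  have "measure Q {w\<in>space Q. ?R w} = (\<integral>\<omega>. ?m \<omega> \<partial>M)" by (rule integral_measure_K[OF R, symmetric])
  also have "\<dots> \<le> (\<integral>\<omega>. indicator E \<omega> + 2 * \<eta> * B \<partial>M)"
  proof (rule integral_mono_AE[OF _ _ le])
    have "AE \<omega> in M. norm (?m \<omega>) \<le> 1"
      using K_prob(1)[OF space_X] by (intro AE_I2) (simp add: prob_space.prob_le_1)
    then show "integrable M ?m" using measurable_measure_K[OF R] by (rule M.integrable_const_bound)
    show "integrable M (\<lambda>\<omega>. indicator E \<omega> + 2 * \<eta> * B)"
      using E(1) by (auto simp: less_top[symmetric])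
  qed
  also have "\<dots> = measure M E + 2 * \<eta> * B"
    using E(1) M.prob_space sets.sets_into_space[OF E(1)] by (simp add: Int_absorb2 less_top[symmetric])
  finally show ?thesis using Er by linarith
qed

end

section \<open>The prediction sets in terms of counts\<close>

lemma bij_betw_skip:
  assumes i: "i \<in> {1..m}"
  shows "bij_betw (\<lambda>j. if j < i then j else Suc j) {1..m - 1} ({1..m} - {i})"
  by (rule bij_betwI[where g="\<lambda>k. if k < i then k else k - 1"]) (use i in \<open>auto split: if_splits\<close>)

lemma remove_entry_eq: "remove_entry m i \<tau> = (\<lambda>k\<in>{1..m - 1}. \<tau> (if k < i then k else Suc k))"
  by (auto simp: remove_entry_def)

context iid_scores
begin

lemma loo_eq_remove_entry:
  assumes "w \<in> space Q" "i \<in> {1..Suc n}"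
  shows "loo c n i w = c n (w i) (remove_entry (n + 1) i w)"
  unfolding loo_def remove_entry_eq using assms n_ge_2 bij_betw_skip[OF assms(2)]
  by (subst score_at_eq[symmetric, of w "{1..Suc n}" i _ n "\<lambda>j. if j < i then j else Suc j"]) auto

lemma
  assumes \<tau>: "\<tau> \<in> space PT" and z: "z \<in> space P"
  shows loo_append_last: "loo c n (Suc n) (\<tau>(Suc n := z)) = c n z \<tau>"
    and lto_append_last: "i \<in> {1..n} \<Longrightarrow> lto c n (Suc n) i (\<tau>(Suc n := z)) = c (n - 1) z (remove_entry n i \<tau>)"
    and lto_append_inner: "i \<in> {1..n} \<Longrightarrow> lto c n i (Suc n) (\<tau>(Suc n := z)) = c (n - 1) (\<tau> i) (remove_entry n i \<tau>)"
proof -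
  let ?w = "\<tau>(Suc n := z)"
  have w: "?w \<in> space Q" by (rule append_space[OF \<tau> z])
  have "bij_betw (\<lambda>k. k) {1..n} ({1..Suc n} - {Suc n})" by (auto simp: bij_betw_def)
  from score_at_eq[OF w _ _ _ this, of "Suc n"] n_ge_2
  have "loo c n (Suc n) ?w = c n z (\<lambda>k\<in>{1..n}. ?w k)" by (auto simp: loo_def)
  also have "(\<lambda>k\<in>{1..n}. ?w k) = \<tau>"
    using \<tau> by (fastforce simp: space_PiM PiE_def extensional_def restrict_def fun_eq_iff)
  finally show "loo c n (Suc n) ?w = c n z \<tau>" .
  have *: "score_at c k ({1..n} - {i}) ?w = c (n - 1) (?w k) (remove_entry n i \<tau>)"
    if i: "i \<in> {1..n}" and k: "k \<in> {1..Suc n}" for i k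
  proof -
    have "score_at c k ({1..n} - {i}) ?w = c (n - 1) (?w k) (\<lambda>j\<in>{1..n - 1}. ?w (if j < i then j else Suc j))"
      using n_ge_2 by (intro score_at_eq[OF w k _ _ bij_betw_skip[OF i], symmetric]) auto
    also have "(\<lambda>j\<in>{1..n - 1}. ?w (if j < i then j else Suc j)) = remove_entry n i \<tau>"
      unfolding remove_entry_eq by (intro restrict_ext) auto
    finally show ?thesis .
  qed
  show "lto c n (Suc n) i ?w = c (n - 1) z (remove_entry n i \<tau>)" if i: "i \<in> {1..n}"
  proof -
    have "{1..Suc n} - {Suc n, i} = {1..n} - {i}" by auto
    then show ?thesis using *[OF i, of "Suc n"] by (simp add: lto_def)
  qed
  show "lto c n i (Suc n) ?w = c (n - 1) (\<tau> i) (remove_entry n i \<tau>)" if i: "i \<in> {1..n}"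
  proof -
    have "{1..Suc n} - {i, Suc n} = {1..n} - {i}" by auto
    then show ?thesis using *[OF i, of i] i by (simp add: lto_def)
  qed
qed

end

text \<open>
  The score \<open>c0\<close> exceeds the quantile by more than \<open>\<delta>\<close> iff \<open>F\<close> attains \<open>1 - \<alpha>\<close> strictly to the left of
  \<open>c0 - \<delta>\<close>. As \<open>0 \<le> \<delta>\<close>, the score \<open>c0\<close> itself does not contribute to \<open>F\<close> there.
\<close>

lemma le_quantile_add_iff:
  fixes s :: "nat \<Rightarrow> real" and c0 :: real and n :: nat
  assumes \<delta>: "0 \<le> \<delta>"
  defines "F \<equiv> \<lambda>x. 1 / (real n + 1) * of_bool (c0 \<le> x) + 1 / (real n + 1) * (\<Sum>i=1..n. of_bool (s i \<le> x))"
  shows "ereal c0 \<le> quantile F (1 - \<alpha>) + ereal \<delta> \<longleftrightarrow>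
    \<not> 1 + (\<Sum>i=1..n. of_bool (c0 \<le> s i + \<delta>)) \<le> \<alpha> * (real n + 1)"
proof -
  have F: "1 - \<alpha> \<le> F x \<longleftrightarrow> (1 - \<alpha>) * (real n + 1) \<le> of_bool (c0 \<le> x) + (\<Sum>i=1..n. of_bool (s i \<le> x))" for x
  proof -
    have "F x = (of_bool (c0 \<le> x) + (\<Sum>i=1..n. of_bool (s i \<le> x))) / (real n + 1)"
      unfolding F_def by (simp only: add_divide_distrib times_divide_eq_left mult_1_left)
    then show ?thesis by (simp add: pos_le_divide_eq)
  qed
  have "ereal c0 \<le> quantile F (1 - \<alpha>) + ereal \<delta> \<longleftrightarrow> ereal (c0 - \<delta>) \<le> quantile F (1 - \<alpha>)"
    by (cases "quantile F (1 - \<alpha>)") auto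
  also have "\<dots> \<longleftrightarrow> \<not> (\<exists>x<c0 - \<delta>. 1 - \<alpha> \<le> F x)"
    unfolding quantile_def le_Inf_iff by (auto simp: not_less)
  also have "(\<exists>x<c0 - \<delta>. 1 - \<alpha> \<le> F x) \<longleftrightarrow> 1 + (\<Sum>i=1..n. of_bool (c0 \<le> s i + \<delta>)) \<le> \<alpha> * (real n + 1)"
  proof
    assume "\<exists>x<c0 - \<delta>. 1 - \<alpha> \<le> F x"
    then obtain x where x: "x < c0 - \<delta>" "1 - \<alpha> \<le> F x" by blast
    have "(\<Sum>i=1..n. of_bool (s i \<le> x)) + (\<Sum>i=1..n. of_bool (c0 \<le> s i + \<delta>)) \<le> (\<Sum>i=1..n. 1::real)"
      unfolding sum.distrib[symmetric] using x(1) by (intro sum_mono) (auto simp: of_bool_def)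
    moreover have "(1 - \<alpha>) * (real n + 1) \<le> (\<Sum>i=1..n. of_bool (s i \<le> x))"
      using x \<delta> unfolding F by simp
    moreover have "(1 - \<alpha>) * (real n + 1) = real n + 1 - \<alpha> * (real n + 1)" by (simp add: algebra_simps)
    ultimately show "1 + (\<Sum>i=1..n. of_bool (c0 \<le> s i + \<delta>)) \<le> \<alpha> * (real n + 1)" by simp
  next
    assume *: "1 + (\<Sum>i=1..n. of_bool (c0 \<le> s i + \<delta>)) \<le> \<alpha> * (real n + 1)"
    define A where "A = insert (c0 - \<delta> - 1) {s i | i. i \<in> {1..n} \<and> s i < c0 - \<delta>}"
    have fin: "finite A" unfolding A_def by (auto intro: finite_subset[of _ "s ` {1..n}"])
    define x where "x = Max A"
    have "x \<in> A" unfolding x_def using fin by (intro Max_in) (auto simp: A_def)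
    then have x: "x < c0 - \<delta>" by (auto simp: A_def)
    have sx: "s i \<le> x" if "i \<in> {1..n}" "s i < c0 - \<delta>" for i
      unfolding x_def using that by (intro Max_ge[OF fin]) (auto simp: A_def)
    have "(\<Sum>i=1..n. 1::real) \<le> (\<Sum>i=1..n. of_bool (s i \<le> x)) + (\<Sum>i=1..n. of_bool (c0 \<le> s i + \<delta>))"
      unfolding sum.distrib[symmetric] using sx by (intro sum_mono) (fastforce simp: of_bool_def)
    moreover have "(1 - \<alpha>) * (real n + 1) = real n + 1 - \<alpha> * (real n + 1)" by (simp add: algebra_simps)
    ultimately have "1 - \<alpha> \<le> F x" unfolding F using * by simp
    then show "\<exists>x<c0 - \<delta>. 1 - \<alpha> \<le> F x" using x by blast
  qed
  finally show ?thesis .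
qed

lemma
  assumes scores: "iid_scores P n (C n)" and sp: "space P = space (obs_space (Y n) (p n))"
    and \<tau>: "\<tau> \<in> space (\<Pi>\<^sub>M i\<in>{1..n}. P)" and sp_K: "space (K n \<tau>) = space P" and \<delta>: "0 \<le> \<delta>"
  shows noncoverage_fc: "noncoverage K (PS_fc Y C) n \<tau> \<alpha> \<delta> = level (K n \<tau>) n (count_fc (C n) n \<delta>) \<tau> \<alpha>"
    and noncoverage_cc: "noncoverage K (PS_cc Y C) n \<tau> \<alpha> \<delta> = level (K n \<tau>) n (count_cc (C n) n \<delta>) \<tau> \<alpha>"
proof -
  interpret iid_scores P n "C n" by (rule scores)
  have Y: "y \<in> Y n" if "(y, x) \<in> space P" for y x
    using that by (simp add: sp obs_space_def space_pair_measure space_restrict_space)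
  have "y \<notin> PS_fc Y C n \<tau> x \<alpha> \<delta> \<longleftrightarrow> count_fc (C n) n \<delta> (\<tau>(Suc n := (y, x))) \<le> \<alpha> * (real n + 1)"
    if z: "(y, x) \<in> space P" for y x
  proof -
    let ?w = "\<tau>(Suc n := (y, x))"
    have w: "?w \<in> space Q" by (rule append_space[OF \<tau> z])
    have loo: "C n n (\<tau> i) (remove_entry (n + 1) i (\<tau>(n + 1 := (y, x)))) = loo (C n) n i ?w" if "i \<in> {1..n}" for i
      using loo_eq_remove_entry[OF w, of i] that by (simp add: Suc_eq_plus1[symmetric])
    have "full_conformal_cdf C n \<tau> x y = (\<lambda>u. 1 / (real n + 1) * of_bool (loo (C n) n (Suc n) ?w \<le> u)
      + 1 / (real n + 1) * (\<Sum>i=1..n. of_bool (loo (C n) n i ?w \<le> u)))"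
      unfolding full_conformal_cdf_def using loo_append_last[OF \<tau> z] loo by (intro ext) simp
    then show ?thesis
      using Y[OF z] le_quantile_add_iff[OF \<delta>, of "loo (C n) n (Suc n) ?w" n "\<lambda>i. loo (C n) n i ?w" \<alpha>]
      by (simp add: PS_fc_def count_fc_def loo_append_last[OF \<tau> z])
  qed
  then show "noncoverage K (PS_fc Y C) n \<tau> \<alpha> \<delta> = level (K n \<tau>) n (count_fc (C n) n \<delta>) \<tau> \<alpha>"
    unfolding noncoverage_def level_def by (intro arg_cong[where f="measure (K n \<tau>)"]) (auto simp: sp_K)
  have "y \<notin> PS_cc Y C n \<tau> x \<alpha> \<delta> \<longleftrightarrow> count_cc (C n) n \<delta> (\<tau>(Suc n := (y, x))) \<le> \<alpha> * (real n + 1)"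
    if z: "(y, x) \<in> space P" for y x
  proof -
    have "count_cc (C n) n \<delta> (\<tau>(Suc n := (y, x))) = 1 + (\<Sum>i=1..n. of_bool
        (C n (n - 1) (y, x) (remove_entry n i \<tau>) \<le> C n (n - 1) (\<tau> i) (remove_entry n i \<tau>) + \<delta>))"
      unfolding count_cc_def using lto_append_last[OF \<tau> z] lto_append_inner[OF \<tau> z] by simp
    then show ?thesis using Y[OF z] by (simp add: PS_cc_def not_less)
  qed
  then show "noncoverage K (PS_cc Y C) n \<tau> \<alpha> \<delta> = level (K n \<tau>) n (count_cc (C n) n \<delta>) \<tau> \<alpha>"
    unfolding noncoverage_def level_def by (intro arg_cong[where f="measure (K n \<tau>)"]) (auto simp: sp_K)
qed

section \<open>The equivalence\<close>

text \<open>
  For variables with values in \<open>[0, 1]\<close>, convergence to \<open>0\<close> in probability is convergence in mean.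
\<close>

lemma tendsto_prob_iff_tendsto_expectation:
  fixes f :: "nat \<Rightarrow> 'a \<Rightarrow> real"
  assumes prob: "\<And>n. n \<ge> k \<Longrightarrow> prob_space (M n)" and meas: "\<And>n. n \<ge> k \<Longrightarrow> f n \<in> borel_measurable (M n)"
    and bounds: "\<And>n \<omega>. n \<ge> k \<Longrightarrow> \<omega> \<in> space (M n) \<Longrightarrow> 0 \<le> f n \<omega>"
      "\<And>n \<omega>. n \<ge> k \<Longrightarrow> \<omega> \<in> space (M n) \<Longrightarrow> f n \<omega> \<le> 1"
  shows "(\<forall>\<epsilon>>0. (\<lambda>n. measure (M n) {\<omega>\<in>space (M n). f n \<omega> \<ge> \<epsilon>}) \<longlonglongrightarrow> 0) \<longleftrightarrow> (\<lambda>n. \<integral>\<omega>. f n \<omega> \<partial>M n) \<longlonglongrightarrow> 0"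
proof -
  have int: "integrable (M n) (f n)" and int2: "integrable (M n) (\<lambda>\<omega>. of_bool (f n \<omega> \<ge> \<epsilon>) :: real)" if n: "n \<ge> k" for n \<epsilon>
  proof -
    interpret prob_space "M n" by (rule prob[OF n])
    note [measurable] = meas[OF n]
    show "integrable (M n) (f n)" using bounds[OF n] by (intro integrable_const_bound[where B=1] AE_I2) auto
    show "integrable (M n) (\<lambda>\<omega>. of_bool (f n \<omega> \<ge> \<epsilon>) :: real)"
      by (intro integrable_const_bound[where B=1] AE_I2) auto
  qed
  show ?thesis
  proof (intro iffI allI impI)
    assume *: "\<forall>\<epsilon>>0. (\<lambda>n. measure (M n) {\<omega>\<in>space (M n). f n \<omega> \<ge> \<epsilon>}) \<longlonglongrightarrow> 0"
    show "(\<lambda>n. \<integral>\<omega>. f n \<omega> \<partial>M n) \<longlonglongrightarrow> 0"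
    proof (rule tendsto_zero_squeeze[where k=k])
      fix n assume "n \<ge> k" then show "0 \<le> (\<integral>\<omega>. f n \<omega> \<partial>M n)" using bounds(1) by (intro integral_nonneg_AE AE_I2) auto
    next
      fix e :: real assume e: "0 < e"
      have "(\<integral>\<omega>. f n \<omega> \<partial>M n) \<le> measure (M n) {\<omega>\<in>space (M n). f n \<omega> \<ge> e} + e" if n: "n \<ge> k" for n
      proof -
        interpret prob_space "M n" by (rule prob[OF n])
        have "(\<integral>\<omega>. f n \<omega> \<partial>M n) \<le> (\<integral>\<omega>. of_bool (f n \<omega> \<ge> e) + e \<partial>M n)"
        proof (rule integral_mono[OF int[OF n]])
          fix \<omega> assume "\<omega> \<in> space (M n)"
          then show "f n \<omega> \<le> of_bool (f n \<omega> \<ge> e) + e"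
            using bounds(2)[OF n, of \<omega>] e by (auto simp: of_bool_def)
        qed (use int2[OF n] in auto)
        also have "\<dots> = measure (M n) {\<omega>\<in>space (M n). f n \<omega> \<ge> e} + e"
          using int2[OF n] prob_space by (simp add: measure_eq_integral_of_bool)
        finally show ?thesis .
      qed
      then show "\<exists>b. b \<longlonglongrightarrow> 0 \<and> (\<forall>n\<ge>k. (\<integral>\<omega>. f n \<omega> \<partial>M n) \<le> b n + e)"
        using * e by (intro exI[of _ "\<lambda>n. measure (M n) {\<omega>\<in>space (M n). f n \<omega> \<ge> e}"]) auto
    qed
  next
    fix e :: real assume *: "(\<lambda>n. \<integral>\<omega>. f n \<omega> \<partial>M n) \<longlonglongrightarrow> 0" and e: "0 < e"
    show "(\<lambda>n. measure (M n) {\<omega>\<in>space (M n). f n \<omega> \<ge> e}) \<longlonglongrightarrow> 0"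
    proof (rule tendsto_sandwich[OF _ _ tendsto_const])
      show "(\<lambda>n. (\<integral>\<omega>. f n \<omega> \<partial>M n) / e) \<longlonglongrightarrow> 0" using tendsto_divide[OF * tendsto_const[of e]] e by simp
      have "measure (M n) {\<omega>\<in>space (M n). f n \<omega> \<ge> e} \<le> (\<integral>\<omega>. f n \<omega> \<partial>M n) / e" if n: "n \<ge> k" for n
      proof -
        have "measure (M n) {\<omega>\<in>space (M n). f n \<omega> \<ge> e} \<le> (\<integral>\<omega>. f n \<omega> / e \<partial>M n)"
          unfolding measure_eq_integral_of_bool
        proof (rule integral_mono[OF int2[OF n]])
          fix \<omega> assume "\<omega> \<in> space (M n)"
          then show "of_bool (f n \<omega> \<ge> e) \<le> f n \<omega> / e"
            using bounds(1)[OF n, of \<omega>] e by (auto simp: of_bool_def)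
        qed (use int[OF n] in auto)
        then show ?thesis by simp
      qed
      then show "\<forall>\<^sub>F n in sequentially. measure (M n) {\<omega>\<in>space (M n). f n \<omega> \<ge> e} \<le> (\<integral>\<omega>. f n \<omega> \<partial>M n) / e"
        by (auto simp: eventually_sequentially)
    qed auto
  qed
qed

text \<open>
  The samples and conditional distributions for all \<open>n\<close>. The probability space may vary with \<open>n\<close>.
\<close>

locale trained_seq = score_seq P c
  for P :: "nat \<Rightarrow> 'z measure" and c +
  fixes M :: "nat \<Rightarrow> 'a measure" and Z :: "nat \<Rightarrow> 'z measure" and t :: "nat \<Rightarrow> nat \<Rightarrow> 'a \<Rightarrow> 'z"
    and K :: "nat \<Rightarrow> (nat \<Rightarrow> 'z) \<Rightarrow> 'z measure"
  assumes trained: "\<And>n. n \<ge> 2 \<Longrightarrow> trained (P n) n (c n) (M n) (Z n) (t n) (K n)"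
begin

abbreviation T where "T n \<omega> \<equiv> training (t n) n \<omega>"
abbreviation excess_K where "excess_K N \<delta> n \<omega> \<equiv> excess (K n (T n \<omega>)) n (N (c n) n \<delta>) (T n \<omega>)"
abbreviation deficit_K where "deficit_K N \<delta> n \<omega> \<equiv> deficit (K n (T n \<omega>)) n (N (c n) n \<delta>) (T n \<omega>)"

lemma mean_eq:
  assumes n: "n \<ge> 2" and N: "near_jk N"
  shows "(\<integral>\<omega>. excess_K N \<delta> n \<omega> \<partial>M n) = mean_excess N \<delta> n"
    "(\<integral>\<omega>. deficit_K N \<delta> n \<omega> \<partial>M n) = mean_deficit N \<delta> n"
  using trained.integral_excess_K[OF trained[OF n]] trained.integral_deficit_K[OF trained[OF n]] N n
  by (auto simp: near_jk_def mean_excess_def mean_deficit_def)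

lemma tendsto_prob_excess_iff:
  assumes N: "near_jk N"
  shows "(\<forall>\<epsilon>>0. (\<lambda>n. measure (M n) {\<omega>\<in>space (M n). excess_K N \<delta> n \<omega> \<ge> \<epsilon>}) \<longlonglongrightarrow> 0)
    \<longleftrightarrow> mean_excess N \<delta> \<longlonglongrightarrow> 0"
proof -
  have meas: "N (c n) n \<delta> \<in> borel_measurable (Qn n)" if "n \<ge> 2" for n
    using N that by (auto simp: near_jk_def)
  have "(\<forall>\<epsilon>>0. (\<lambda>n. measure (M n) {\<omega>\<in>space (M n). excess_K N \<delta> n \<omega> \<ge> \<epsilon>}) \<longlonglongrightarrow> 0)
    \<longleftrightarrow> (\<lambda>n. \<integral>\<omega>. excess_K N \<delta> n \<omega> \<partial>M n) \<longlonglongrightarrow> 0"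
    using trained.prob_M[OF trained] trained.measurable_excess_K[OF trained meas] trained.excess_K_bounds[OF trained meas]
    by (intro tendsto_prob_iff_tendsto_expectation[where k=2]) auto
  also have "\<dots> \<longleftrightarrow> mean_excess N \<delta> \<longlonglongrightarrow> 0"
    by (intro tendsto_cong eventually_sequentiallyI[of 2]) (simp add: mean_eq N)
  finally show ?thesis .
qed

lemma tendsto_expectation_max_iff:
  assumes N: "near_jk N"
  shows "(\<lambda>n. \<integral>\<omega>. max (excess_K N \<delta> n \<omega>) (deficit_K N \<delta> n \<omega>) \<partial>M n) \<longlonglongrightarrow> 0
    \<longleftrightarrow> mean_excess N \<delta> \<longlonglongrightarrow> 0 \<and> mean_deficit N \<delta> \<longlonglongrightarrow> 0"
proof -
  define f g where "f n \<omega> = excess_K N \<delta> n \<omega>" and "g n \<omega> = deficit_K N \<delta> n \<omega>" for n \<omega>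
  have *: "mean_excess N \<delta> n \<le> (\<integral>\<omega>. max (f n \<omega>) (g n \<omega>) \<partial>M n)"
    "mean_deficit N \<delta> n \<le> (\<integral>\<omega>. max (f n \<omega>) (g n \<omega>) \<partial>M n)"
    "(\<integral>\<omega>. max (f n \<omega>) (g n \<omega>) \<partial>M n) \<le> mean_excess N \<delta> n + mean_deficit N \<delta> n" if n: "n \<ge> 2" for n
  proof -
    interpret trained "P n" n "c n" "M n" "Z n" "t n" "K n" by (rule trained[OF n])
    have meas: "N (c n) n \<delta> \<in> borel_measurable Q" using N n by (auto simp: near_jk_def)
    have b: "0 \<le> f n \<omega>" "f n \<omega> \<le> 1" "0 \<le> g n \<omega>" "g n \<omega> \<le> 1" if "\<omega> \<in> space (M n)" for \<omega>
      using excess_K_bounds[OF meas that] by (simp_all add: f_def g_def)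
    have "f n \<in> borel_measurable (M n)" "g n \<in> borel_measurable (M n)"
      using measurable_excess_K[OF meas] measurable_deficit_K[OF meas] by (simp_all add: f_def[abs_def] g_def[abs_def])
    then have int: "integrable (M n) (f n)" "integrable (M n) (g n)"
      using b by (auto intro!: M.integrable_const_bound[where B=1] AE_I2)
    have eq: "mean_excess N \<delta> n = (\<integral>\<omega>. f n \<omega> \<partial>M n)" "mean_deficit N \<delta> n = (\<integral>\<omega>. g n \<omega> \<partial>M n)"
      unfolding f_def g_def using mean_eq[OF n N] by simp_all
    show "mean_excess N \<delta> n \<le> (\<integral>\<omega>. max (f n \<omega>) (g n \<omega>) \<partial>M n)"
      "mean_deficit N \<delta> n \<le> (\<integral>\<omega>. max (f n \<omega>) (g n \<omega>) \<partial>M n)"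
      unfolding eq using int by (auto intro!: integral_mono)
    have "(\<integral>\<omega>. max (f n \<omega>) (g n \<omega>) \<partial>M n) \<le> (\<integral>\<omega>. f n \<omega> + g n \<omega> \<partial>M n)"
      using int b by (intro integral_mono) auto
    also have "\<dots> = mean_excess N \<delta> n + mean_deficit N \<delta> n" unfolding eq using int by simp
    finally show "(\<integral>\<omega>. max (f n \<omega>) (g n \<omega>) \<partial>M n) \<le> mean_excess N \<delta> n + mean_deficit N \<delta> n" .
  qed
  have ev: "\<forall>\<^sub>F n in sequentially. Pr n" if "\<And>n. n \<ge> 2 \<Longrightarrow> Pr n" for Pr
    using that by (rule eventually_sequentiallyI)
  have "(\<lambda>n. \<integral>\<omega>. max (f n \<omega>) (g n \<omega>) \<partial>M n) \<longlonglongrightarrow> 0 \<longleftrightarrow> mean_excess N \<delta> \<longlonglongrightarrow> 0 \<and> mean_deficit N \<delta> \<longlonglongrightarrow> 0"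
  proof (intro iffI conjI; (elim conjE)?)
    assume lim: "(\<lambda>n. \<integral>\<omega>. max (f n \<omega>) (g n \<omega>) \<partial>M n) \<longlonglongrightarrow> 0"
    show "mean_excess N \<delta> \<longlonglongrightarrow> 0"
      by (rule tendsto_sandwich[OF ev ev tendsto_const lim]) (auto intro: near_jk_nonneg[OF N] *)
    show "mean_deficit N \<delta> \<longlonglongrightarrow> 0"
      by (rule tendsto_sandwich[OF ev ev tendsto_const lim]) (auto intro: near_jk_nonneg[OF N] *)
  next
    assume "mean_excess N \<delta> \<longlonglongrightarrow> 0" "mean_deficit N \<delta> \<longlonglongrightarrow> 0"
    from tendsto_add[OF this] have lim: "(\<lambda>n. mean_excess N \<delta> n + mean_deficit N \<delta> n) \<longlonglongrightarrow> 0" by simp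
    show "(\<lambda>n. \<integral>\<omega>. max (f n \<omega>) (g n \<omega>) \<partial>M n) \<longlonglongrightarrow> 0"
      by (rule tendsto_sandwich[OF ev ev tendsto_const lim])
        (auto intro: * order_trans[OF near_jk_nonneg(1)[OF N] *(1)])
  qed
  then show ?thesis unfolding f_def g_def .
qed

end

text \<open>
  The conditional noncoverage probability is only needed through the count that determines it.
\<close>

lemma
  assumes ts: "trained_seq P C M Z t K" and N: "score_seq.near_jk P C N"
    and nc: "\<And>n \<omega> \<alpha> \<delta>. n \<ge> 2 \<Longrightarrow> \<omega> \<in> space (M n) \<Longrightarrow> 0 \<le> \<delta> \<Longrightarrow>
      noncoverage K PS n (training (t n) n \<omega>) \<alpha> \<delta>
        = level (K n (training (t n) n \<omega>)) n (N (C n) n \<delta>) (training (t n) n \<omega>) \<alpha>"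
  shows asymp_conservative_iff: "asymp_conservative M t K PS \<longleftrightarrow> (\<forall>\<delta>>0. score_seq.mean_excess P C N \<delta> \<longlonglongrightarrow> 0)"
    and asymp_exact_iff: "asymp_exact M t K PS \<longleftrightarrow>
      score_seq.mean_excess P C N 0 \<longlonglongrightarrow> 0 \<and> score_seq.mean_deficit P C N 0 \<longlonglongrightarrow> 0"
proof -
  interpret trained_seq P C M Z t K by (rule ts)
  have sup: "(SUP \<alpha>\<in>{0..1}. noncoverage K PS n (T n \<omega>) \<alpha> \<delta> - \<alpha>) = excess_K N \<delta> n \<omega>"
    if "n \<ge> 2" "\<omega> \<in> space (M n)" "0 \<le> \<delta>" for n \<omega> \<delta>
    using nc[OF that] by (simp add: excess_def)
  have "(\<lambda>n. measure (M n) {\<omega>\<in>space (M n). (SUP \<alpha>\<in>{0..1}. noncoverage K PS n (T n \<omega>) \<alpha> \<delta> - \<alpha>) \<ge> \<epsilon>}) \<longlonglongrightarrow> 0 \<longleftrightarrow>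
    (\<lambda>n. measure (M n) {\<omega>\<in>space (M n). excess_K N \<delta> n \<omega> \<ge> \<epsilon>}) \<longlonglongrightarrow> 0" if "\<delta> > 0" for \<delta> \<epsilon>
    using sup[of _ _ \<delta>] that
    by (intro tendsto_cong eventually_sequentiallyI[of 2] arg_cong2[where f=measure] refl Collect_cong conj_cong) auto
  then show "asymp_conservative M t K PS \<longleftrightarrow> (\<forall>\<delta>>0. mean_excess N \<delta> \<longlonglongrightarrow> 0)"
    unfolding asymp_conservative_def tendsto_prob_excess_iff[OF N, symmetric] by blast
  have sup_abs: "(SUP \<alpha>\<in>{0..1}. \<bar>noncoverage K PS n (T n \<omega>) \<alpha> 0 - \<alpha>\<bar>)
    = max (excess_K N 0 n \<omega>) (deficit_K N 0 n \<omega>)"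
    if n: "n \<ge> 2" and \<omega>: "\<omega> \<in> space (M n)" for n \<omega>
  proof -
    have "N (C n) n 0 \<in> borel_measurable (Qn n)" using N n by (auto simp: near_jk_def)
    from unit_mono.SUP_abs_eq_max[OF trained.unit_mono_level_K[OF trained[OF n] this \<omega>]] show ?thesis
      using nc[OF n \<omega>, of 0] by (simp add: excess_def deficit_def)
  qed
  have "asymp_exact M t K PS \<longleftrightarrow> (\<lambda>n. \<integral>\<omega>. max (excess_K N 0 n \<omega>) (deficit_K N 0 n \<omega>) \<partial>M n) \<longlonglongrightarrow> 0"
    unfolding asymp_exact_def using sup_abs
    by (intro tendsto_cong eventually_sequentiallyI[of 2] Bochner_Integration.integral_cong refl) auto
  then show "asymp_exact M t K PS \<longleftrightarrow> mean_excess N 0 \<longlonglongrightarrow> 0 \<and> mean_deficit N 0 \<longlonglongrightarrow> 0"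
    unfolding tendsto_expectation_max_iff[OF N] .
qed

lemma bounded_scores_imp_tight:
  assumes ts: "trained_seq P C M Z t K" and "bounded_scores M t C"
  shows "score_seq.tight P C"
proof -
  interpret trained_seq P C M Z t K by (rule ts)
  show ?thesis unfolding tight_def
  proof (intro allI impI)
    fix e :: real assume e: "0 < e"
    then obtain B where B: "\<And>n. n \<ge> 1 \<Longrightarrow> outer_measure_of (M n)
      {\<omega>\<in>space (M n). ennreal \<bar>C n n (t n (n + 1) \<omega>) (T n \<omega>)\<bar> > ennreal B} \<le> ennreal e"
      using assms(2) unfolding bounded_scores_def stochastically_bounded_def by blast
    have "iid_scores.tail (P n) n (C n) (max 0 B) \<le> e" if n: "n \<ge> 2" for n
    proof -
      interpret trained "P n" n "C n" "M n" "Z n" "t n" "K n" by (rule trained[OF n])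
      have [measurable]: "loo (C n) n (Suc n) \<in> borel_measurable Q" by (rule measurable_loo) simp
      let ?S = "{\<omega>\<in>space (M n). \<bar>C n n (t n (n + 1) \<omega>) (T n \<omega>)\<bar> > max 0 B}"
      have pr: "Measurable.pred Q (\<lambda>w. \<bar>loo (C n) n (Suc n) w\<bar> > max 0 B)" by measurable
      have eq: "{\<omega>\<in>space (M n). \<bar>loo (C n) n (Suc n) ((T n \<omega>)(Suc n := t n (Suc n) \<omega>))\<bar> > max 0 B} = ?S"
        using loo_append_last[OF space_X measurable_space[OF measurable_t]]
        by (auto simp: Suc_eq_plus1[symmetric])
      have S: "?S \<in> sets (M n)"
        unfolding eq[symmetric] using measurable_compose[OF measurable_joint pr] by (simp add: pred_def)
      have "ennreal (measure (M n) ?S) = outer_measure_of (M n) ?S"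
        using S by (simp add: M.emeasure_eq_measure)
      also have "\<dots> \<le> outer_measure_of (M n) {\<omega>\<in>space (M n). ennreal \<bar>C n n (t n (n + 1) \<omega>) (T n \<omega>)\<bar> > ennreal B}"
        by (rule outer_measure_of_mono) (auto intro: ennreal_lessI)
      also have "\<dots> \<le> ennreal e" using B[of n] n by simp
      finally have "measure (M n) ?S \<le> e" using e by (simp add: ennreal_le_iff)
      then show ?thesis unfolding tail_def prob_joint[OF pr, symmetric] eq .
    qed
    then show "\<exists>R. \<forall>n\<ge>2. iid_scores.tail (P n) n (C n) R \<le> e" by blast
  qed
qed

lemma continuous_case_imp_no_ties:
  assumes ts: "trained_seq P C M Z t K" and "continuous_case M t K C"
  shows "score_seq.no_ties P C"
proof -
  interpret trained_seq P C M Z t K by (rule ts)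
  obtain f where f: "\<And>n. n \<ge> 1 \<Longrightarrow> AE \<omega> in M n. (\<forall>x. 0 \<le> f n (T n \<omega>) x) \<and>
        distributed (K n (T n \<omega>)) lborel (\<lambda>z. C n n z (T n \<omega>)) (\<lambda>x. ennreal (f n (T n \<omega>) x))"
    and sb: "stochastically_bounded M (\<lambda>n \<omega>. SUP x. ennreal \<bar>f n (T n \<omega>) x\<bar>)"
    using assms(2) unfolding continuous_case_def by blast
  show ?thesis unfolding no_ties_def
  proof (intro allI impI)
    fix e :: real assume e: "0 < e"
    then have "e / 2 > 0" by simp
    then obtain B where B: "\<And>n. n \<ge> 1 \<Longrightarrow> outer_measure_of (M n)
      {\<omega>\<in>space (M n). (SUP x. ennreal \<bar>f n (T n \<omega>) x\<bar>) > ennreal B} \<le> ennreal (e / 2)"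
      using sb unfolding stochastically_bounded_def by blast
    \<comment> \<open>\<open>B\<close> need not be positive, since \<open>ennreal\<close> truncates negative numbers to \<open>0\<close>\<close>
    define B' where "B' = max B 1"
    define \<eta> where "\<eta> = e / (4 * B')"
    have B': "B' > 0" by (simp add: B'_def)
    have \<eta>: "\<eta> > 0" using e B' by (simp add: \<eta>_def)
    have sum: "e / 2 + 2 * \<eta> * B' = e" using B' by (simp add: \<eta>_def field_simps)
    show "\<exists>\<eta>>0. \<forall>n\<ge>2. \<forall>i\<in>{1..n}. tie_prob \<eta> n i \<le> e"
    proof (intro exI[of _ \<eta>] conjI allI impI ballI \<eta>)
      fix n i :: nat assume n: "n \<ge> 2" and i: "i \<in> {1..n}"
      interpret trained "P n" n "C n" "M n" "Z n" "t n" "K n" by (rule trained[OF n])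
      have "outer_measure_of (M n) {\<omega>\<in>space (M n). (SUP x. ennreal \<bar>f n (T n \<omega>) x\<bar>) > ennreal B'}
        \<le> outer_measure_of (M n) {\<omega>\<in>space (M n). (SUP x. ennreal \<bar>f n (T n \<omega>) x\<bar>) > ennreal B}"
        by (rule outer_measure_of_mono) (auto intro: le_less_trans[OF ennreal_leI[of B B']] simp: B'_def)
      also have "\<dots> \<le> ennreal (e / 2)" using B[of n] n by simp
      finally have outer: "outer_measure_of (M n) {\<omega>\<in>space (M n). (SUP x. ennreal \<bar>f n (T n \<omega>) x\<bar>) > ennreal B'} \<le> ennreal (e / 2)" .
      have n1: "n \<ge> 1" using n by simp
      have "AE \<omega> in M n. distributed (K n (T n \<omega>)) lborel
        (\<lambda>z. loo (C n) n (Suc n) ((T n \<omega>)(Suc n := z))) (\<lambda>x. ennreal (f n (T n \<omega>) x))"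
        using f[OF n1]
      proof (rule AE_mp, intro AE_I2 impI)
        fix \<omega> assume \<omega>: "\<omega> \<in> space (M n)" and d: "(\<forall>x. 0 \<le> f n (T n \<omega>) x) \<and>
          distributed (K n (T n \<omega>)) lborel (\<lambda>z. C n n z (T n \<omega>)) (\<lambda>x. ennreal (f n (T n \<omega>) x))"
        have eq: "loo (C n) n (Suc n) ((T n \<omega>)(Suc n := z)) = C n n z (T n \<omega>)" if "z \<in> space (K n (T n \<omega>))" for z
          using loo_append_last[OF space_X[OF \<omega>]] that by (simp add: space_K[OF \<omega>])
        have "distr (K n (T n \<omega>)) lborel (\<lambda>z. loo (C n) n (Suc n) ((T n \<omega>)(Suc n := z)))
          = distr (K n (T n \<omega>)) lborel (\<lambda>z. C n n z (T n \<omega>))" using eq by (intro distr_cong) auto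
        then show "distributed (K n (T n \<omega>)) lborel
          (\<lambda>z. loo (C n) n (Suc n) ((T n \<omega>)(Suc n := z))) (\<lambda>x. ennreal (f n (T n \<omega>) x))"
          using d eq by (simp add: distributed_def cong: measurable_cong)
      qed
      from near_ties_le[OF this _ _ i _ outer, of \<eta>]
      show "tie_prob \<eta> n i \<le> e"
        using sum B' \<eta> e by simp
    qed
  qed
qed

theorem corollary5p3:
  fixes M :: "nat \<Rightarrow> 'a measure"
    and t :: "nat \<Rightarrow> nat \<Rightarrow> 'a \<Rightarrow> obs"
    and Y :: "nat \<Rightarrow> real set"
    and p :: "nat \<Rightarrow> nat"
    and P :: "nat \<Rightarrow> obs measure"
    and K :: "nat \<Rightarrow> (nat \<Rightarrow> obs) \<Rightarrow> obs measure"
    and C :: score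
  assumes interval: "\<And>n. n \<ge> 1 \<Longrightarrow> is_interval (Y n)"
    and prob_P: "\<And>n. n \<ge> 1 \<Longrightarrow> prob_space (P n)"
    and sets_P: "\<And>n. n \<ge> 1 \<Longrightarrow> sets (P n) = sets (obs_space (Y n) (p n))"
    and prob_M: "\<And>n. n \<ge> 1 \<Longrightarrow> prob_space (M n)"
    and indep: "\<And>n. n \<ge> 1 \<Longrightarrow>
      prob_space.indep_vars (M n) (\<lambda>_. obs_space (Y n) (p n)) (t n) {1..n + 1}"
    and distr: "\<And>n i. n \<ge> 1 \<Longrightarrow> i \<in> {1..n + 1} \<Longrightarrow>
      distr (M n) (obs_space (Y n) (p n)) (t n i) = P n"
    and cond_distr: "\<And>n. n \<ge> 1 \<Longrightarrow>
      regular_cond_distr (M n) (sample_space (Y n) (p n) n) (obs_space (Y n) (p n))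
        (training (t n) n) (t n (n + 1)) (K n)"
    and scores: "conformity_scores Y p C"
    and stable: "stable_scores M t C"
  shows
    "(asymp_conservative M t K (PS_fc Y C) \<longleftrightarrow> asymp_conservative M t K (PS_cc Y C)) \<and>
     (continuous_case M t K C \<longrightarrow>
        (asymp_exact M t K (PS_fc Y C) \<longleftrightarrow> asymp_exact M t K (PS_cc Y C))) \<and>
     (bounded_scores M t C \<longrightarrow>
        asymp_conservative M t K (PS_cc Y C) \<and>
        (continuous_case M t K C \<longrightarrow> asymp_exact M t K (PS_cc Y C)))"
proof -
  define Z where "Z n = obs_space (Y n) (p n)" for n
  have sp: "space (P n) = space (Z n)" if "n \<ge> 1" for n
    using sets_P[OF that] by (auto simp: Z_def dest: sets_eq_imp_space_eq)
  have setsPi: "sets (\<Pi>\<^sub>M i\<in>{1..m}. P n) = sets (sample_space (Y n) (p n) m)" if "n \<ge> 1" for n m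
    unfolding sample_space_def by (intro sets_PiM_cong) (simp_all add: sets_P[OF that])
  have iid: "iid_scores (P n) n (C n)" if n: "n \<ge> 2" for n
  proof -
    have n1: "n \<ge> 1" using n by simp
    interpret prob_space "P n" by (rule prob_P[OF n1])
    show ?thesis
    proof
      show "2 \<le> n" by (rule n)
      fix m :: nat assume m: "1 \<le> m"
      have eq: "sets (P n \<Otimes>\<^sub>M (\<Pi>\<^sub>M i\<in>{1..m}. P n)) = sets (obs_space (Y n) (p n) \<Otimes>\<^sub>M sample_space (Y n) (p n) m)"
        by (intro sets_pair_measure_cong sets_P setsPi n1)
      have "(\<lambda>(z, \<tau>). C n m z \<tau>) \<in> borel_measurable (obs_space (Y n) (p n) \<Otimes>\<^sub>M sample_space (Y n) (p n) m)"
        using scores n1 m unfolding conformity_scores_def by blast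
      then show "(\<lambda>(z, \<tau>). C n m z \<tau>) \<in> borel_measurable (P n \<Otimes>\<^sub>M (\<Pi>\<^sub>M i\<in>{1..m}. P n))"
        by (simp only: measurable_cong_sets[OF eq refl])
      fix z \<tau> \<pi> assume "z \<in> space (P n)" "\<tau> \<in> space (\<Pi>\<^sub>M i\<in>{1..m}. P n)" "\<pi> permutes {1..m}"
      then show "C n m z (\<tau> \<circ> \<pi>) = C n m z \<tau>"
        using scores n1 m unfolding conformity_scores_def sp[OF n1, unfolded Z_def] sets_eq_imp_space_eq[OF setsPi[OF n1]]
        by blast
    qed
  qed
  have tr: "trained (P n) n (C n) (M n) (Z n) (t n) (K n)" if n: "n \<ge> 2" for n
  proof -
    have n1: "n \<ge> 1" using n by simp
    show ?thesis
    proof (intro trained.intro trained_axioms.intro iid[OF n] prob_M[OF n1])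
      show "sets (P n) = sets (Z n)" using sets_P[OF n1] by (simp add: Z_def)
      show "prob_space.indep_vars (M n) (\<lambda>_. Z n) (t n) {1..Suc n}" using indep[OF n1] by (simp add: Z_def Suc_eq_plus1)
      show "distr (M n) (Z n) (t n i) = P n" if "i \<in> {1..Suc n}" for i using distr[OF n1, of i] that by (simp add: Z_def)
      show "regular_cond_distr (M n) (\<Pi>\<^sub>M i\<in>{1..n}. Z n) (Z n) (training (t n) n) (t n (Suc n)) (K n)"
        using cond_distr[OF n1] by (simp add: Z_def sample_space_def Suc_eq_plus1)
    qed
  qed
  have ss: "score_seq P C"
  proof (rule score_seq.intro[OF iid])
    fix \<eta> :: real assume \<eta>: "\<eta> > 0"
    let ?unst = "\<lambda>n. measure (M n) {\<omega>\<in>space (M n).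
        \<bar>C n n (t n (n + 1) \<omega>) (training (t n) n \<omega>)
          - C n (n - 1) (t n (n + 1) \<omega>) (remove_entry n n (training (t n) n \<omega>))\<bar> > \<eta>}"
    have "iid_scores.gap (P n) n (C n) \<eta> = ?unst n" if n: "n \<ge> 2" for n
    proof -
      interpret trained "P n" n "C n" "M n" "Z n" "t n" "K n" by (rule tr[OF n])
      have [measurable]: "loo (C n) n (Suc n) \<in> borel_measurable Q" "lto (C n) n (Suc n) n \<in> borel_measurable Q"
        by (intro measurable_loo measurable_lto; simp)+
      have pr: "Measurable.pred Q (\<lambda>w. \<bar>loo (C n) n (Suc n) w - lto (C n) n (Suc n) n w\<bar> > \<eta>)" by measurable
      have nn: "n \<in> {1..n}" using n by simp
      show ?thesis
        unfolding gap_def prob_joint[OF pr, symmetric]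
        using loo_append_last[OF space_X measurable_space[OF measurable_t]]
          lto_append_last[OF space_X measurable_space[OF measurable_t] nn]
        by (intro arg_cong[where f="measure (M n)"]) (auto simp: Suc_eq_plus1[symmetric])
    qed
    then have "\<forall>\<^sub>F n in sequentially. ?unst n = iid_scores.gap (P n) n (C n) \<eta>"
      by (intro eventually_sequentiallyI[of 2]) simp
    moreover have "(\<lambda>n. ?unst n) \<longlonglongrightarrow> 0"
      using stable \<eta> unfolding stable_scores_def by blast
    ultimately show "(\<lambda>n. iid_scores.gap (P n) n (C n) \<eta>) \<longlonglongrightarrow> 0"
      by (rule Lim_transform_eventually[rotated])
  qed
  have ts: "trained_seq P C M Z t K"
    using ss tr by (intro trained_seq.intro trained_seq_axioms.intro)
  interpret trained_seq P C M Z t K by (rule ts)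
  have fc: "noncoverage K (PS_fc Y C) n (T n \<omega>) \<alpha> \<delta> = level (K n (T n \<omega>)) n (count_fc (C n) n \<delta>) (T n \<omega>) \<alpha>"
    and cc: "noncoverage K (PS_cc Y C) n (T n \<omega>) \<alpha> \<delta> = level (K n (T n \<omega>)) n (count_cc (C n) n \<delta>) (T n \<omega>) \<alpha>"
    if n: "n \<ge> 2" and \<omega>: "\<omega> \<in> space (M n)" and \<delta>: "0 \<le> \<delta>" for n \<omega> \<alpha> \<delta>
  proof -
    interpret trained "P n" n "C n" "M n" "Z n" "t n" "K n" by (rule tr[OF n])
    have "space (P n) = space (obs_space (Y n) (p n))" using sp[of n] n by (simp add: Z_def)
    from noncoverage_fc[where P="P n" and n=n and C=C and Y=Y and p=p and K=K, OF iid[OF n] this space_X[OF \<omega>] space_K[OF \<omega>] \<delta>]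
      noncoverage_cc[where P="P n" and n=n and C=C and Y=Y and p=p and K=K, OF iid[OF n] this space_X[OF \<omega>] space_K[OF \<omega>] \<delta>]
    show "noncoverage K (PS_fc Y C) n (T n \<omega>) \<alpha> \<delta> = level (K n (T n \<omega>)) n (count_fc (C n) n \<delta>) (T n \<omega>) \<alpha>"
      "noncoverage K (PS_cc Y C) n (T n \<omega>) \<alpha> \<delta> = level (K n (T n \<omega>)) n (count_cc (C n) n \<delta>) (T n \<omega>) \<alpha>" by auto
  qed
  have cons_fc: "asymp_conservative M t K (PS_fc Y C) \<longleftrightarrow> (\<forall>\<delta>>0. mean_excess count_jk \<delta> \<longlonglongrightarrow> 0)"
    using asymp_conservative_iff[OF ts near_jk_fc, of "PS_fc Y C"] fc conservative_near_jk_iff[OF near_jk_fc] by simp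
  have cons_cc: "asymp_conservative M t K (PS_cc Y C) \<longleftrightarrow> (\<forall>\<delta>>0. mean_excess count_jk \<delta> \<longlonglongrightarrow> 0)"
    using asymp_conservative_iff[OF ts near_jk_cc, of "PS_cc Y C"] cc conservative_near_jk_iff[OF near_jk_cc] by simp
  have exact_fc: "asymp_exact M t K (PS_fc Y C) \<longleftrightarrow>
      mean_excess count_jk 0 \<longlonglongrightarrow> 0 \<and> mean_deficit count_jk 0 \<longlonglongrightarrow> 0"
    and exact_cc: "asymp_exact M t K (PS_cc Y C) \<longleftrightarrow>
      mean_excess count_jk 0 \<longlonglongrightarrow> 0 \<and> mean_deficit count_jk 0 \<longlonglongrightarrow> 0" if nt: no_ties
    using asymp_exact_iff[OF ts near_jk_fc, of "PS_fc Y C"] fc exact_near_jk_iff[OF near_jk_fc nt]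
      asymp_exact_iff[OF ts near_jk_cc, of "PS_cc Y C"] cc exact_near_jk_iff[OF near_jk_cc nt] by simp_all
  show ?thesis
  proof (intro conjI impI)
    show "asymp_conservative M t K (PS_fc Y C) \<longleftrightarrow> asymp_conservative M t K (PS_cc Y C)"
      unfolding cons_fc cons_cc by (rule refl)
  next
    assume "continuous_case M t K C"
    then have nt: no_ties by (rule continuous_case_imp_no_ties[OF ts])
    show "asymp_exact M t K (PS_fc Y C) \<longleftrightarrow> asymp_exact M t K (PS_cc Y C)"
      unfolding exact_fc[OF nt] exact_cc[OF nt] by (rule refl)
  next
    assume "bounded_scores M t C"
    then have tight by (rule bounded_scores_imp_tight[OF ts])
    then show "asymp_conservative M t K (PS_cc Y C)"
      unfolding cons_cc using conservative_jk by blast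
  next
    assume "bounded_scores M t C" "continuous_case M t K C"
    then have tight and nt: no_ties
      using bounded_scores_imp_tight[OF ts] continuous_case_imp_no_ties[OF ts] by auto
    then show "asymp_exact M t K (PS_cc Y C)"
      unfolding exact_cc[OF nt] using exact_jk by blast
  qed
qed

end
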